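(* Let $C$ be an elliptic curve over $\mathbb{C}$, let $P,Q\in C$ be closed points, and let $E=\mathcal{O}_C(2P)\oplus\mathcal{O}_C(bQ)$ with $b\ge3$ an integer. Then $\overline{\mathbf{R}_2(E)}$ and $\mathbf{R}_b(E)$ are the irreducible components of the resonance variety $\mathbf{R}(E)$.
   Context: We work over $\mathbb{C}$. An elliptic curve is a smooth projective (irreducible) curve of genus $1$. For a vector space $V$, $\mathbb{P}V$ denotes the projective space of one-dimensional subspaces of $V$. For a vector bundle $E$ of rank at least two on a smooth projective curve $C$, let $d_2:\bigwedge^2H^0(C,E)\to H^0(C,\bigwedge^2E)$ be the second determinant map, $s\wedge t\mapsto (x\mapsto s(x)\wedge t(x))$. The (projectivized) resonance variety of $E$ is $$\mathbf{R}(E)=\{[s]\in\mathbb{P}H^0(C,E) : \exists\, t\in H^0(C,E)\text{ with } 0\ne s\wedge t\in\ker(d_2)\},$$ i.e. the locus of classes of sections $s$ for which there is a section $t$, linearly independent from $s$, such that $s,t$ generate a rank-one subsheaf of $E$. Such a section $s$ is called resonant. A sub-line bundle of $E$ is a locally free subsheaf of $E$ of rank one; it is a subpencil if it has at least two linearly independent global sections; it is saturated if the quotient of $E$ by it is torsion-free. The saturation of a subsheaf $\mathcal{F}\subseteq E$ is $\mathcal{F}^{\mathrm{sat}}=\ker\big(E\to (E/\mathcal{F})/\mathrm{tors}(E/\mathcal{F})\big)$. For a resonant section $s$, the saturation of the subsheaf generated by $s$ is a saturated subpencil of $E$. The stratum $\mathbf{R}_d(E)\subseteq\mathbf{R}(E)$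 is the set of classes $[s]$ of resonant sections for which this saturated subpencil has degree $d$. The sets $\mathbf{R}_d(E)$ are locally closed and $\mathbf{R}(E)$ is their disjoint union over $d\ge1$. $\overline{\mathbf{R}_d(E)}$ denotes the closure in $\mathbb{P}H^0(C,E)$. *)

theory Defs
  imports "HOL-Analysis.Analysis" "HOL-Library.Poly_Mapping"
begin

section \<open>Polynomials in several variables\<close>

type_synonym 'i mpoly = "('i \<Rightarrow>\<^sub>0 nat) \<Rightarrow>\<^sub>0 complex"

text \<open>
  The value at \<open>v\<close> of a complex polynomial, its coefficients being transported by
  \<open>h\<close> (the inclusion of the complex numbers in a field extension).
\<close>

definition peval :: "(complex \<Rightarrow> 'k::comm_ring_1) \<Rightarrow> 'i mpoly \<Rightarrow> ('i \<Rightarrow> 'k) \<Rightarrow> 'k" where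
  "peval h F v =
     (\<Sum>m\<in>Poly_Mapping.keys F. h (Poly_Mapping.lookup F m) *
        (\<Prod>i\<in>Poly_Mapping.keys m. v i ^ Poly_Mapping.lookup m i))"

definition homogeneous :: "nat \<Rightarrow> 'i mpoly \<Rightarrow> bool" where
  "homogeneous d F \<longleftrightarrow>
     (\<forall>m\<in>Poly_Mapping.keys F. (\<Sum>i\<in>Poly_Mapping.keys m. Poly_Mapping.lookup m i) = d)"

definition alg_independent :: "(complex \<Rightarrow> 'k::field) \<Rightarrow> 'k set \<Rightarrow> bool" where
  "alg_independent h S \<longleftrightarrow>
     (\<forall>F :: 'k mpoly. (\<forall>m\<in>Poly_Mapping.keys F. Poly_Mapping.keys m \<subseteq> S) \<longrightarrow>
        peval h F (\<lambda>x. x) = 0 \<longrightarrow> F = 0)"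

definition has_trdeg :: "(complex \<Rightarrow> 'k::field) \<Rightarrow> nat \<Rightarrow> bool" where
  "has_trdeg h n \<longleftrightarrow>
     (\<exists>S. finite S \<and> card S = n \<and> alg_independent h S \<and>
        (\<forall>T. alg_independent h T \<and> S \<subseteq> T \<longrightarrow> T = S))"


section \<open>Projective spaces and the Zariski topology\<close>

text \<open>
  \<open>V\<close> is a finite-dimensional complex linear subspace of an ambient type on which the
  complex numbers act by \<open>sc\<close>.
\<close>

definition pline :: "(complex \<Rightarrow> 'v \<Rightarrow> 'v) \<Rightarrow> 'v \<Rightarrow> 'v set" where
  "pline sc v = range (\<lambda>c. sc c v)"

definition proj :: "(complex \<Rightarrow> 'v::ab_group_add \<Rightarrow> 'v) \<Rightarrow> 'v set \<Rightarrow> 'v set set" where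
  "proj sc V = {pline sc v | v. v \<in> V \<and> v \<noteq> 0}"

definition functional_on ::
    "(complex \<Rightarrow> 'v::ab_group_add \<Rightarrow> 'v) \<Rightarrow> 'v set \<Rightarrow> ('v \<Rightarrow> complex) \<Rightarrow> bool" where
  "functional_on sc V \<phi> \<longleftrightarrow>
     (\<forall>u\<in>V. \<forall>v\<in>V. \<phi> (u + v) = \<phi> u + \<phi> v) \<and> (\<forall>c. \<forall>v\<in>V. \<phi> (sc c v) = c * \<phi> v)"

text \<open>
  The elements of \<open>Sym\<^sup>d V\<^sup>*\<close>: homogeneous polynomials of degree \<open>d\<close> in (finitely many)
  linear functionals, so that no basis of \<open>V\<close> has to be chosen.
\<close>

definition homogeneous_form ::
    "(complex \<Rightarrow> 'v::ab_group_add \<Rightarrow> 'v) \<Rightarrow> 'v set \<Rightarrow> nat \<Rightarrow> ('v \<Rightarrow> complex) \<Rightarrow> bool" where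
  "homogeneous_form sc V d f \<longleftrightarrow>
     (\<exists>(F :: nat mpoly) \<phi>. homogeneous d F \<and> (\<forall>i. functional_on sc V (\<phi> i)) \<and>
        f = (\<lambda>v. peval (\<lambda>c. c) F (\<lambda>i. \<phi> i v)))"

text \<open>
  The topology on \<open>proj sc V\<close> whose basic open sets are the loci where a homogeneous form does
  not vanish; the constant form of degree \<open>0\<close> gives the whole space.
\<close>

definition zariski ::
    "(complex \<Rightarrow> 'v::ab_group_add \<Rightarrow> 'v) \<Rightarrow> 'v set \<Rightarrow> 'v set topology" where
  "zariski sc V =
     topology_generated_by
       {{L \<in> proj sc V. \<exists>v\<in>L. f v \<noteq> 0} | f d. homogeneous_form sc V d f}"

definition irreducible_space :: "'a topology \<Rightarrow> bool" where
  "irreducible_space T \<longleftrightarrow> topspace T \<noteq> {} \<and>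
     (\<forall>A B. closedin T A \<and> closedin T B \<and> A \<union> B = topspace T \<longrightarrow>
        A = topspace T \<or> B = topspace T)"

definition irreducible_components :: "'a topology \<Rightarrow> 'a set set" where
  "irreducible_components T =
     {Z. Z \<subseteq> topspace T \<and> irreducible_space (subtopology T Z) \<and>
         (\<forall>Y. Y \<subseteq> topspace T \<and> irreducible_space (subtopology T Y) \<and> Z \<subseteq> Y \<longrightarrow> Y = Z)}"


section \<open>Projective varieties and their function fields\<close>

text \<open>A point of projective space is a one-dimensional subspace of \<open>complex ^ 'n\<close>.\<close>

type_synonym 'n ppoint = "(complex ^ 'n) set"

text \<open>
  A projective variety \<open>pts\<close> in the projective space of \<open>complex ^ 'n\<close>, with its function
  field \<open>'k\<close>: \<open>const\<close> is the inclusion of the constants, and \<open>coord\<close> are homogeneous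
  coordinates of the generic point, i.e. \<open>coord i / coord j\<close> is the rational function
  \<open>x\<^sub>i / x\<^sub>j\<close> whenever \<open>x\<^sub>j\<close> does not vanish identically on the variety.
\<close>

record ('n::finite, 'k) variety_data =
  pts :: "'n ppoint set"
  const :: "complex \<Rightarrow> 'k"
  coord :: "'n \<Rightarrow> 'k"

text \<open>
  The last two conditions say that \<open>F / G \<mapsto> F(coord) / G(coord)\<close>, for homogeneous \<open>F\<close>, \<open>G\<close> of
  the same degree with \<open>G\<close> not in the ideal of \<open>pts\<close>, is a well-defined isomorphism from the
  field of rational functions on \<open>pts\<close> onto \<open>'k\<close>. Any model of the function field is
  allowed; it is unique up to isomorphism.
\<close>

definition projective_variety :: "('n::finite, 'k::field) variety_data \<Rightarrow> bool" where
  "projective_variety C \<longleftrightarrow>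
     closedin (zariski (*s) UNIV) (pts C) \<and>
     irreducible_space (subtopology (zariski (*s) UNIV) (pts C)) \<and>
     const C 1 = 1 \<and>
     (\<forall>a b. const C (a + b) = const C a + const C b) \<and>
     (\<forall>a b. const C (a * b) = const C a * const C b) \<and>
     (\<forall>d F. homogeneous d F \<longrightarrow>
        (peval (const C) F (coord C) = 0 \<longleftrightarrow>
         (\<forall>x\<in>pts C. \<forall>a\<in>x. peval (\<lambda>c. c) F (\<lambda>i. a $ i) = 0))) \<and>
     (\<forall>f. \<exists>d F G. homogeneous d F \<and> homogeneous d G \<and> peval (const C) G (coord C) \<noteq> 0 \<and>
        f = peval (const C) F (coord C) / peval (const C) G (coord C))"

text \<open>The rational functions that are regular at \<open>x\<close>.\<close>

definition local_ring :: "('n::finite, 'k::field) variety_data \<Rightarrow> 'n ppoint \<Rightarrow> 'k set" where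
  "local_ring C x =
     {peval (const C) F (coord C) / peval (const C) G (coord C) | F G d.
        homogeneous d F \<and> homogeneous d G \<and> (\<exists>a\<in>x. peval (\<lambda>c. c) G (\<lambda>i. a $ i) \<noteq> 0)}"

definition local_unit :: "('n::finite, 'k::field) variety_data \<Rightarrow> 'n ppoint \<Rightarrow> 'k \<Rightarrow> bool" where
  "local_unit C x u \<longleftrightarrow> u \<noteq> 0 \<and> u \<in> local_ring C x \<and> inverse u \<in> local_ring C x"

definition max_ideal :: "('n::finite, 'k::field) variety_data \<Rightarrow> 'n ppoint \<Rightarrow> 'k set" where
  "max_ideal C x = {f \<in> local_ring C x. \<not> local_unit C x f}"

definition uniformizer :: "('n::finite, 'k::field) variety_data \<Rightarrow> 'n ppoint \<Rightarrow> 'k \<Rightarrow> bool" where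
  "uniformizer C x t \<longleftrightarrow> max_ideal C x = {g * t | g. g \<in> local_ring C x}"


section \<open>Smooth projective curves and their genus\<close>

text \<open>
  The dimension of a variety is the transcendence degree of its function field, and smoothness
  means that all local rings are regular, i.e. (in dimension one) that their maximal ideals are
  generated by a single element.
\<close>

definition smooth_projective_curve :: "('n::finite, 'k::field) variety_data \<Rightarrow> bool" where
  "smooth_projective_curve C \<longleftrightarrow>
     projective_variety C \<and> has_trdeg (const C) 1 \<and> (\<forall>x\<in>pts C. \<exists>t. uniformizer C x t)"

definition repartitions :: "('n::finite, 'k::field) variety_data \<Rightarrow> ('n ppoint \<Rightarrow> 'k) set" where
  "repartitions C = {a. finite {x \<in> pts C. a x \<notin> local_ring C x}}"

text \<open>
  The genus is the dimension of \<open>H\<^sup>1(C, O\<^sub>C)\<close>. The flasque resolution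
  \<open>0 \<rightarrow> O\<^sub>C \<rightarrow> K \<rightarrow> K/O\<^sub>C \<rightarrow> 0\<close>, with \<open>K\<close> the constant sheaf of rational functions, identifies
  this space with the quotient of the space of repartitions by the sum of \<open>K\<close> and the
  everywhere regular repartitions; \<open>B\<close> below represents a basis of this quotient.
\<close>

definition has_genus :: "('n::finite, 'k::field) variety_data \<Rightarrow> nat \<Rightarrow> bool" where
  "has_genus C g \<longleftrightarrow>
     (\<exists>B \<subseteq> repartitions C. finite B \<and> card B = g \<and>
        (\<forall>a\<in>repartitions C. \<exists>!c. c \<in> (B \<rightarrow>\<^sub>E UNIV) \<and>
           (\<exists>f. \<forall>x\<in>pts C. a x - (\<Sum>b\<in>B. const C (c b) * b x) - f \<in> local_ring C x)))"

definition elliptic_curve :: "('n::finite, 'k::field) variety_data \<Rightarrow> bool" where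
  "elliptic_curve C \<longleftrightarrow> smooth_projective_curve C \<and> has_genus C 1"


section \<open>Line bundles and vector bundles\<close>

text \<open>
  A torsion-free sheaf on a curve is given as a subsheaf of a constant sheaf \<open>K\<^sup>r\<close> by the family
  of its stalks, indexed by the closed points.
\<close>

definition ord_at :: "('n::finite, 'k::field) variety_data \<Rightarrow> 'n ppoint \<Rightarrow> 'k \<Rightarrow> int" where
  "ord_at C x f = (THE n. \<exists>t u. uniformizer C x t \<and> local_unit C x u \<and> f = t powi n * u)"

definition multiple_point :: "int \<Rightarrow> 'n::finite ppoint \<Rightarrow> 'n ppoint \<Rightarrow> int" where
  "multiple_point n P = (\<lambda>x. if x = P then n else 0)"

text \<open>The sheaf \<open>O\<^sub>C(D)\<close>.\<close>

definition line_bundle ::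
    "('n::finite, 'k::field) variety_data \<Rightarrow> ('n ppoint \<Rightarrow> int) \<Rightarrow> 'n ppoint \<Rightarrow> 'k set" where
  "line_bundle C D x = {f. f = 0 \<or> ord_at C x f + D x \<ge> 0}"

definition direct_sum ::
    "('n::finite ppoint \<Rightarrow> 'k::field set) \<Rightarrow> ('n ppoint \<Rightarrow> 'k set) \<Rightarrow> 'n ppoint \<Rightarrow> ('k ^ 2) set" where
  "direct_sum L M x = {v. v $ 1 \<in> L x \<and> v $ 2 \<in> M x}"

definition global_sections ::
    "('n::finite, 'k::field) variety_data \<Rightarrow> ('n ppoint \<Rightarrow> ('k ^ 'r) set) \<Rightarrow> ('k ^ 'r) set" where
  "global_sections C E = {s. \<forall>x\<in>pts C. s \<in> E x}"

definition cscale ::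
    "('n::finite, 'k::field) variety_data \<Rightarrow> complex \<Rightarrow> 'k ^ 'r \<Rightarrow> 'k ^ 'r" where
  "cscale C c v = const C c *s v"

text \<open>
  The order of vanishing at \<open>x\<close> of a nonzero rational section \<open>\<sigma>\<close> of a sheaf whose stalk \<open>M\<close>
  at \<open>x\<close> is free of rank one, generated by \<open>e\<close>.
\<close>

definition section_ord ::
    "('n::finite, 'k::field) variety_data \<Rightarrow> 'n ppoint \<Rightarrow> ('k ^ 'r) set \<Rightarrow> 'k ^ 'r \<Rightarrow> int" where
  "section_ord C x M \<sigma> =
     (THE n. \<exists>t e. uniformizer C x t \<and> M = {g *s e | g. g \<in> local_ring C x} \<and>
        \<sigma> = (t powi n) *s e)"

text \<open>
  The degree of a sub-line bundle \<open>L\<close> of a vector bundle: the degree of the divisor of any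
  nonzero rational section of \<open>L\<close>.
\<close>

definition sub_line_bundle_degree ::
    "('n::finite, 'k::field) variety_data \<Rightarrow> ('n ppoint \<Rightarrow> ('k ^ 'r) set) \<Rightarrow> int" where
  "sub_line_bundle_degree C L =
     (THE d. \<exists>\<sigma>. \<sigma> \<noteq> 0 \<and> (\<exists>x\<in>pts C. \<exists>e\<in>L x. \<exists>h. \<sigma> = h *s e) \<and>
        d = (\<Sum>x | x \<in> pts C \<and> section_ord C x (L x) \<sigma> \<noteq> 0. section_ord C x (L x) \<sigma>))"

text \<open>
  The saturation of the subsheaf \<open>F = O\<^sub>C s\<close> of \<open>E\<close>, i.e. the kernel of
  \<open>E \<rightarrow> (E/F)/tors(E/F)\<close>: germs having a nonzero multiple in \<open>F\<close>.
\<close>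

definition saturation ::
    "('n::finite, 'k::field) variety_data \<Rightarrow> ('n ppoint \<Rightarrow> ('k ^ 'r) set) \<Rightarrow> 'k ^ 'r \<Rightarrow>
       'n ppoint \<Rightarrow> ('k ^ 'r) set" where
  "saturation C E s x =
     {v \<in> E x. \<exists>h\<in>local_ring C x. h \<noteq> 0 \<and> (\<exists>g\<in>local_ring C x. h *s v = g *s s)}"


section \<open>Resonance\<close>

definition lin_independent2 ::
    "('n::finite, 'k::field) variety_data \<Rightarrow> 'k ^ 'r \<Rightarrow> 'k ^ 'r \<Rightarrow> bool" where
  "lin_independent2 C s t \<longleftrightarrow>
     (\<forall>a b. cscale C a s + cscale C b t = 0 \<longrightarrow> a = 0 \<and> b = 0)"

text \<open>
  The second determinant map on \<open>s \<wedge> t\<close>; elements of the second exterior power of \<open>K\<^sup>r\<close>, which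
  contains the sections of the second exterior power of \<open>E\<close>, are written as alternating matrices.
\<close>

definition det2 :: "'k::field ^ 'r \<Rightarrow> 'k ^ 'r \<Rightarrow> 'k ^ 'r ^ 'r" where
  "det2 s t = (\<chi> i j. s $ i * t $ j - s $ j * t $ i)"

text \<open>
  Over the complex numbers \<open>s \<wedge> t \<noteq> 0\<close> means that \<open>s\<close> and \<open>t\<close> are linearly independent.
\<close>

definition resonant ::
    "('n::finite, 'k::field) variety_data \<Rightarrow> ('n ppoint \<Rightarrow> ('k ^ 'r) set) \<Rightarrow> 'k ^ 'r \<Rightarrow> bool" where
  "resonant C E s \<longleftrightarrow> s \<in> global_sections C E \<and>
     (\<exists>t\<in>global_sections C E. lin_independent2 C s t \<and> det2 s t = 0)"

definition resonance_variety ::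
    "('n::finite, 'k::field) variety_data \<Rightarrow> ('n ppoint \<Rightarrow> ('k ^ 'r) set) \<Rightarrow>
       ('k ^ 'r) set set" where
  "resonance_variety C E = {pline (cscale C) s | s. resonant C E s}"

definition resonance_stratum ::
    "('n::finite, 'k::field) variety_data \<Rightarrow> ('n ppoint \<Rightarrow> ('k ^ 'r) set) \<Rightarrow> int \<Rightarrow>
       ('k ^ 'r) set set" where
  "resonance_stratum C E d =
     {pline (cscale C) s | s. resonant C E s \<and> sub_line_bundle_degree C (saturation C E s) = d}"

text \<open>The projective space of \<open>H\<^sup>0(C, E)\<close> with its Zariski topology.\<close>

definition proj_sections ::
    "('n::finite, 'k::field) variety_data \<Rightarrow> ('n ppoint \<Rightarrow> ('k ^ 'r) set) \<Rightarrow>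
       ('k ^ 'r) set topology" where
  "proj_sections C E = zariski (cscale C) (global_sections C E)"

end

theory Submission
  imports Defs "HOL-Library.Function_Algebras"
begin

text \<open>
  Since the function field \<open>K\<close> has transcendence degree one, any two of its elements are
  algebraically dependent; this makes the local rings of \<open>C\<close> discrete valuation rings and the
  supports of principal divisors finite. One-dimensionality of \<open>H\<^sup>1(O)\<close> gives \<open>H\<^sup>0(O) = \<complex>\<close>, because
  a nonconstant regular function would act on \<open>H\<^sup>1(O)\<close> with an eigenvalue, whereas repartitions are
  divisible. Adding one point at a time, \<open>h\<^sup>0(D) = deg D + h\<^sup>1(D)\<close> for effective \<open>D\<close>, and
  \<open>h\<^sup>1(x) = 0\<close> for every point \<open>x\<close>, since otherwise there would be a function with one simple pole and the
  genus would be \<open>0\<close>. Hence \<open>h\<^sup>0(D) = deg D\<close> whenever \<open>deg D > 0\<close>, and principal divisors have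
  degree \<open>0\<close>.

  A section \<open>(f, g)\<close> is proportional over \<open>K\<close> to an independent one iff the divisor of its
  saturation has degree at least two. If \<open>f \<noteq> 0\<close>, that divisor is bounded by the divisor of \<open>f\<close>, of
  degree two, so the condition is \<open>g = f k\<close> with \<open>k \<in> H\<^sup>0(O(bQ - 2P))\<close>. Thus \<open>R\<^sub>b\<close> is the linear space
  \<open>f = 0\<close>, \<open>R\<^sub>2\<close> is parametrized by pairs \<open>(f, k)\<close>, and their union is a determinantal locus, hence
  closed. Finally \<open>R\<^sub>b\<close> is not contained in the closure of \<open>R\<^sub>2\<close>, because the products \<open>f k\<close> satisfy a
  homogeneous equation on \<open>H\<^sup>0(O(bQ))\<close>, by a count of monomials.
\<close>

section \<open>Polynomials in several variables\<close>

text \<open>Two counts carry the argument: that any two functions are algebraically dependent, and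
  that the products f k satisfy an equation. Both only compare a number of monomials with the size
  of a spanning set, so they need no theory of field extensions or of dimension. In the second count
  the products, up to scaling, depend on b - 2 parameters, while b homogeneous coordinates leave b -
  1 dimensions.

  Riemann-Roch is obtained without duality: for effective D, H^1(O(D)) is a quotient of the line
  H^1(O), so it is recorded by the truth value \<open>special D\<close>, and each induction step
  decides whether the functional \<open>\<omega>\<close> vanishes on the repartitions with poles
  bounded by D.

  Irreducibility is shown by joining any two points of a family by a curve along which linear
  functionals are polynomials in one parameter: finitely many parameters are bad for each of two
  open sets, so the two sets meet.

  The degree of a saturation enters only through the divisor \<open>min_div s\<close>: the multiples
  of s lying in E are exactly the c s with c in \<open>LL (min_div s)\<close>.\<close>

definition meval :: "('i \<Rightarrow>\<^sub>0 nat) \<Rightarrow> ('i \<Rightarrow> 'k::comm_ring_1) \<Rightarrow> 'k" where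
  "meval m v = (\<Prod>i\<in>Poly_Mapping.keys m. v i ^ Poly_Mapping.lookup m i)"

definition mdeg :: "('i \<Rightarrow>\<^sub>0 nat) \<Rightarrow> nat" where
  "mdeg m = (\<Sum>i\<in>Poly_Mapping.keys m. Poly_Mapping.lookup m i)"

lemma peval_meval: "peval h F v = (\<Sum>m\<in>Poly_Mapping.keys F. h (Poly_Mapping.lookup F m) * meval m v)"
  by (simp add: peval_def meval_def)

lemma homogeneous_mdeg: "homogeneous d F \<longleftrightarrow> (\<forall>m\<in>Poly_Mapping.keys F. mdeg m = d)"
  by (simp add: homogeneous_def mdeg_def)

text \<open>Absent variables have exponent 0 and contribute the factor 1; enlarging the support lets
  two monomials be compared over one index set.\<close>

lemma meval_superset:
  assumes "finite A" "Poly_Mapping.keys m \<subseteq> A"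
  shows "meval m v = (\<Prod>i\<in>A. v i ^ Poly_Mapping.lookup m i)"
  unfolding meval_def
  by (rule prod.mono_neutral_left) (use assms in \<open>auto simp: in_keys_iff\<close>)

lemma mdeg_superset:
  assumes "finite A" "Poly_Mapping.keys m \<subseteq> A"
  shows "mdeg m = (\<Sum>i\<in>A. Poly_Mapping.lookup m i)"
  unfolding mdeg_def
  by (rule sum.mono_neutral_left) (use assms in \<open>auto simp: in_keys_iff\<close>)

lemma meval_add: "meval (m + n) v = meval m v * meval n v"
proof -
  let ?A = "Poly_Mapping.keys m \<union> Poly_Mapping.keys n"
  have "Poly_Mapping.keys (m + n) \<subseteq> ?A"
    by (rule Poly_Mapping.keys_add)
  then show ?thesis
    by (simp add: meval_superset[of ?A] lookup_add power_add prod.distrib)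
qed

lemma mdeg_add: "mdeg (m + n) = mdeg m + mdeg n"
proof -
  let ?A = "Poly_Mapping.keys m \<union> Poly_Mapping.keys n"
  have "Poly_Mapping.keys (m + n) \<subseteq> ?A"
    by (rule Poly_Mapping.keys_add)
  then show ?thesis
    by (simp add: mdeg_superset[of ?A] lookup_add sum.distrib)
qed

lemma meval_0 [simp]: "meval 0 v = 1"
  and mdeg_0 [simp]: "mdeg 0 = 0"
  by (simp_all add: meval_def mdeg_def)

lemma meval_single [simp]: "meval (Poly_Mapping.single i e) v = v i ^ e"
  and mdeg_single [simp]: "mdeg (Poly_Mapping.single i e) = e"
  by (auto simp: meval_def mdeg_def)

lemma meval_sum: "meval (\<Sum>j\<in>J. m j) v = (\<Prod>j\<in>J. meval (m j) v)"
  by (induction J rule: infinite_finite_induct) (simp_all add: meval_add)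

lemma mdeg_sum: "mdeg (\<Sum>j\<in>J. m j) = (\<Sum>j\<in>J. mdeg (m j))"
  by (induction J rule: infinite_finite_induct) (simp_all add: mdeg_add)

lemma meval_scale: "meval m (\<lambda>i. c * v i) = c ^ mdeg m * meval m v"
  unfolding meval_def mdeg_def power_mult_distrib prod.distrib power_sum ..

text \<open>Instantiated with \<open>const C\<close> and with the identity of the complex numbers,
  so that evaluation at the generic point and at an actual point obey the same rules.\<close>

locale field_embedding =
  fixes h :: "complex \<Rightarrow> 'k::field"
  assumes h_1: "h 1 = 1"
    and h_add: "h (a + b) = h a + h b"
    and h_mult: "h (a * b) = h a * h b"
begin

lemma h_0: "h 0 = 0"
  using h_add[of 0 0] by (metis add_cancel_right_right)

lemma h_minus: "h (- a) = - h a"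
  using h_add[of a "-a"] by (simp add: eq_neg_iff_add_eq_0 add.commute h_0)

lemma h_diff: "h (a - b) = h a - h b"
  using h_add[of a "-b"] by (simp add: h_minus)

lemma h_eq_0_iff: "h a = 0 \<longleftrightarrow> a = 0"
proof
  assume "h a = 0"
  then show "a = 0"
    using h_mult[of a "inverse a"] by (cases "a = 0") (auto simp: h_1)
qed (simp add: h_0)

lemma h_eq_iff: "h a = h b \<longleftrightarrow> a = b"
  using h_eq_0_iff[of "a - b"] by (simp add: h_diff)

lemma h_inverse: "h (inverse a) = inverse (h a)"
  by (cases "a = 0") (auto intro!: inverse_unique[symmetric] simp: h_0 h_1 simp flip: h_mult)

lemma peval_superset:
  assumes "finite A" "Poly_Mapping.keys F \<subseteq> A"
  shows "peval h F v = (\<Sum>m\<in>A. h (Poly_Mapping.lookup F m) * meval m v)"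
  unfolding peval_meval
  by (rule sum.mono_neutral_left) (use assms in \<open>auto simp: in_keys_iff h_0\<close>)

lemma peval_0 [simp]: "peval h 0 v = 0"
  by (simp add: peval_def)

lemma peval_add: "peval h (F + G) v = peval h F v + peval h G v"
proof -
  let ?A = "Poly_Mapping.keys F \<union> Poly_Mapping.keys G"
  have "Poly_Mapping.keys (F + G) \<subseteq> ?A"
    by (rule Poly_Mapping.keys_add)
  then show ?thesis
    by (simp add: peval_superset[of ?A] lookup_add sum.distrib h_add algebra_simps)
qed

lemma peval_single [simp]: "peval h (Poly_Mapping.single m c) v = h c * meval m v"
  by (auto simp: peval_meval h_0)

lemma peval_sum: "peval h (\<Sum>j\<in>J. F j) v = (\<Sum>j\<in>J. peval h (F j) v)"
  by (induction J rule: infinite_finite_induct) (simp_all add: peval_add)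

lemma peval_mult: "peval h (F * G) v = peval h F v * peval h G v"
proof -
  \<comment> \<open>Writing both factors as sums of their terms reduces the product to
    \<open>mult_single\<close>.\<close>
  have expand: "H = (\<Sum>m\<in>Poly_Mapping.keys H. Poly_Mapping.single m (Poly_Mapping.lookup H m))"
    for H :: "'i mpoly"
  proof (rule poly_mapping_eqI)
    fix k
    show "Poly_Mapping.lookup H k = Poly_Mapping.lookup
        (\<Sum>m\<in>Poly_Mapping.keys H. Poly_Mapping.single m (Poly_Mapping.lookup H m)) k"
      by (cases "k \<in> Poly_Mapping.keys H")
         (simp_all add: lookup_sum lookup_single when_def in_keys_iff)
  qed
  have "F * G = (\<Sum>m\<in>Poly_Mapping.keys F. \<Sum>n\<in>Poly_Mapping.keys G.
      Poly_Mapping.single (m + n) (Poly_Mapping.lookup F m * Poly_Mapping.lookup G n))"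
    using arg_cong2[OF expand[of F] expand[of G], of "(*)"]
    by (simp only: sum_product mult_single)
  then have "peval h (F * G) v = (\<Sum>m\<in>Poly_Mapping.keys F. \<Sum>n\<in>Poly_Mapping.keys G.
      h (Poly_Mapping.lookup F m * Poly_Mapping.lookup G n) * meval (m + n) v)"
    by (simp add: peval_sum)
  also have "\<dots> = peval h F v * peval h G v"
    by (simp add: peval_meval sum_product h_mult meval_add mult_ac)
  finally show ?thesis .
qed

end

interpretation complex_id: field_embedding "\<lambda>c::complex. c"
  by unfold_locales auto

lemma homogeneous_0 [simp]: "homogeneous d 0"
  by (simp add: homogeneous_def)

lemma homogeneous_add: "homogeneous d F \<Longrightarrow> homogeneous d G \<Longrightarrow> homogeneous d (F + G)"
  using Poly_Mapping.keys_add[of F G] by (auto simp: homogeneous_mdeg)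

lemma homogeneous_sum: "(\<And>j. j \<in> J \<Longrightarrow> homogeneous d (F j)) \<Longrightarrow> homogeneous d (\<Sum>j\<in>J. F j)"
  by (induction J rule: infinite_finite_induct) (auto intro: homogeneous_add)

lemma homogeneous_mult: "homogeneous d F \<Longrightarrow> homogeneous e G \<Longrightarrow> homogeneous (d + e) (F * G)"
  using Poly_Mapping.keys_mult[of F G] by (fastforce simp: homogeneous_mdeg mdeg_add)

lemma homogeneous_single: "mdeg m = d \<Longrightarrow> homogeneous d (Poly_Mapping.single m c)"
  by (auto simp: homogeneous_mdeg)

lemma peval_homogeneous_scale:
  assumes "homogeneous d F"
  shows "peval (\<lambda>c. c) F (\<lambda>i. c * v i) = c ^ d * peval (\<lambda>c. c) F v"
  unfolding peval_meval sum_distrib_left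
  by (rule sum.cong) (use assms in \<open>simp_all add: homogeneous_mdeg meval_scale mult_ac\<close>)

section \<open>Homogeneous forms\<close>

text \<open>Allows a form to be given as an explicit sum of monomials in functionals, with
  \<open>g r j\<close> selecting the functional; determinants and \<open>digit_form\<close> are of
  this shape.\<close>

lemma homogeneous_formI:
  fixes g :: "'r \<Rightarrow> 'j \<Rightarrow> nat"
  assumes "finite R" "finite J"
    and "\<And>r. r \<in> R \<Longrightarrow> (\<Sum>j\<in>J. e r j) = d"
    and "\<And>i. functional_on sc V (\<phi> i)"
  shows "homogeneous_form sc V d (\<lambda>v. \<Sum>r\<in>R. c r * (\<Prod>j\<in>J. \<phi> (g r j) v ^ e r j))"
proof -
  let ?F = "\<Sum>r\<in>R. Poly_Mapping.single (\<Sum>j\<in>J. Poly_Mapping.single (g r j :: nat) (e r j)) (c r)"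
  have 1: "homogeneous d ?F"
    by (intro homogeneous_sum homogeneous_single) (simp add: mdeg_sum assms)
  have 2: "(\<Sum>r\<in>R. c r * (\<Prod>j\<in>J. \<phi> (g r j) v ^ e r j)) = peval (\<lambda>c. c) ?F (\<lambda>i. \<phi> i v)" for v
    by (simp add: complex_id.peval_sum meval_sum)
  show ?thesis
    unfolding homogeneous_form_def
    by (intro exI[of _ ?F] exI[of _ \<phi>] conjI allI ext) (fact 1, fact assms(4), fact 2)
qed

text \<open>Reduces non-vanishing on a line of V to non-vanishing at a spanning vector.\<close>

lemma homogeneous_form_scale:
  assumes "homogeneous_form sc V d f" "v \<in> V"
  shows "f (sc c v) = c ^ d * f v"
proof -
  obtain F and \<phi> :: "nat \<Rightarrow> _" where F: "homogeneous d F" and \<phi>: "\<forall>i. functional_on sc V (\<phi> i)"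
    and f: "f = (\<lambda>v. peval (\<lambda>c. c) F (\<lambda>i. \<phi> i v))"
    using assms(1) unfolding homogeneous_form_def by (elim exE conjE) (rule that; simp)
  have "(\<lambda>i. \<phi> i (sc c v)) = (\<lambda>i. c * \<phi> i v)"
    using \<phi> assms(2) by (auto simp: functional_on_def)
  then show ?thesis
    unfolding f using peval_homogeneous_scale[OF F, of c "\<lambda>i. \<phi> i v"] by simp
qed

lemma peval_poly_curve:
  fixes p :: "'i \<Rightarrow> complex poly"
  shows "\<exists>q. \<forall>t. peval (\<lambda>c. c) F (\<lambda>i. poly (p i) t) = poly q t"
proof
  show "\<forall>t. peval (\<lambda>c. c) F (\<lambda>i. poly (p i) t) =
      poly (\<Sum>m\<in>Poly_Mapping.keys F. smult (Poly_Mapping.lookup F m)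
        (\<Prod>i\<in>Poly_Mapping.keys m. p i ^ Poly_Mapping.lookup m i)) t"
    by (simp add: peval_def poly_sum poly_prod)
qed

text \<open>Along such a curve a form that is nonzero at one parameter has only finitely many zeros;
  this drives the irreducibility proofs.\<close>

lemma homogeneous_form_poly_curve:
  assumes "homogeneous_form sc V d f"
    and "\<And>\<phi>. functional_on sc V \<phi> \<Longrightarrow> \<exists>p. \<forall>t. \<phi> (w t) = poly p t"
  shows "\<exists>q. \<forall>t. f (w t) = poly q t"
proof -
  obtain F and \<phi> :: "nat \<Rightarrow> _" where \<phi>: "\<And>i. functional_on sc V (\<phi> i)"
    and f: "f = (\<lambda>v. peval (\<lambda>c. c) F (\<lambda>i. \<phi> i v))"
    using assms(1) unfolding homogeneous_form_def by (elim exE conjE) (rule that; simp)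
  have "\<forall>i. \<exists>p. \<forall>t. \<phi> i (w t) = poly p t"
    using assms(2)[OF \<phi>] by blast
  then obtain p where p: "\<forall>i t. \<phi> i (w t) = poly (p i) t"
    unfolding choice_iff by blast
  have "f (w t) = peval (\<lambda>c. c) F (\<lambda>i. poly (p i) t)" for t
    by (simp only: f p)
  then show ?thesis
    using peval_poly_curve[of F p] by presburger
qed

section \<open>Spans in commutative algebras\<close>

text \<open>Covers both algebras in which monomials are counted: the function field over the
  constants, and complex-valued functions with pointwise operations.\<close>

locale comm_algebra = vector_space scale
  for scale :: "complex \<Rightarrow> 'a::comm_ring_1 \<Rightarrow> 'a" +
  assumes scale_mult_left: "scale c (x * y) = scale c x * y"
begin

lemma span_mult:
  assumes "a \<in> span A" "b \<in> span B"
  shows "a * b \<in> span {x * y | x y. x \<in> A \<and> y \<in> B}"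
  using assms(1)
proof (induction rule: span_induct_alt)
  case base
  then show ?case by (simp add: span_zero)
next
  case (step c x y)
  have "x * b \<in> span {x * y | x y. x \<in> A \<and> y \<in> B}"
    using assms(2)
  proof (induction rule: span_induct_alt)
    case base
    then show ?case by (simp add: span_zero)
  next
    case (step d z w)
    have "x * scale d z = scale d (x * z)"
      using scale_mult_left[of d z x] by (simp add: mult.commute)
    moreover have "x * z \<in> span {x * y | x y. x \<in> A \<and> y \<in> B}"
      using \<open>x \<in> A\<close> step(1) by (intro span_base) auto
    ultimately show ?case
      using step by (simp add: distrib_left span_add span_scale)
  qed
  then show ?case
    using step by (simp add: distrib_right span_add span_scale flip: scale_mult_left)
qed

lemma span_mult_subset:
  assumes "a \<in> span A" "b \<in> span B" "\<And>x y. x \<in> A \<Longrightarrow> y \<in> B \<Longrightarrow> x * y \<in> span D"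
  shows "a * b \<in> span D"
proof -
  have "span {x * y | x y. x \<in> A \<and> y \<in> B} \<subseteq> span D"
    by (rule span_minimal) (use assms(3) in \<open>auto simp: subspace_span\<close>)
  then show ?thesis
    using span_mult[OF assms(1,2)] by blast
qed

end

text \<open>Stated for indexed families because different monomials may have equal values; a
  repeated vector gives the relation with coefficients 1 and -1.\<close>

lemma (in vector_space) family_dependent:
  assumes "finite T" "finite I" "card T < card I" "\<And>i. i \<in> I \<Longrightarrow> w i \<in> span T"
  shows "\<exists>c. (\<Sum>i\<in>I. scale (c i) (w i)) = 0 \<and> (\<exists>i\<in>I. c i \<noteq> 0)"
proof (cases "inj_on w I")
  case True
  have "\<not> independent (w ` I)"
  proof
    assume "independent (w ` I)"
    then have "card (w ` I) \<le> card T"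
      using independent_span_bound[OF assms(1)] assms(4) by blast
    then show False
      using assms(3) card_image[OF True] by simp
  qed
  then obtain u v where "v \<in> w ` I" "u v \<noteq> 0" "(\<Sum>v\<in>w ` I. scale (u v) v) = 0"
    using assms(2) dependent_finite[of "w ` I"] by auto
  then show ?thesis
    by (intro exI[of _ "u \<circ> w"]) (auto simp: sum.reindex[OF True])
next
  case False
  then obtain i j where ij: "i \<in> I" "j \<in> I" "i \<noteq> j" "w i = w j"
    by (auto simp: inj_on_def)
  let ?c = "\<lambda>k. if k = i then 1 else if k = j then -1 else 0"
  have "(\<Sum>k\<in>I. scale (?c k) (w k)) = (\<Sum>k\<in>{i,j}. scale (?c k) (w k))"
    by (rule sum.mono_neutral_right) (use ij assms(2) in auto)
  also have "\<dots> = 0"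
    using ij by (simp add: scale_minus_left)
  finally show ?thesis
    using ij(1) by (intro exI[of _ ?c]) auto
qed

section \<open>Algebraic dependence in a field of transcendence degree one\<close>

context field_embedding
begin

sublocale comm_algebra "\<lambda>c x. h c * x"
  by unfold_locales (simp_all add: algebra_simps h_add h_mult h_1)

text \<open>Multiplication by p, or by p y, keeps the degree in y below e at the cost of raising the
  degree in z by at most N. After M such steps the degree in z has grown only linearly in M.\<close>

lemma span_power_bound:
  assumes p: "p \<in> span {z ^ u | u. u \<le> N}"
    and y: "p * y ^ e \<in> span {z ^ u * y ^ r | u r. u \<le> N \<and> r < e}" and e: "e > 0"
  shows "i \<le> M \<Longrightarrow> p ^ M * y ^ i \<in> span {z ^ u * y ^ r | u r. u \<le> N * M \<and> r < e}"
proof -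
  define W where "W n = {z ^ u * y ^ r | u r. u \<le> n \<and> r < e}" for n
  have W: "z ^ u * y ^ r \<in> W n" if "u \<le> n" "r < e" for u r n
    using that unfolding W_def by blast
  have mult_p: "p * b \<in> span (W (N + n))" if b: "b \<in> span (W n)" for b n
  proof (rule span_mult_subset[OF p b])
    fix c d assume "c \<in> {z ^ u | u. u \<le> N}" "d \<in> W n"
    then obtain u u' r where "c = z ^ u" "u \<le> N" "d = z ^ u' * y ^ r" "u' \<le> n" "r < e"
      unfolding W_def by blast
    then have "c * d \<in> W (N + n)"
      using W[of "u + u'" "N + n" r] by (simp add: power_add mult_ac)
    then show "c * d \<in> span (W (N + n))"
      by (rule span_base)
  qed
  have mult_py: "p * y * b \<in> span (W (N + n))" if b: "b \<in> span (W n)" for b n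
  proof (rule span_mult_subset[OF span_base[of "p * y" "{p * y}"] b])
    fix c d assume c: "c \<in> {p * y}" and "d \<in> W n"
    then obtain u r where d: "d = z ^ u * y ^ r" "u \<le> n" "r < e"
      unfolding W_def by blast
    show "c * d \<in> span (W (N + n))"
    proof (cases "Suc r < e")
      case True
      then have "p * (z ^ u * y ^ Suc r) \<in> span (W (N + n))"
        using d(2) by (intro mult_p span_base W)
      moreover have "c * d = p * (z ^ u * y ^ Suc r)"
        using c d(1) by (simp add: mult_ac)
      ultimately show ?thesis
        by (simp only:)
    next
      case False
      then have r: "e = Suc r"
        using d by simp
      \<comment> \<open>The exponent of y would reach e; the relation for \<open>p * y ^ e\<close>
        rewrites it.\<close>
      have "z ^ u * (p * y ^ e) \<in> span (W (N + n))"
      proof (rule span_mult_subset[OF span_base[of "z ^ u" "{z ^ u}"] y])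
        fix a b assume "a \<in> {z ^ u}" "b \<in> {z ^ u * y ^ r | u r. u \<le> N \<and> r < e}"
        then obtain u' r' where "a = z ^ u" "b = z ^ u' * y ^ r'" "u' \<le> N" "r' < e"
          by blast
        then have "a * b \<in> W (N + n)"
          using W[of "u + u'" "N + n" r'] d(2) by (simp add: power_add mult_ac)
        then show "a * b \<in> span (W (N + n))"
          by (rule span_base)
      qed simp
      moreover have "c * d = z ^ u * (p * y ^ e)"
        using c d(1) r by (simp add: mult_ac)
      ultimately show ?thesis
        by (simp only:)
    qed
  qed simp
  have "i \<le> M \<Longrightarrow> p ^ M * y ^ i \<in> span (W (N * M))"
  proof (induction M arbitrary: i)
    case 0
    then show ?case
      using W[of 0 0 0] e by (simp add: span_base)
  next
    case (Suc M)
    \<comment> \<open>Each factor p absorbs one factor y, as long as there is one left.\<close>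
    have "p ^ Suc M * y ^ i = (if i = 0 then p * (p ^ M * y ^ i) else p * y * (p ^ M * y ^ (i - 1)))"
      by (cases i) (simp_all add: mult_ac)
    moreover have "p * (p ^ M * y ^ i) \<in> span (W (N + N * M))" if "i = 0"
      using that by (intro mult_p Suc.IH) simp
    moreover have "p * y * (p ^ M * y ^ (i - 1)) \<in> span (W (N + N * M))"
      using Suc.prems by (intro mult_py Suc.IH) simp
    ultimately show ?case
      by (simp only: mult_Suc_right split: if_split) blast
  qed
  then show "i \<le> M \<Longrightarrow> p ^ M * y ^ i \<in> span {z ^ u * y ^ r | u r. u \<le> N * M \<and> r < e}"
    unfolding W_def .
qed

text \<open>
  Two elements algebraic over \<open>\<complex>(z)\<close> are algebraically dependent: after clearing denominators,
  their quadratically many monomials lie in a space of linearly growing dimension.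
\<close>

lemma algebraic_pair_dependent:
  assumes p: "p \<in> span {z ^ u | u. u \<le> N}" "p \<noteq> 0"
    and f: "p * f ^ e \<in> span {z ^ u * f ^ r | u r. u \<le> N \<and> r < e}" "e > 0"
    and q: "q \<in> span {z ^ u | u. u \<le> N}" "q \<noteq> 0"
    and g: "q * g ^ e' \<in> span {z ^ u * g ^ r | u r. u \<le> N \<and> r < e'}" "e' > 0"
  obtains M c where "(\<Sum>i\<le>M. \<Sum>j\<le>M. h (c i j) * (f ^ i * g ^ j)) = 0"
    and "\<exists>i\<le>M. \<exists>j\<le>M. c i j \<noteq> 0"
proof -
  \<comment> \<open>This M gives (2NM + 1) e e' \<le> M (M + 1) < (M + 1)^2: fewer spanning
    monomials than products \<open>f ^ i * g ^ j\<close>.\<close>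
  define M where "M = (2 * N + 1) * e * e'"
  define T where "T = (\<lambda>(u, r, s). z ^ u * f ^ r * g ^ s) ` ({..2 * N * M} \<times> {..<e} \<times> {..<e'})"
  have "finite T"
    unfolding T_def by simp
  have "card T \<le> card ({..2 * N * M} \<times> {..<e} \<times> {..<e'})"
    unfolding T_def by (rule card_image_le) simp
  also have "\<dots> = (2 * N * M + 1) * (e * e')"
    by (simp add: card_cartesian_product)
  also have "\<dots> \<le> ((2 * N + 1) * (M + 1)) * (e * e')"
    by (rule mult_right_mono) (simp_all add: algebra_simps)
  also have "\<dots> = ((2 * N + 1) * e * e') * (M + 1)"
    by (simp only: mult_ac)
  also have "\<dots> = M * (M + 1)"
    by (simp only: M_def)
  also have "\<dots> < (M + 1) * (M + 1)"
    by simp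
  also have "\<dots> = card ({..M} \<times> {..M})"
    by (simp add: card_cartesian_product)
  finally have card: "card T < card ({..M} \<times> {..M})" .
  have "p ^ M * q ^ M * (f ^ i * g ^ j) \<in> span T" if "i \<le> M" "j \<le> M" for i j
  proof -
    have "(p ^ M * f ^ i) * (q ^ M * g ^ j) \<in> span T"
    proof (rule span_mult_subset[OF span_power_bound[OF p(1) f that(1)] span_power_bound[OF q(1) g that(2)]])
      fix a b assume "a \<in> {z ^ u * f ^ r | u r. u \<le> N * M \<and> r < e}"
        "b \<in> {z ^ u * g ^ r | u r. u \<le> N * M \<and> r < e'}"
      then obtain u r u' s where *: "a = z ^ u * f ^ r" "u \<le> N * M" "r < e"
        "b = z ^ u' * g ^ s" "u' \<le> N * M" "s < e'"
        by blast
      then have "(u + u', r, s) \<in> {..2 * N * M} \<times> {..<e} \<times> {..<e'}"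
        "a * b = (\<lambda>(u, r, s). z ^ u * f ^ r * g ^ s) (u + u', r, s)"
        by (auto simp: power_add mult_ac)
      then show "a * b \<in> span T"
        unfolding T_def by (intro span_base) blast
    qed
    then show ?thesis
      by (simp add: mult_ac)
  qed
  then have mem: "(case w of (i, j) \<Rightarrow> p ^ M * q ^ M * (f ^ i * g ^ j)) \<in> span T"
    if "w \<in> {..M} \<times> {..M}" for w
    using that by auto
  obtain c where c: "(\<Sum>w\<in>{..M} \<times> {..M}. h (c w) * (case w of (i, j) \<Rightarrow> p ^ M * q ^ M * (f ^ i * g ^ j))) = 0"
    "\<exists>w\<in>{..M} \<times> {..M}. c w \<noteq> 0"
    using family_dependent[OF \<open>finite T\<close> _ card, of "\<lambda>w. case w of (i, j) \<Rightarrow> p ^ M * q ^ M * (f ^ i * g ^ j)"] mem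
    by blast
  have "0 = (\<Sum>i\<le>M. \<Sum>j\<le>M. h (c (i, j)) * (p ^ M * q ^ M * (f ^ i * g ^ j)))"
    using c(1) by (simp add: sum.cartesian_product split_def)
  also have "\<dots> = p ^ M * q ^ M * (\<Sum>i\<le>M. \<Sum>j\<le>M. h (c (i, j)) * (f ^ i * g ^ j))"
    by (simp add: sum_distrib_left mult_ac)
  finally have "(\<Sum>i\<le>M. \<Sum>j\<le>M. h (c (i, j)) * (f ^ i * g ^ j)) = 0"
    using p(2) q(2) by simp
  then show ?thesis
    using c(2) by (intro that[of "\<lambda>i j. c (i, j)" M]) auto
qed

text \<open>Rewrites a polynomial in the variables z and y as a square array of coefficients. As z
  and y differ, both exponents can be read off a monomial; N is a crude bound for them.\<close>

lemma relation_of_dependent_pair: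
  assumes "\<not> alg_independent h {z, y}" "z \<noteq> y"
  obtains N c where "(\<Sum>i\<le>N. \<Sum>j\<le>N. h (c i j) * (z ^ i * y ^ j)) = 0"
    and "\<exists>i\<le>N. \<exists>j\<le>N. c i j \<noteq> 0"
proof -
  obtain F :: "'k mpoly" where F: "\<forall>m\<in>Poly_Mapping.keys F. Poly_Mapping.keys m \<subseteq> {z, y}"
    "peval h F (\<lambda>x. x) = 0" "F \<noteq> 0"
    using assms(1) unfolding alg_independent_def by blast
  define N where "N = (\<Sum>m\<in>Poly_Mapping.keys F. Poly_Mapping.lookup m z + Poly_Mapping.lookup m y)"
  define mon :: "nat \<times> nat \<Rightarrow> ('k \<Rightarrow>\<^sub>0 nat)" where
    "mon = (\<lambda>(i, j). Poly_Mapping.single z i + Poly_Mapping.single y j)"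
  have lk: "Poly_Mapping.lookup (mon (i, j)) z = i" "Poly_Mapping.lookup (mon (i, j)) y = j" for i j
    using assms(2) by (auto simp: mon_def lookup_add lookup_single when_def)
  have inj: "inj mon"
    using lk by (metis injI prod.collapse)
  have sub: "Poly_Mapping.keys F \<subseteq> mon ` ({..N} \<times> {..N})"
  proof
    fix m assume m: "m \<in> Poly_Mapping.keys F"
    let ?i = "Poly_Mapping.lookup m z" and ?j = "Poly_Mapping.lookup m y"
    have "m = mon (?i, ?j)"
    proof (rule poly_mapping_eqI)
      fix k
      have "k \<notin> {z, y} \<Longrightarrow> Poly_Mapping.lookup m k = 0"
        using F(1) m in_keys_iff[of k m] by blast
      then show "Poly_Mapping.lookup m k = Poly_Mapping.lookup (mon (?i, ?j)) k"
        using assms(2) by (auto simp: mon_def lookup_add lookup_single when_def)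
    qed
    moreover have "?i + ?j \<le> N"
      unfolding N_def using m by (intro member_le_sum) auto
    ultimately show "m \<in> mon ` ({..N} \<times> {..N})"
      by auto
  qed
  have "0 = (\<Sum>m\<in>mon ` ({..N} \<times> {..N}). h (Poly_Mapping.lookup F m) * meval m (\<lambda>x. x))"
    using F(2) peval_superset[OF _ sub] by simp
  also have "\<dots> = (\<Sum>(i, j)\<in>{..N} \<times> {..N}. h (Poly_Mapping.lookup F (mon (i, j))) * (z ^ i * y ^ j))"
    by (subst sum.reindex[OF inj_on_subset[OF inj subset_UNIV]])
       (auto intro!: sum.cong simp: mon_def meval_add)
  also have "\<dots> = (\<Sum>i\<le>N. \<Sum>j\<le>N. h (Poly_Mapping.lookup F (mon (i, j))) * (z ^ i * y ^ j))"
    by (simp add: sum.cartesian_product)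
  finally have "(\<Sum>i\<le>N. \<Sum>j\<le>N. h (Poly_Mapping.lookup F (mon (i, j))) * (z ^ i * y ^ j)) = 0" ..
  moreover obtain m where "m \<in> Poly_Mapping.keys F"
    using F(3) by fastforce
  then obtain i j where "i \<le> N" "j \<le> N" "Poly_Mapping.lookup F (mon (i, j)) \<noteq> 0"
    using sub by (auto simp: in_keys_iff)
  ultimately show ?thesis
    by (intro that[of "\<lambda>i j. Poly_Mapping.lookup F (mon (i, j))" N]) blast+
qed

text \<open>The relation is read as a polynomial in y with coefficients \<open>P j\<close> in
  \<complex>[z]. Transcendence of z keeps \<open>P j\<close> nonzero whenever some
  \<open>c i j\<close> is, and p is the leading coefficient, e the degree in y.\<close>

lemma algebraic_of_relation:
  assumes "alg_independent h {z}"
    and "(\<Sum>i\<le>N. \<Sum>j\<le>N. h (c i j) * (z ^ i * y ^ j)) = 0"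
    and "\<exists>i\<le>N. \<exists>j\<le>N. c i j \<noteq> 0"
  obtains p e where "p \<in> span {z ^ u | u. u \<le> N}" "p \<noteq> 0"
    "p * y ^ e \<in> span {z ^ u * y ^ r | u r. u \<le> N \<and> r < e}" "e > 0"
proof -
  define P where "P j = (\<Sum>i\<le>N. h (c i j) * z ^ i)" for j
  have P_span: "P j \<in> span {z ^ u | u. u \<le> N}" for j
    unfolding P_def by (intro span_sum span_scale span_base) auto
  have P_nz: "P j \<noteq> 0" if "i \<le> N" "c i j \<noteq> 0" for i j
  proof
    assume *: "P j = 0"
    let ?F = "\<Sum>i\<le>N. Poly_Mapping.single (Poly_Mapping.single z i) (c i j)"
    have "peval h ?F (\<lambda>x. x) = 0"
      using * by (simp add: peval_sum P_def)
    moreover have "Poly_Mapping.keys m \<subseteq> {z}" if "m \<in> Poly_Mapping.keys ?F" for m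
    proof -
      have "m \<in> (\<Union>i\<in>{..N}. Poly_Mapping.keys (Poly_Mapping.single (Poly_Mapping.single z i) (c i j)))"
        using that Poly_Mapping.keys_sum[of "\<lambda>i. Poly_Mapping.single (Poly_Mapping.single z i) (c i j)" "{..N}"] by blast
      then show ?thesis
        by (auto split: if_splits)
    qed
    ultimately have "?F = 0"
      using assms(1) unfolding alg_independent_def by blast
    then have "Poly_Mapping.lookup ?F (Poly_Mapping.single z i) = 0"
      by (simp only: lookup_zero)
    moreover have "Poly_Mapping.lookup ?F (Poly_Mapping.single z i) = (\<Sum>k\<le>N. if k = i then c k j else 0)"
      unfolding lookup_sum by (rule sum.cong) (auto simp: lookup_single when_def dest: injD[OF inj_single])
    ultimately show False
      using that by simp
  qed
  have rel: "(\<Sum>j\<le>N. P j * y ^ j) = 0"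
    using assms(2) unfolding P_def
    by (subst (asm) sum.swap) (simp add: sum_distrib_right mult.assoc)
  obtain i0 j0 where ij0: "i0 \<le> N" "j0 \<le> N" "c i0 j0 \<noteq> 0"
    using assms(3) by blast
  define e where "e = Max {j. j \<le> N \<and> P j \<noteq> 0}"
  have fin: "finite {j. j \<le> N \<and> P j \<noteq> 0}"
    by simp
  have mem: "j0 \<in> {j. j \<le> N \<and> P j \<noteq> 0}"
    using ij0 P_nz by auto
  have e: "e \<le> N" "P e \<noteq> 0"
    using Max_in[OF fin] mem unfolding e_def by blast+
  have emax: "P j = 0" if "j \<le> N" "e < j" for j
    using Max_ge[OF fin, of j] that unfolding e_def by fastforce
  have "(\<Sum>j\<le>N. P j * y ^ j) = (\<Sum>j\<le>e. P j * y ^ j)"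
    by (rule sum.mono_neutral_right) (use e emax in auto)
  also have "\<dots> = P e * y ^ e + (\<Sum>j<e. P j * y ^ j)"
    by (simp add: lessThan_Suc_atMost[symmetric])
  finally have *: "P e * y ^ e = - (\<Sum>j<e. P j * y ^ j)"
    using rel by (simp add: eq_neg_iff_add_eq_0)
  have "P j * y ^ j \<in> span {z ^ u * y ^ r | u r. u \<le> N \<and> r < e}" if "j < e" for j
    using P_span[of j] span_base[of "y ^ j" "{y ^ j}"]
    by (rule span_mult_subset) (use that in \<open>auto intro!: span_base\<close>)
  then have "P e * y ^ e \<in> span {z ^ u * y ^ r | u r. u \<le> N \<and> r < e}"
    unfolding * by (intro span_neg span_sum) auto
  moreover have "e > 0"
    using * e(2) by (cases e) auto
  ultimately show ?thesis
    using that P_span e(2) by blast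
qed

lemma trdeg_1_dependent:
  assumes "has_trdeg h 1"
  obtains M c where "(\<Sum>i\<le>M. \<Sum>j\<le>M. h (c i j) * (f ^ i * g ^ j)) = 0"
    and "\<exists>i\<le>M. \<exists>j\<le>M. c i j \<noteq> 0"
proof -
  obtain z where z: "alg_independent h {z}" and max: "\<And>T. alg_independent h T \<Longrightarrow> z \<in> T \<Longrightarrow> T = {z}"
    using assms unfolding has_trdeg_def by (auto simp: card_1_singleton_iff)
  have alg: "\<exists>N p e. p \<in> span {z ^ u | u. u \<le> N} \<and> p \<noteq> 0 \<and>
    p * y ^ e \<in> span {z ^ u * y ^ r | u r. u \<le> N \<and> r < e} \<and> e > 0" for y
  proof (cases "z = y")
    case True
    \<comment> \<open>For y = z maximality of {z} says nothing; the trivial relation with p = 1 and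
      e = 1 serves.\<close>
    have "1 * z ^ 1 = z ^ 1 * z ^ 0"
      by simp
    then have "1 * z ^ 1 \<in> span {z ^ u * z ^ r | u r. u \<le> 1 \<and> r < 1}"
      by (intro span_base) blast
    moreover have "1 \<in> span {z ^ u | u. u \<le> 1}"
      by (rule span_base) (auto intro!: exI[of _ 0])
    ultimately show ?thesis
      using True by (intro exI[of _ 1] exI[of _ "1::'k"]) auto
  next
    case False
    have dep: "\<not> alg_independent h {z, y}"
    proof
      assume "alg_independent h {z, y}"
      then have "{z, y} = {z}"
        by (rule max) simp
      then show False
        using False by blast
    qed
    obtain N c where rel: "(\<Sum>i\<le>N. \<Sum>j\<le>N. h (c i j) * (z ^ i * y ^ j)) = 0"
      "\<exists>i\<le>N. \<exists>j\<le>N. c i j \<noteq> 0"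
      by (rule relation_of_dependent_pair[OF dep False])
    obtain p e where "p \<in> span {z ^ u | u. u \<le> N}" "p \<noteq> 0"
      "p * y ^ e \<in> span {z ^ u * y ^ r | u r. u \<le> N \<and> r < e}" "e > 0"
      by (rule algebraic_of_relation[OF z rel])
    then show ?thesis
      by blast
  qed
  obtain N p e where f: "p \<in> span {z ^ u | u. u \<le> N}" "p \<noteq> 0"
    "p * f ^ e \<in> span {z ^ u * f ^ r | u r. u \<le> N \<and> r < e}" "e > 0"
    using alg by blast
  obtain N' q e' where g: "q \<in> span {z ^ u | u. u \<le> N'}" "q \<noteq> 0"
    "q * g ^ e' \<in> span {z ^ u * g ^ r | u r. u \<le> N' \<and> r < e'}" "e' > 0"
    using alg by blast
  let ?N = "max N N'"
  have f': "p \<in> span {z ^ u | u. u \<le> ?N}" "p * f ^ e \<in> span {z ^ u * f ^ r | u r. u \<le> ?N \<and> r < e}"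
    by (rule subsetD[OF span_mono f(1)], force) (rule subsetD[OF span_mono f(3)], force)
  have g': "q \<in> span {z ^ u | u. u \<le> ?N}" "q * g ^ e' \<in> span {z ^ u * g ^ r | u r. u \<le> ?N \<and> r < e'}"
    by (rule subsetD[OF span_mono g(1)], force) (rule subsetD[OF span_mono g(3)], force)
  show ?thesis
    by (rule algebraic_pair_dependent[OF f'(1) f(2) f'(2) f(4) g'(1) g(2) g'(2) g(4)]) (rule that)
qed

text \<open>Cancelling the highest common power of g from a relation leaves terms free of g. Modulo
  g, the element a therefore satisfies a nontrivial equation over the constants.\<close>

lemma trdeg_1_relation:
  assumes "has_trdeg h 1" "g \<noteq> 0"
  obtains M n c where "(\<Sum>j\<le>M. h (c 0 j) * a ^ j) = g * - (\<Sum>i<n. \<Sum>j\<le>M. h (c (Suc i) j) * (g ^ i * a ^ j))"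
    and "\<exists>j\<le>M. c 0 j \<noteq> 0"
proof -
  obtain M c where rel: "(\<Sum>i\<le>M. \<Sum>j\<le>M. h (c i j) * (g ^ i * a ^ j)) = 0" "\<exists>i\<le>M. \<exists>j\<le>M. c i j \<noteq> 0"
    by (rule trdeg_1_dependent[OF assms(1)])
  have "\<exists>c n. (\<Sum>i<Suc n. \<Sum>j\<le>M. h (c i j) * (g ^ i * a ^ j)) = 0 \<and> (\<exists>j\<le>M. c 0 j \<noteq> 0)"
    if "(\<Sum>i<Suc n. \<Sum>j\<le>M. h (c i j) * (g ^ i * a ^ j)) = 0" "\<exists>i<Suc n. \<exists>j\<le>M. c i j \<noteq> 0" for n c
    using that
  proof (induction n arbitrary: c)
    case 0
    then show ?case
      by (intro exI[of _ c] exI[of _ 0]) auto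
  next
    case (Suc n)
    show ?case
    proof (cases "\<exists>j\<le>M. c 0 j \<noteq> 0")
      case True
      then show ?thesis
        by (intro exI[of _ c] exI[of _ "Suc n"] conjI[OF Suc.prems(1) True])
    next
      case False
      then have "(\<Sum>i<Suc (Suc n). \<Sum>j\<le>M. h (c i j) * (g ^ i * a ^ j)) =
          g * (\<Sum>i<Suc n. \<Sum>j\<le>M. h (c (Suc i) j) * (g ^ i * a ^ j))"
        by (subst sum.lessThan_Suc_shift) (simp add: h_0 sum_distrib_left mult_ac del: sum.lessThan_Suc)
      from trans[OF this[symmetric] Suc.prems(1)]
      have "(\<Sum>i<Suc n. \<Sum>j\<le>M. h (c (Suc i) j) * (g ^ i * a ^ j)) = 0"
        using no_zero_divisors[OF assms(2)] by blast
      moreover have "\<exists>i<Suc n. \<exists>j\<le>M. c (Suc i) j \<noteq> 0"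
        using Suc.prems(2) False by (metis less_Suc_eq_0_disj)
      ultimately show ?thesis
        by (rule Suc.IH)
    qed
  qed
  from this[of c M] rel obtain c n where
    c: "(\<Sum>i<Suc n. \<Sum>j\<le>M. h (c i j) * (g ^ i * a ^ j)) = 0" "\<exists>j\<le>M. c 0 j \<noteq> 0"
    by (auto simp: lessThan_Suc_atMost less_Suc_eq_le)
  have "(\<Sum>j\<le>M. h (c 0 j) * a ^ j) + g * (\<Sum>i<n. \<Sum>j\<le>M. h (c (Suc i) j) * (g ^ i * a ^ j)) = 0"
    using c(1) by (subst (asm) sum.lessThan_Suc_shift) (simp add: sum_distrib_left mult_ac)
  then show ?thesis
    using that[of c M n] c(2) by (simp add: eq_neg_iff_add_eq_0)
qed

end

section \<open>Local rings of a smooth projective curve\<close>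

lemma topspace_zariski: "topspace (zariski sc V) = proj sc V"
proof -
  have "homogeneous_form sc V 0 (\<lambda>v. \<Sum>r\<in>{()}. 1 * (\<Prod>j\<in>{}. (\<lambda>v. 0 :: complex) v ^ 0))"
    by (rule homogeneous_formI[where \<phi> = "\<lambda>_ _. 0" and g = "\<lambda>_ _. 0" and J = "{}" and e = "\<lambda>_ _. 0", simplified])
       (auto simp: functional_on_def)
  then have "homogeneous_form sc V 0 (\<lambda>v. 1)"
    by simp
  moreover have "{L \<in> proj sc V. \<exists>v\<in>L. (1::complex) \<noteq> 0} = proj sc V"
    by (auto simp: proj_def pline_def)
  ultimately have "proj sc V \<in> {{L \<in> proj sc V. \<exists>v\<in>L. f v \<noteq> 0} | f d. homogeneous_form sc V d f}"
    by (intro CollectI exI[of _ "\<lambda>v. 1"] exI[of _ 0]) simp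
  then show ?thesis
    unfolding zariski_def topology_generated_by_topspace by blast
qed

lemma (in field_embedding) peval_1: "peval h 1 v = 1"
  by (simp add: h_1 flip: single_one)

lemma homogeneous_1: "homogeneous 0 1"
  unfolding single_one[symmetric] by (rule homogeneous_single) simp

locale curve =
  fixes C :: "('n::finite, 'k::field) variety_data"
  assumes smooth: "smooth_projective_curve C"
begin

lemma variety: "projective_variety C"
  and trdeg: "has_trdeg (const C) 1"
  and ex_uniformizer: "x \<in> pts C \<Longrightarrow> \<exists>t. uniformizer C x t"
  using smooth by (auto simp: smooth_projective_curve_def)

sublocale field_embedding "const C"
  using variety by unfold_locales (auto simp: projective_variety_def)

abbreviation gen :: "'n mpoly \<Rightarrow> 'k" where
  "gen F \<equiv> peval (const C) F (coord C)"

lemma vanishing_iff: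
  "homogeneous d F \<Longrightarrow> gen F = 0 \<longleftrightarrow>
     (\<forall>x\<in>pts C. \<forall>a\<in>x. peval (\<lambda>c. c) F (\<lambda>i. a $ i) = 0)"
  using variety by (auto simp: projective_variety_def)

lemma ratio_of_forms:
  "\<exists>d F G. homogeneous d F \<and> homogeneous d G \<and> gen G \<noteq> 0 \<and>
     f = gen F / gen G"
  using variety by (auto simp: projective_variety_def)

section \<open>Values of rational functions at points\<close>

definition rep :: "'n ppoint \<Rightarrow> complex ^ 'n" where
  "rep x = (SOME a. a \<noteq> 0 \<and> x = pline (*s) a)"

text \<open>Depends on the choice of \<open>rep x\<close>; only vanishing and quotients in equal
  degree, which do not, are used.\<close>

definition val_at :: "'n ppoint \<Rightarrow> 'n mpoly \<Rightarrow> complex" where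
  "val_at x F = peval (\<lambda>c. c) F (\<lambda>i. rep x $ i)"

lemma rep:
  assumes "x \<in> pts C"
  shows "rep x \<noteq> 0" "x = pline (*s) (rep x)"
proof -
  have "pts C \<subseteq> topspace (zariski (*s) UNIV)"
    using variety by (intro closedin_subset) (simp add: projective_variety_def)
  then have "x \<in> proj (*s) UNIV"
    using assms unfolding topspace_zariski by blast
  then have "\<exists>a. a \<noteq> 0 \<and> x = pline (*s) a"
    by (auto simp: proj_def)
  then have "rep x \<noteq> 0 \<and> x = pline (*s) (rep x)"
    unfolding rep_def by (rule someI_ex)
  then show "rep x \<noteq> 0" "x = pline (*s) (rep x)"
    by simp_all
qed

lemma rep_in: "x \<in> pts C \<Longrightarrow> rep x \<in> x"
proof -
  assume "x \<in> pts C"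
  then have "x = range (\<lambda>c. c *s rep x)"
    using rep(2) unfolding pline_def by blast
  moreover have "1 *s rep x \<in> range (\<lambda>c. c *s rep x)"
    by (rule rangeI)
  ultimately show "rep x \<in> x"
    by simp
qed

lemma ex_nonvanishing_iff:
  assumes "x \<in> pts C" "homogeneous d F"
  shows "(\<exists>a\<in>x. peval (\<lambda>c. c) F (\<lambda>i. a $ i) \<noteq> 0) \<longleftrightarrow> val_at x F \<noteq> 0"
proof
  assume "\<exists>a\<in>x. peval (\<lambda>c. c) F (\<lambda>i. a $ i) \<noteq> 0"
  then obtain a where "a \<in> x" "peval (\<lambda>c. c) F (\<lambda>i. a $ i) \<noteq> 0"
    by blast
  moreover have "x = range (\<lambda>c. c *s rep x)"
    using rep(2)[OF assms(1)] unfolding pline_def .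
  ultimately obtain c where "peval (\<lambda>c. c) F (\<lambda>i. (c *s rep x) $ i) \<noteq> 0"
    by (metis imageE)
  then show "val_at x F \<noteq> 0"
    using peval_homogeneous_scale[OF assms(2), of c "\<lambda>i. rep x $ i"] by (auto simp: val_at_def)
next
  assume "val_at x F \<noteq> 0"
  then show "\<exists>a\<in>x. peval (\<lambda>c. c) F (\<lambda>i. a $ i) \<noteq> 0"
    using rep_in[OF assms(1)] by (auto simp: val_at_def)
qed

lemma val_at_vanishing:
  "x \<in> pts C \<Longrightarrow> homogeneous d F \<Longrightarrow> gen F = 0 \<Longrightarrow> val_at x F = 0"
  using vanishing_iff rep_in unfolding val_at_def by blast

text \<open>A relation, since a function has many presentations as a quotient of forms;
  \<open>has_value_unique\<close> turns it into the function \<open>ev\<close>.\<close>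

definition has_value :: "'n ppoint \<Rightarrow> 'k \<Rightarrow> complex \<Rightarrow> bool" where
  "has_value x f r \<longleftrightarrow> (\<exists>d F G. homogeneous d F \<and> homogeneous d G \<and> val_at x G \<noteq> 0 \<and>
     f = gen F / gen G \<and> r = val_at x F / val_at x G)"

definition ev :: "'n ppoint \<Rightarrow> 'k \<Rightarrow> complex" where
  "ev x f = (THE r. has_value x f r)"

abbreviation \<O> :: "'n ppoint \<Rightarrow> 'k set" where
  "\<O> \<equiv> local_ring C"

lemma has_valueE:
  assumes "has_value x f r"
  obtains d F G where "homogeneous d F" "homogeneous d G" "val_at x G \<noteq> 0"
    "f = gen F / gen G" "r = val_at x F / val_at x G"
  using assms unfolding has_value_def by blast

lemma local_ring_iff: "x \<in> pts C \<Longrightarrow> f \<in> \<O> x \<longleftrightarrow> (\<exists>r. has_value x f r)"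
  unfolding local_ring_def has_value_def using ex_nonvanishing_iff by blast

lemma has_value_unique:
  assumes x: "x \<in> pts C" and "has_value x f r" "has_value x f r'"
  shows "r = r'"
proof -
  obtain d F G where 1: "homogeneous d F" "homogeneous d G" "val_at x G \<noteq> 0"
    "f = gen F / gen G" "r = val_at x F / val_at x G"
    by (rule has_valueE[OF assms(2)])
  obtain d' F' G' where 2: "homogeneous d' F'" "homogeneous d' G'" "val_at x G' \<noteq> 0"
    "f = gen F' / gen G'" "r' = val_at x F' / val_at x G'"
    by (rule has_valueE[OF assms(3)])
  \<comment> \<open>The form F G' - F' G vanishes at the generic point, hence on the whole curve and
    at x. The sign is a constant polynomial so that \<open>homogeneous_mult\<close> applies.\<close>
  let ?H = "F * G' + Poly_Mapping.single 0 (-1) * (F' * G)"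
  have nz: "gen G \<noteq> 0" "gen G' \<noteq> 0"
    using val_at_vanishing[OF x] 1 2 by blast+
  have "homogeneous (0 + (d' + d)) (Poly_Mapping.single 0 (-1) * (F' * G))"
    using 1 2 by (intro homogeneous_mult homogeneous_single) auto
  then have "homogeneous (d + d') (Poly_Mapping.single 0 (-1) * (F' * G))"
    by (simp add: add.commute)
  then have hom: "homogeneous (d + d') ?H"
    using 1 2 by (intro homogeneous_add[OF homogeneous_mult])
  have "peval (const C) ?H (coord C) = gen F * gen G'
      - gen F' * gen G"
    by (simp add: peval_add peval_mult h_minus h_1)
  also have "\<dots> = 0"
    using 1(4) 2(4) nz by (simp add: field_simps)
  finally have "val_at x ?H = 0"
    using val_at_vanishing[OF x hom] by blast
  then have "val_at x F * val_at x G' = val_at x F' * val_at x G"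
    by (simp add: val_at_def complex_id.peval_add complex_id.peval_mult)
  then show ?thesis
    by (simp only: 1(5) 2(5) frac_eq_eq[OF 1(3) 2(3)])
qed

lemma ev_eq: "x \<in> pts C \<Longrightarrow> has_value x f r \<Longrightarrow> ev x f = r"
  unfolding ev_def using has_value_unique by blast

lemma has_value_ev: "x \<in> pts C \<Longrightarrow> f \<in> \<O> x \<Longrightarrow> has_value x f (ev x f)"
  using local_ring_iff ev_eq by metis

lemma has_value_add:
  assumes x: "x \<in> pts C" and "has_value x f r" "has_value x g s"
  shows "has_value x (f + g) (r + s)" "has_value x (f * g) (r * s)"
proof -
  obtain d F G where 1: "homogeneous d F" "homogeneous d G" "val_at x G \<noteq> 0"
    "f = gen F / gen G" "r = val_at x F / val_at x G"
    by (rule has_valueE[OF assms(2)])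
  obtain d' F' G' where 2: "homogeneous d' F'" "homogeneous d' G'" "val_at x G' \<noteq> 0"
    "g = gen F' / gen G'" "s = val_at x F' / val_at x G'"
    by (rule has_valueE[OF assms(3)])
  have nz: "gen G \<noteq> 0" "gen G' \<noteq> 0"
    using val_at_vanishing[OF x] 1 2 by blast+
  have hG: "homogeneous (d + d') (G * G')" "val_at x (G * G') \<noteq> 0"
    using 1 2 by (auto intro: homogeneous_mult simp: val_at_def complex_id.peval_mult)
  have "homogeneous (d + d') (F * G' + G * F')"
    using 1 2 by (intro homogeneous_add homogeneous_mult)
  moreover have "f + g = gen (F * G' + G * F') / gen (G * G')"
    using 1(4) 2(4) nz by (simp add: peval_add peval_mult add_divide_distrib)
  moreover have "r + s = val_at x (F * G' + G * F') / val_at x (G * G')"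
    using 1(3,5) 2(3,5) by (simp add: val_at_def complex_id.peval_add complex_id.peval_mult add_divide_distrib)
  ultimately show "has_value x (f + g) (r + s)"
    unfolding has_value_def using hG by blast
  have "homogeneous (d + d') (F * F')"
    using 1 2 by (intro homogeneous_mult)
  moreover have "f * g = gen (F * F') / gen (G * G')"
    using 1 2 nz by (simp add: peval_mult)
  moreover have "r * s = val_at x (F * F') / val_at x (G * G')"
    using 1 2 by (simp add: val_at_def complex_id.peval_mult)
  ultimately show "has_value x (f * g) (r * s)"
    unfolding has_value_def using hG by blast
qed

lemma has_value_const: "has_value x (const C c) c"
  unfolding has_value_def
  by (rule exI[of _ 0], rule exI[of _ "Poly_Mapping.single 0 c"], rule exI[of _ "Poly_Mapping.single 0 1"])
     (auto intro: homogeneous_single homogeneous_1 simp: val_at_def peval_1 complex_id.peval_1)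

lemma has_value_inverse:
  assumes "has_value x f r" "r \<noteq> 0"
  shows "has_value x (inverse f) (inverse r)"
proof -
  obtain d F G where 1: "homogeneous d F" "homogeneous d G" "val_at x G \<noteq> 0"
    "f = gen F / gen G" "r = val_at x F / val_at x G"
    by (rule has_valueE[OF assms(1)])
  then have "val_at x F \<noteq> 0" "inverse r = val_at x G / val_at x F"
    "inverse f = gen G / gen F"
    using assms(2) by auto
  then show ?thesis
    unfolding has_value_def using 1 by blast
qed

lemma local_ring_add: "x \<in> pts C \<Longrightarrow> f \<in> \<O> x \<Longrightarrow> g \<in> \<O> x \<Longrightarrow> f + g \<in> \<O> x"
  and local_ring_mult: "x \<in> pts C \<Longrightarrow> f \<in> \<O> x \<Longrightarrow> g \<in> \<O> x \<Longrightarrow> f * g \<in> \<O> x"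
  and local_ring_const: "x \<in> pts C \<Longrightarrow> const C c \<in> \<O> x"
  and ev_add: "x \<in> pts C \<Longrightarrow> f \<in> \<O> x \<Longrightarrow> g \<in> \<O> x \<Longrightarrow> ev x (f + g) = ev x f + ev x g"
  and ev_mult: "x \<in> pts C \<Longrightarrow> f \<in> \<O> x \<Longrightarrow> g \<in> \<O> x \<Longrightarrow> ev x (f * g) = ev x f * ev x g"
  and ev_const: "x \<in> pts C \<Longrightarrow> ev x (const C c) = c"
  and local_ring_inverse: "x \<in> pts C \<Longrightarrow> f \<in> \<O> x \<Longrightarrow> ev x f \<noteq> 0 \<Longrightarrow> inverse f \<in> \<O> x"
  using has_value_add has_value_const has_value_inverse has_value_ev local_ring_iff ev_eq by meson+

lemma local_ring_0: "x \<in> pts C \<Longrightarrow> 0 \<in> \<O> x"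
  and local_ring_1: "x \<in> pts C \<Longrightarrow> 1 \<in> \<O> x"
  and ev_0: "x \<in> pts C \<Longrightarrow> ev x 0 = 0"
  and ev_1: "x \<in> pts C \<Longrightarrow> ev x 1 = 1"
  using local_ring_const[of x 0] local_ring_const[of x 1] ev_const[of x 0] ev_const[of x 1]
  by (simp_all add: h_0 h_1)

lemma local_ring_minus: "x \<in> pts C \<Longrightarrow> f \<in> \<O> x \<Longrightarrow> - f \<in> \<O> x"
  using local_ring_mult[of x "const C (-1)" f] local_ring_const[of x "-1"] by (simp add: h_minus h_1)

lemma local_ring_power: "x \<in> pts C \<Longrightarrow> f \<in> \<O> x \<Longrightarrow> f ^ n \<in> \<O> x"
  and ev_power: "x \<in> pts C \<Longrightarrow> f \<in> \<O> x \<Longrightarrow> ev x (f ^ n) = ev x f ^ n"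
proof -
  have "f ^ n \<in> \<O> x \<and> ev x (f ^ n) = ev x f ^ n" if "x \<in> pts C" "f \<in> \<O> x"
    by (induction n) (use that in \<open>simp_all add: local_ring_1 ev_1 local_ring_mult ev_mult\<close>)
  then show "x \<in> pts C \<Longrightarrow> f \<in> \<O> x \<Longrightarrow> f ^ n \<in> \<O> x"
    "x \<in> pts C \<Longrightarrow> f \<in> \<O> x \<Longrightarrow> ev x (f ^ n) = ev x f ^ n"
    by auto
qed

lemma local_ring_sum: "x \<in> pts C \<Longrightarrow> (\<And>i. i \<in> I \<Longrightarrow> f i \<in> \<O> x) \<Longrightarrow> (\<Sum>i\<in>I. f i) \<in> \<O> x"
  by (induction I rule: infinite_finite_induct) (auto intro: local_ring_0 local_ring_add)

lemma ev_sum: "x \<in> pts C \<Longrightarrow> (\<And>i. i \<in> I \<Longrightarrow> f i \<in> \<O> x) \<Longrightarrow> ev x (\<Sum>i\<in>I. f i) = (\<Sum>i\<in>I. ev x (f i))"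
  by (induction I rule: infinite_finite_induct) (auto simp: ev_0 ev_add local_ring_sum)

lemma local_unit_iff: "x \<in> pts C \<Longrightarrow> local_unit C x u \<longleftrightarrow> u \<in> \<O> x \<and> ev x u \<noteq> 0"
proof -
  assume x: "x \<in> pts C"
  show ?thesis
  proof
    assume u: "local_unit C x u"
    then have "ev x u * ev x (inverse u) = 1"
      using ev_mult[OF x, of u "inverse u"] ev_1[OF x] by (simp add: local_unit_def)
    then show "u \<in> \<O> x \<and> ev x u \<noteq> 0"
      using u by (auto simp: local_unit_def)
  next
    assume "u \<in> \<O> x \<and> ev x u \<noteq> 0"
    then show "local_unit C x u"
      using local_ring_inverse[OF x] ev_0[OF x] by (auto simp: local_unit_def)
  qed
qed

lemma max_ideal_iff: "x \<in> pts C \<Longrightarrow> f \<in> max_ideal C x \<longleftrightarrow> f \<in> \<O> x \<and> ev x f = 0"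
  by (auto simp: max_ideal_def local_unit_iff)

lemma monomial_quotient:
  assumes x: "x \<in> pts C" and j: "rep x $ j \<noteq> 0" and F: "homogeneous d F"
  shows "coord C j \<noteq> 0" "gen F / coord C j ^ d \<in> \<O> x"
    "ev x (gen F / coord C j ^ d) = val_at x F / (rep x $ j) ^ d"
proof -
  have val: "val_at x (Poly_Mapping.single (Poly_Mapping.single j e) 1) = rep x $ j ^ e" for e
    by (simp add: val_at_def)
  have hom: "homogeneous e (Poly_Mapping.single (Poly_Mapping.single j e) 1)" for e
    by (intro homogeneous_single) simp
  show "coord C j \<noteq> 0"
    using val_at_vanishing[OF x hom[of 1]] val[of 1] j by (auto simp: h_1)
  have "has_value x (gen F / coord C j ^ d) (val_at x F / (rep x $ j) ^ d)"
    unfolding has_value_def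
    by (intro exI[of _ d] exI[of _ F] exI[of _ "Poly_Mapping.single (Poly_Mapping.single j d) 1"])
       (use F hom val j in \<open>auto simp: h_1\<close>)
  then show "gen F / coord C j ^ d \<in> \<O> x"
    "ev x (gen F / coord C j ^ d) = val_at x F / (rep x $ j) ^ d"
    using local_ring_iff[OF x] ev_eq[OF x] by blast+
qed

lemma coordinate_quotient:
  assumes x: "x \<in> pts C" and j: "rep x $ j \<noteq> 0"
  shows "coord C i / coord C j \<in> \<O> x" "ev x (coord C i / coord C j) = rep x $ i / rep x $ j"
proof -
  have "homogeneous 1 (Poly_Mapping.single (Poly_Mapping.single i 1) 1)"
    by (intro homogeneous_single) simp
  from monomial_quotient(2,3)[OF x j this]
  show "coord C i / coord C j \<in> \<O> x" "ev x (coord C i / coord C j) = rep x $ i / rep x $ j"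
    by (simp_all add: h_1 val_at_def)
qed

lemma ex_rep_nonzero: "x \<in> pts C \<Longrightarrow> \<exists>j. rep x $ j \<noteq> 0"
  using rep(1)[of x] by (auto simp: vec_eq_iff)

text \<open>Dividing both forms of a quotient by the same power of a coordinate that is nonzero at x
  makes them regular germs.\<close>

lemma local_ring_fraction:
  assumes x: "x \<in> pts C"
  obtains p q where "p \<in> \<O> x" "q \<in> \<O> x" "q \<noteq> 0" "f = p / q"
proof -
  obtain j where j: "rep x $ j \<noteq> 0"
    using ex_rep_nonzero[OF x] by blast
  obtain d F G where 1: "homogeneous d F" "homogeneous d G" "gen G \<noteq> 0"
    "f = gen F / gen G"
    using ratio_of_forms by blast
  show ?thesis
    using that[OF monomial_quotient(2)[OF x j 1(1)] monomial_quotient(2)[OF x j 1(2)]]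
      monomial_quotient(1)[OF x j 1(1)] 1 by simp
qed

text \<open>If a transcendental z were the constant c, then X - c would be a relation for
  it.\<close>

lemma ex_nonconstant: "\<exists>f. f \<notin> range (const C)"
proof (rule ccontr)
  assume const: "\<not> ?thesis"
  obtain z where z: "alg_independent (const C) {z}"
    using trdeg unfolding has_trdeg_def by (auto simp: card_1_singleton_iff)
  obtain c where c: "z = const C c"
    using const by blast
  let ?F = "Poly_Mapping.single (Poly_Mapping.single z 1) 1 + Poly_Mapping.single 0 (- c) :: 'k mpoly"
  have "peval (const C) ?F (\<lambda>x. x) = 0"
    unfolding peval_add peval_single meval_single meval_0 h_minus c[symmetric] by (simp add: h_1)
  moreover have "\<forall>m\<in>Poly_Mapping.keys ?F. Poly_Mapping.keys m \<subseteq> {z}"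
  proof
    fix m :: "'k \<Rightarrow>\<^sub>0 nat" assume "m \<in> Poly_Mapping.keys ?F"
    then have "m \<in> Poly_Mapping.keys (Poly_Mapping.single (Poly_Mapping.single z 1) (1::complex)) \<union>
        Poly_Mapping.keys (Poly_Mapping.single (0 :: 'k \<Rightarrow>\<^sub>0 nat) (- c))"
      by (rule subsetD[OF Poly_Mapping.keys_add])
    then show "Poly_Mapping.keys m \<subseteq> {z}"
      by (auto split: if_splits)
  qed
  ultimately have F: "?F = 0"
    using z unfolding alg_independent_def by blast
  have "Poly_Mapping.single z (1::nat) \<noteq> 0"
    by (metis lookup_single_eq lookup_zero one_neq_zero)
  then have "Poly_Mapping.lookup ?F (Poly_Mapping.single z 1) = 1"
    by (simp add: lookup_add lookup_single when_def del: One_nat_def)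
  then show False
    by (simp only: F lookup_zero) simp
qed

text \<open>The definition would admit t = 0 if the maximal ideal were zero. Then every regular germ
  equals its value, so every function is constant, against transcendence degree one.\<close>

lemma uniformizer_nonzero:
  assumes x: "x \<in> pts C" and t: "uniformizer C x t"
  shows "t \<noteq> 0"
proof
  assume "t = 0"
  then have zero: "f = 0" if "f \<in> \<O> x" "ev x f = 0" for f
    using t that max_ideal_iff[OF x, of f] by (auto simp: uniformizer_def)
  have const: "f = const C (ev x f)" if "f \<in> \<O> x" for f
  proof -
    have "f + const C (- ev x f) = 0"
      by (rule zero) (use that x in \<open>simp_all add: local_ring_add local_ring_const ev_add ev_const del: add_uminus_conv_diff\<close>)
    then show ?thesis
      by (simp add: h_minus)
  qed
  have "f \<in> range (const C)" for f
  proof -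
    obtain p q where pq: "p \<in> \<O> x" "q \<in> \<O> x" "q \<noteq> 0" "f = p / q"
      by (rule local_ring_fraction[OF x])
    then have "f = const C (ev x p * inverse (ev x q))"
      using const[of p] const[of q] by (simp add: h_mult h_inverse divide_inverse)
    then show ?thesis
      by blast
  qed
  then show False
    using ex_nonconstant by blast
qed

lemma uniformizerD:
  assumes "x \<in> pts C" "uniformizer C x t"
  shows "t \<in> \<O> x" "ev x t = 0" "\<And>f. f \<in> \<O> x \<Longrightarrow> ev x f = 0 \<Longrightarrow> \<exists>g\<in>\<O> x. f = g * t"
proof -
  have "1 * t \<in> max_ideal C x"
    using assms local_ring_1 unfolding uniformizer_def by blast
  then show "t \<in> \<O> x" "ev x t = 0"
    using max_ideal_iff[OF assms(1)] by auto
  fix f assume "f \<in> \<O> x" "ev x f = 0"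
  then have "f \<in> max_ideal C x"
    using max_ideal_iff[OF assms(1)] by auto
  then show "\<exists>g\<in>\<O> x. f = g * t"
    using assms(2) unfolding uniformizer_def by blast
qed

text \<open>
  The term of lowest order in an algebraic relation between \<open>t\<close> and \<open>f\<close> makes \<open>f\<close> divide a power
  of \<open>t\<close> up to a unit.
\<close>

lemma not_infinitely_divisible:
  assumes x: "x \<in> pts C" and t: "uniformizer C x t" and f: "f \<in> \<O> x" "f \<noteq> 0"
  shows "\<exists>n. \<forall>g\<in>\<O> x. f \<noteq> g * t ^ n"
proof -
  note tD = uniformizerD[OF x t]
  obtain M n c where rel: "(\<Sum>j\<le>M. const C (c 0 j) * t ^ j) =
      f * - (\<Sum>i<n. \<Sum>j\<le>M. const C (c (Suc i) j) * (f ^ i * t ^ j))"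
    and nz: "\<exists>j\<le>M. c 0 j \<noteq> 0"
    by (rule trdeg_1_relation[OF trdeg f(2)])
  define a where "a = - (\<Sum>i<n. \<Sum>j\<le>M. const C (c (Suc i) j) * (f ^ i * t ^ j))"
  have a: "a \<in> \<O> x"
    unfolding a_def by (intro local_ring_minus local_ring_sum local_ring_mult local_ring_const local_ring_power x f tD)
  define j0 where "j0 = (LEAST j. j \<le> M \<and> c 0 j \<noteq> 0)"
  have j0: "j0 \<le> M \<and> c 0 j0 \<noteq> 0"
    unfolding j0_def by (rule LeastI_ex) (use nz in blast)
  have j0_min: "c 0 j = 0" if "j < j0" for j
    using not_less_Least[of j "\<lambda>j. j \<le> M \<and> c 0 j \<noteq> 0"] that j0 unfolding j0_def by auto
  define u where "u = (\<Sum>j\<in>{j0..M}. const C (c 0 j) * t ^ (j - j0))"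
  have "f * a = (\<Sum>j\<in>{j0..M}. const C (c 0 j) * t ^ j)"
    unfolding a_def rel[symmetric] by (rule sum.mono_neutral_right) (auto simp: j0_min h_0)
  also have "\<dots> = t ^ j0 * u"
    unfolding u_def sum_distrib_left
    by (rule sum.cong) (simp_all add: power_add[symmetric] mult.left_commute)
  finally have fa: "f * a = t ^ j0 * u" .
  have "ev x u = (\<Sum>j\<in>{j0..M}. c 0 j * ev x t ^ (j - j0))"
    unfolding u_def
    by (subst ev_sum[OF x])
       (auto intro!: sum.cong local_ring_mult local_ring_const local_ring_power x tD
         simp: ev_mult[OF x local_ring_const[OF x] local_ring_power[OF x tD(1)]] ev_const[OF x] ev_power[OF x tD(1)])
  also have "\<dots> = (\<Sum>j\<in>{j0..M}. if j = j0 then c 0 j else 0)"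
    by (rule sum.cong) (auto simp: tD(2))
  also have "\<dots> = c 0 j0"
    using j0 by simp
  finally have evu: "ev x u \<noteq> 0"
    using j0 by simp
  have "f \<noteq> g * t ^ Suc j0" if g: "g \<in> \<O> x" for g
  proof
    assume f: "f = g * t ^ Suc j0"
    have "t ^ j0 * u = t ^ j0 * (g * t * a)"
      using fa[symmetric] by (simp only: f power_Suc mult_ac)
    then have "u = g * t * a"
      using uniformizer_nonzero[OF x t] by simp
    then have "ev x u = ev x g * ev x t * ev x a"
      using g a tD by (simp add: ev_mult[OF x] local_ring_mult[OF x])
    then show False
      using evu tD(2) by simp
  qed
  then show ?thesis
    by blast
qed

section \<open>The discrete valuation at a point\<close>

lemma local_unit_mult:
  assumes "x \<in> pts C" "local_unit C x u" "local_unit C x w"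
  shows "local_unit C x (u * w)"
  using assms by (simp add: local_unit_iff local_ring_mult ev_mult)

lemma local_unit_inverse:
  "local_unit C x u \<Longrightarrow> local_unit C x (inverse u)"
  by (simp add: local_unit_def)

lemma local_unit_powi:
  assumes "x \<in> pts C" "local_unit C x u"
  shows "local_unit C x (u powi n)"
proof -
  have "local_unit C x (w ^ m)" if "local_unit C x w" for w m
    using that assms(1) by (simp add: local_unit_iff local_ring_power ev_power)
  then show ?thesis
    using local_unit_inverse[OF assms(2)] assms(2) by (simp add: power_int_def)
qed

text \<open>For regular f the exponent precedes the least n such that t^n does not divide f; the
  cofactor has a nonzero value, for otherwise one more t would split off. Quotients of germs give
  the general case.\<close>

lemma uniformizer_decomposition:
  assumes x: "x \<in> pts C" and t: "uniformizer C x t" and f: "f \<noteq> 0"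
  obtains n u where "local_unit C x u" "f = t powi n * u"
proof -
  note tD = uniformizerD[OF x t] and t0 = uniformizer_nonzero[OF x t]
  have dec: "\<exists>n u. local_unit C x u \<and> f = t ^ n * u" if f: "f \<in> \<O> x" "f \<noteq> 0" for f
  proof -
    let ?P = "\<lambda>n. \<forall>g\<in>\<O> x. f \<noteq> g * t ^ n"
    have "\<exists>n. ?P n"
      by (rule not_infinitely_divisible[OF x t f])
    then have P: "?P (LEAST n. ?P n)"
      by (rule LeastI_ex)
    then have "(LEAST n. ?P n) \<noteq> 0"
      using f(1) by (metis mult.right_neutral power_0)
    then obtain n where n: "(LEAST n. ?P n) = Suc n"
      using not0_implies_Suc by blast
    then have "\<not> ?P n"
      using not_less_Least[of n ?P] by simp
    then obtain g where g: "g \<in> \<O> x" "f = g * t ^ n"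
      by blast
    have "ev x g \<noteq> 0"
    proof
      assume "ev x g = 0"
      then obtain g' where "g' \<in> \<O> x" "g = g' * t"
        using tD(3) g(1) by blast
      then have "f = g' * t ^ Suc n"
        using g(2) by simp
      moreover have "?P (Suc n)"
        using P unfolding n .
      ultimately show False
        using \<open>g' \<in> \<O> x\<close> by blast
    qed
    then show ?thesis
      using g local_unit_iff[OF x] by (auto simp: mult.commute)
  qed
  obtain p q where pq: "p \<in> \<O> x" "q \<in> \<O> x" "q \<noteq> 0" "f = p / q"
    by (rule local_ring_fraction[OF x])
  then have "p \<noteq> 0"
    using f by auto
  obtain n u where 1: "local_unit C x u" "p = t ^ n * u"
    using dec pq(1) \<open>p \<noteq> 0\<close> by blast
  obtain m w where 2: "local_unit C x w" "q = t ^ m * w"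
    using dec pq(2,3) by blast
  have "f = t powi (int n - int m) * (u * inverse w)"
    using pq(4) 1 2 t0 by (simp add: power_int_diff divide_simps)
  then show ?thesis
    using that local_unit_mult[OF x 1(1) local_unit_inverse[OF 2(1)]] by blast
qed

text \<open>Justifies the definite description in \<open>ord_at\<close>: two uniformizers differ by
  a unit, and no nonzero power of t is a unit.\<close>

lemma ord_at_eq:
  assumes x: "x \<in> pts C" and t: "uniformizer C x t" and u: "local_unit C x u"
  shows "ord_at C x (t powi n * u) = n"
proof -
  note t0 = uniformizer_nonzero[OF x t]
  have not_pos: "\<not> 0 < k" if "local_unit C x (t powi k)" for k :: int
  proof
    assume "0 < k"
    then have "ev x (t powi k) = 0"
      using uniformizerD[OF x t] by (simp add: power_int_def ev_power[OF x])
    then show False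
      using that local_unit_iff[OF x] by blast
  qed
  have uniq: "m = n" if t': "uniformizer C x t'" and u': "local_unit C x u'"
    and eq: "t powi n * u = t' powi m * u'" for m t' u'
  proof -
    obtain g where g: "g \<in> \<O> x" "t' = g * t"
      using uniformizerD[OF x t] uniformizerD[OF x t'] by blast
    obtain g' where g': "g' \<in> \<O> x" "t = g' * t'"
      using uniformizerD[OF x t] uniformizerD[OF x t'] by blast
    have "g * g' = 1"
      using g(2) g'(2) t0 by (metis mult.assoc mult.commute mult_cancel_right1)
    then have "ev x g * ev x g' = 1"
      using g g' ev_mult[OF x] ev_1[OF x] by metis
    then have "ev x g \<noteq> 0"
      by (metis mult_zero_left zero_neq_one)
    then have gu: "local_unit C x g"
      by (simp add: local_unit_iff[OF x] g(1))
    let ?w = "(g powi m * u') * inverse u"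
    have w: "local_unit C x ?w"
      using gu u u' by (intro local_unit_mult local_unit_powi local_unit_inverse x)
    have "u \<noteq> 0"
      using u by (simp add: local_unit_def)
    have "t powi (n - m) = ?w"
      using eq t0 \<open>u \<noteq> 0\<close> g(2) by (simp add: power_int_diff power_int_mult_distrib divide_simps mult_ac)
    then have "local_unit C x (t powi (n - m))" "local_unit C x (t powi (m - n))"
      using w local_unit_inverse[OF w] power_int_minus[of t "n - m"] by auto
    then show "m = n"
      using not_pos[of "n - m"] not_pos[of "m - n"] by simp
  qed
  show ?thesis
    unfolding ord_at_def
    by (rule the_equality) (use t u uniq in \<open>blast+\<close>)
qed

abbreviation ord :: "'n ppoint \<Rightarrow> 'k \<Rightarrow> int" where
  "ord \<equiv> ord_at C"

lemma ord_decomposition: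
  assumes x: "x \<in> pts C" and t: "uniformizer C x t" and f: "f \<noteq> 0"
  obtains u where "local_unit C x u" "f = t powi ord x f * u"
  using uniformizer_decomposition[OF assms] ord_at_eq[OF x t] by metis

lemma ord_mult:
  assumes x: "x \<in> pts C" and "f \<noteq> 0" "g \<noteq> 0"
  shows "ord x (f * g) = ord x f + ord x g"
proof -
  obtain t where t: "uniformizer C x t"
    using ex_uniformizer[OF x] by blast
  obtain u where u: "local_unit C x u" "f = t powi ord x f * u"
    by (rule ord_decomposition[OF x t assms(2)])
  obtain w where w: "local_unit C x w" "g = t powi ord x g * w"
    by (rule ord_decomposition[OF x t assms(3)])
  have "f * g = (t powi ord x f * u) * (t powi ord x g * w)"
    using u(2) w(2) by presburger
  also have "\<dots> = t powi (ord x f + ord x g) * (u * w)"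
    using uniformizer_nonzero[OF x t] by (simp add: power_int_add mult_ac)
  finally have "f * g = t powi (ord x f + ord x g) * (u * w)" .
  then show ?thesis
    using ord_at_eq[OF x t local_unit_mult[OF x u(1) w(1)]] by simp
qed

lemma ord_unit: "x \<in> pts C \<Longrightarrow> local_unit C x u \<Longrightarrow> ord x u = 0"
  using ex_uniformizer[of x] ord_at_eq[of x _ u 0] by auto

lemma ord_const: "x \<in> pts C \<Longrightarrow> c \<noteq> 0 \<Longrightarrow> ord x (const C c) = 0"
  by (rule ord_unit) (simp_all add: local_unit_iff local_ring_const ev_const)

lemma ord_powi_uniformizer: "x \<in> pts C \<Longrightarrow> uniformizer C x t \<Longrightarrow> ord x (t powi n) = n"
  using ord_at_eq[of x t 1 n] by (simp add: local_unit_iff local_ring_1 ev_1)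

lemma ord_uniformizer: "x \<in> pts C \<Longrightarrow> uniformizer C x t \<Longrightarrow> ord x t = 1"
  using ord_powi_uniformizer[of x t 1] by simp

lemma local_ring_iff_ord:
  assumes x: "x \<in> pts C" and "f \<noteq> 0"
  shows "f \<in> \<O> x \<longleftrightarrow> ord x f \<ge> 0"
proof -
  obtain t where t: "uniformizer C x t"
    using ex_uniformizer[OF x] by blast
  note tD = uniformizerD[OF x t]
  obtain u where u: "local_unit C x u" "f = t powi ord x f * u"
    by (rule ord_decomposition[OF x t assms(2)])
  have u': "u \<in> \<O> x" "inverse u \<in> \<O> x" "u \<noteq> 0"
    using u(1) by (auto simp: local_unit_def)
  show ?thesis
  proof
    assume "ord x f \<ge> 0"
    then have "t powi ord x f \<in> \<O> x"
      using tD by (simp add: power_int_def local_ring_power[OF x])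
    then show "f \<in> \<O> x"
      using u u' local_ring_mult[OF x] by metis
  next
    assume f: "f \<in> \<O> x"
    show "ord x f \<ge> 0"
    proof (rule ccontr)
      assume "\<not> ord x f \<ge> 0"
      then obtain n where n: "ord x f = - int (Suc n)"
        by (metis not_le_imp_less negD)
      have "f * t ^ Suc n = u"
        using u(2) uniformizer_nonzero[OF x t] unfolding n
        by (simp add: power_int_minus divide_simps del: of_nat_Suc power_Suc)
      then have "ev x u = 0"
        using f tD by (auto simp: ev_mult[OF x] local_ring_mult[OF x] ev_power[OF x] local_ring_power[OF x])
      then show False
        using u(1) local_unit_iff[OF x] by blast
    qed
  qed
qed

lemma ord_inverse:
  assumes x: "x \<in> pts C" and "f \<noteq> 0"
  shows "ord x (inverse f) = - ord x f"
  using ord_mult[OF x assms(2), of "inverse f"] ord_const[OF x, of 1] assms(2) by (simp add: h_1)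

lemma ord_add:
  assumes x: "x \<in> pts C" and "f \<noteq> 0" "g \<noteq> 0" "f + g \<noteq> 0"
  shows "min (ord x f) (ord x g) \<le> ord x (f + g)"
proof -
  have *: "ord x f \<le> ord x (f + g)" if "f \<noteq> 0" "g \<noteq> 0" "f + g \<noteq> 0" "ord x f \<le> ord x g" for f g
  proof -
    let ?h = "1 + g * inverse f"
    have "g * inverse f \<in> \<O> x"
      using that by (subst local_ring_iff_ord[OF x]) (simp_all add: ord_mult[OF x] ord_inverse[OF x])
    then have h: "?h \<in> \<O> x"
      by (intro local_ring_add local_ring_1 x)
    have eq: "f + g = f * ?h"
      using that by (simp add: field_simps)
    then have "?h \<noteq> 0"
      using that(3) by auto
    then show ?thesis
      unfolding eq using h local_ring_iff_ord[OF x] ord_mult[OF x that(1)] by simp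
  qed
  show ?thesis
    using *[of f g] *[of g f] assms by (cases "ord x f \<le> ord x g") (auto simp: add.commute)
qed

text \<open>The residue field is the field of constants, c being the value of f at x.\<close>

lemma residue_constant:
  assumes x: "x \<in> pts C" and "f \<in> \<O> x"
  shows "\<exists>c. f = const C c \<or> ord x (f - const C c) \<ge> 1"
proof -
  obtain t where t: "uniformizer C x t"
    using ex_uniformizer[OF x] by blast
  let ?g = "f + const C (- ev x f)"
  have g: "?g \<in> \<O> x" "ev x ?g = 0"
    using assms by (simp_all add: local_ring_add local_ring_const ev_add ev_const)
  then obtain w where w: "w \<in> \<O> x" "?g = w * t"
    using uniformizerD[OF x t] by blast
  have "ord x ?g \<ge> 1" if "?g \<noteq> 0"
    using w that local_ring_iff_ord[OF x, of w] ord_uniformizer[OF x t] uniformizer_nonzero[OF x t]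
    by (auto simp: ord_mult[OF x])
  then show ?thesis
    by (intro exI[of _ "ev x f"]) (auto simp: h_minus)
qed

text \<open>On the chart where coordinate j is nonzero, each affine coordinate of a zero of G is a
  root of one fixed nonzero polynomial, obtained from an algebraic relation with g = G /
  x_j^d.\<close>

lemma finite_vanishing:
  assumes G: "homogeneous d G" "gen G \<noteq> 0"
  shows "finite {x \<in> pts C. val_at x G = 0}"
proof -
  have fin: "finite {x \<in> pts C. val_at x G = 0 \<and> rep x $ j \<noteq> 0}" for j
  proof (cases "coord C j = 0")
    case True
    \<comment> \<open>A coordinate that is zero at the generic point vanishes on the whole curve, so
      this chart is empty.\<close>
    then have "{x \<in> pts C. val_at x G = 0 \<and> rep x $ j \<noteq> 0} = {}"
      using monomial_quotient(1)[OF _ _ G(1), of _ j] by auto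
    then show ?thesis
      by (simp only: finite.emptyI)
  next
    case False
    define g where "g = gen G / coord C j ^ d"
    have g0: "g \<noteq> 0"
      using False G(2) by (simp add: g_def)
    have "\<exists>S. finite S \<and> (\<forall>x\<in>pts C. val_at x G = 0 \<and> rep x $ j \<noteq> 0 \<longrightarrow> rep x $ i / rep x $ j \<in> S)" for i
    proof -
      define a where "a = coord C i / coord C j"
      obtain M n c where rel: "(\<Sum>j\<le>M. const C (c 0 j) * a ^ j) =
          g * - (\<Sum>i<n. \<Sum>j\<le>M. const C (c (Suc i) j) * (g ^ i * a ^ j))"
        and nz: "\<exists>j\<le>M. c 0 j \<noteq> 0"
        by (rule trdeg_1_relation[OF trdeg g0])
      define q where "q = (\<Sum>j\<le>M. monom (c 0 j) j)"
      have "q \<noteq> 0"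
      proof -
        obtain j where "j \<le> M" "c 0 j \<noteq> 0"
          using nz by blast
        then have "coeff q j \<noteq> 0"
          by (simp add: q_def coeff_sum)
        then show ?thesis
          by auto
      qed
      then have "finite {r. poly q r = 0}"
        by (rule poly_roots_finite)
      moreover have "poly q (rep x $ i / rep x $ j) = 0"
        if x: "x \<in> pts C" and v: "val_at x G = 0" and j: "rep x $ j \<noteq> 0" for x
      proof -
        have g: "g \<in> \<O> x" "ev x g = 0"
          using monomial_quotient[OF x j G(1)] v by (auto simp: g_def)
        have a: "a \<in> \<O> x" "ev x a = rep x $ i / rep x $ j"
          using coordinate_quotient[OF x j] by (auto simp: a_def)
        have q: "- (\<Sum>i<n. \<Sum>j\<le>M. const C (c (Suc i) j) * (g ^ i * a ^ j)) \<in> \<O> x"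
          by (intro local_ring_minus local_ring_sum local_ring_mult local_ring_const local_ring_power x g a)
        \<comment> \<open>At a zero of g the right side of the relation has value 0, leaving a
          polynomial equation for the value of a.\<close>
        have "0 = ev x (\<Sum>j\<le>M. const C (c 0 j) * a ^ j)"
          unfolding rel ev_mult[OF x g(1) q] g(2) by simp
        also have "\<dots> = (\<Sum>j\<le>M. c 0 j * ev x a ^ j)"
          using a by (subst ev_sum[OF x])
            (simp_all add: local_ring_mult[OF x] local_ring_power[OF x] ev_mult[OF x] ev_power[OF x]
              local_ring_const[OF x] ev_const[OF x])
        also have "\<dots> = poly q (ev x a)"
          by (simp add: q_def poly_sum poly_monom)
        finally show ?thesis
          using a(2) by simp
      qed
      ultimately show ?thesis
        by (intro exI[of _ "{r. poly q r = 0}"]) auto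
    qed
    then obtain S where S: "\<And>i. finite (S i)"
      "\<And>i x. x \<in> pts C \<Longrightarrow> val_at x G = 0 \<Longrightarrow> rep x $ j \<noteq> 0 \<Longrightarrow> rep x $ i / rep x $ j \<in> S i"
      by metis
    have "finite {v :: complex ^ 'n. \<forall>i. v $ i \<in> S i}"
    proof (rule finite_surj)
      show "finite (Pi\<^sub>E UNIV S :: ('n \<Rightarrow> complex) set)"
        using S(1) by (intro finite_PiE) auto
      show "{v. \<forall>i. v $ i \<in> S i} \<subseteq> vec_lambda ` (Pi\<^sub>E UNIV S)"
      proof
        fix v :: "complex ^ 'n" assume "v \<in> {v. \<forall>i. v $ i \<in> S i}"
        then have "v = vec_lambda (($) v)" "($) v \<in> Pi\<^sub>E UNIV S"
          by (auto simp: PiE_def)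
        then show "v \<in> vec_lambda ` (Pi\<^sub>E UNIV S)"
          by (rule image_eqI)
      qed
    qed
    moreover have "{x \<in> pts C. val_at x G = 0 \<and> rep x $ j \<noteq> 0} \<subseteq> pline (*s) ` {v. \<forall>i. v $ i \<in> S i}"
    proof
      fix x assume "x \<in> {x \<in> pts C. val_at x G = 0 \<and> rep x $ j \<noteq> 0}"
      then have x: "x \<in> pts C" "val_at x G = 0" and j: "rep x $ j \<noteq> 0"
        by auto
      let ?v = "\<chi> i. rep x $ i / rep x $ j"
      have v: "rep x = (rep x $ j) *s ?v"
        using j by (simp add: vec_eq_iff)
      have "range (\<lambda>c. c *s rep x) = range (\<lambda>c. c *s ?v)"
      proof (intro equalityI subsetI)
        fix w assume "w \<in> range (\<lambda>c. c *s rep x)"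
        then obtain c where "w = c *s rep x"
          by blast
        then have "w = (c * rep x $ j) *s ?v"
          using v by (metis vector_smult_assoc)
        then show "w \<in> range (\<lambda>c. c *s ?v)"
          by blast
      next
        fix w assume "w \<in> range (\<lambda>c. c *s ?v)"
        then obtain c where "w = c *s ?v"
          by blast
        then have "w = (c / rep x $ j) *s rep x"
          using j by (simp add: vec_eq_iff)
        then show "w \<in> range (\<lambda>c. c *s rep x)"
          by blast
      qed
      then have "x = pline (*s) ?v"
        using rep(2)[OF x(1)] by (simp add: pline_def)
      moreover have "?v \<in> {v. \<forall>i. v $ i \<in> S i}"
        using S(2)[OF x j] by simp
      ultimately show "x \<in> pline (*s) ` {v. \<forall>i. v $ i \<in> S i}"
        by blast
    qed
    ultimately show ?thesis
      by (meson finite_imageI finite_subset)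
  qed
  have "{x \<in> pts C. val_at x G = 0} \<subseteq> (\<Union>j. {x \<in> pts C. val_at x G = 0 \<and> rep x $ j \<noteq> 0})"
    using ex_rep_nonzero by auto
  then show ?thesis
    by (rule finite_subset) (use fin in auto)
qed

text \<open>Away from the zeros of its numerator and denominator, f is a unit.\<close>

lemma finite_support:
  assumes "f \<noteq> 0"
  shows "finite {x \<in> pts C. ord x f \<noteq> 0}"
proof -
  obtain d F G where 1: "homogeneous d F" "homogeneous d G" "gen G \<noteq> 0"
    "f = gen F / gen G"
    using ratio_of_forms by blast
  then have F: "gen F \<noteq> 0"
    using assms by auto
  have "ord x f = 0" if x: "x \<in> pts C" and "val_at x F \<noteq> 0" "val_at x G \<noteq> 0" for x
  proof -
    have "has_value x f (val_at x F / val_at x G)"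
      unfolding has_value_def using 1 that by blast
    then show ?thesis
      using that ord_unit[OF x] local_unit_iff[OF x] local_ring_iff[OF x] ev_eq[OF x] by (metis divide_eq_0_iff)
  qed
  then have "{x \<in> pts C. ord x f \<noteq> 0} \<subseteq> {x \<in> pts C. val_at x F = 0} \<union> {x \<in> pts C. val_at x G = 0}"
    by blast
  then show ?thesis
    by (rule finite_subset) (use finite_vanishing 1 F in auto)
qed

end

section \<open>Riemann-Roch on a curve of genus one\<close>

context comm_algebra
begin

text \<open>Records finite-dimensionality together with the dimension, which a value of
  \<open>dim\<close> alone does not.\<close>

definition has_dim :: "'a set \<Rightarrow> nat \<Rightarrow> bool" where
  "has_dim V n \<longleftrightarrow> (\<exists>B. finite B \<and> card B = n \<and> independent B \<and> span B = V)"

lemma has_dim_dim: "has_dim V n \<Longrightarrow> dim V = n"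
  unfolding has_dim_def using dim_span_eq_card_independent by metis

lemma has_dim_unique: "has_dim V n \<Longrightarrow> has_dim V m \<Longrightarrow> n = m"
  using has_dim_dim by metis

lemma span_insert_span: "span (insert w (span B)) = span (insert w B)"
proof
  have "span B \<subseteq> span (insert w B)"
    by (rule span_mono) blast
  then show "span (insert w (span B)) \<subseteq> span (insert w B)"
    by (intro span_minimal subspace_span) (simp add: span_base)
  show "span (insert w B) \<subseteq> span (insert w (span B))"
    using span_superset[of B] by (intro span_mono) blast
qed

lemma has_dim_insert:
  assumes "has_dim V n" "w \<notin> V"
  shows "has_dim (span (insert w V)) (Suc n)"
proof -
  obtain B where B: "finite B" "card B = n" "independent B" "span B = V"
    using assms(1) unfolding has_dim_def by metis
  have "w \<notin> B"
    using B(4) assms(2) span_base by metis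
  moreover have "independent (insert w B)"
    using B assms(2) by (simp add: independent_insert)
  moreover have "span (insert w B) = span (insert w V)"
    using B(4) span_insert_span by metis
  ultimately show ?thesis
    unfolding has_dim_def using B by (intro exI[of _ "insert w B"]) simp
qed

text \<open>Finite-dimensionality of V is a conclusion: an independent subset of V is bounded by the
  finite spanning set of the larger space.\<close>

lemma has_dim_remove:
  assumes "subspace V" "w \<notin> V" "has_dim (span (insert w V)) n"
  obtains m where "n = Suc m" "has_dim V m"
proof -
  obtain B where B: "B \<subseteq> V" "independent B" "V \<subseteq> span B"
    by (rule maximal_independent_subset)
  have V: "span B = V"
    using B assms(1) by (metis span_minimal subset_antisym)
  have ind: "independent (insert w B)"
    using B assms(2) V by (simp add: independent_insert)
  obtain B' where B': "finite B'" "card B' = n" "span B' = span (insert w V)"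
    using assms(3) unfolding has_dim_def by metis
  have "insert w B \<subseteq> span B'"
    unfolding B'(3) using B(1) span_superset[of "insert w V"] by blast
  then have fin: "finite (insert w B)"
    using independent_span_bound[OF B'(1) ind] by simp
  have "span (insert w B) = span (insert w V)"
    using V span_insert_span by metis
  then have "has_dim (span (insert w V)) (card (insert w B))"
    unfolding has_dim_def using fin ind by metis
  then have "card (insert w B) = n"
    using has_dim_unique assms(3) by blast
  moreover have "w \<notin> B"
    using assms(2) B(1) by blast
  ultimately have "n = Suc (card B)"
    using fin by simp
  moreover have "has_dim V (card B)"
    unfolding has_dim_def using fin B V by auto
  ultimately show ?thesis
    by (rule that)
qed

lemma has_dim_pos:
  assumes "has_dim V n" "n > 0"
  shows "\<exists>v\<in>V. v \<noteq> 0"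
proof -
  obtain B where B: "finite B" "card B = n" "independent B" "span B = V"
    using assms(1) unfolding has_dim_def by metis
  then obtain b where b: "b \<in> B"
    using assms(2) by fastforce
  then have "b \<noteq> 0"
    using B(3) dependent_zero by metis
  then show ?thesis
    using b B(4) span_base by metis
qed

lemma has_dim_1:
  assumes "has_dim V 1" "v \<in> V" "v \<noteq> 0" "w \<in> V"
  shows "\<exists>c. w = scale c v"
proof -
  obtain b where b: "span {b} = V"
    using assms(1) unfolding has_dim_def by (auto simp: card_1_singleton_iff)
  obtain c d where cd: "v = scale c b" "w = scale d b"
    using assms(2,4) unfolding b[symmetric] span_singleton by auto
  then have "c \<noteq> 0"
    using assms(3) by auto
  then have "w = scale (d / c) v"
    using cd by simp
  then show ?thesis ..
qed

text \<open>Multiplication by a unit is an injective linear map.\<close>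

lemma
  assumes "u * u' = 1"
  shows inj_mult_unit: "inj ((*) u)"
    and independent_mult_unit: "independent B \<Longrightarrow> independent ((*) u ` B)"
    and span_mult_unit: "span ((*) u ` B) = (*) u ` span B"
proof -
  interpret vs: vector_space_pair scale scale ..
  have lin: "Vector_Spaces.linear scale scale ((*) u)"
  proof (rule Vector_Spaces.linear_iff[THEN iffD2], intro conjI allI)
    show "u * scale r b = scale r (u * b)" for r b
      using scale_mult_left[of r b u] by (simp add: mult.commute)
  qed (simp_all add: distrib_left vector_space_axioms)
  show inj: "inj ((*) u)"
  proof (rule injI)
    fix x y assume "u * x = u * y"
    then have "u * u' * x = u * u' * y"
      by (metis mult.assoc mult.commute)
    then show "x = y"
      using assms by simp
  qed
  show "independent ((*) u ` B)" if "independent B"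
    by (rule vs.linear_independent_injective_image[OF lin that]) (rule inj_on_subset[OF inj subset_UNIV])
  show "span ((*) u ` B) = (*) u ` span B"
    by (rule vs.linear_span_image[OF lin])
qed

lemma has_dim_mult_unit:
  assumes "has_dim V n" "u * u' = 1"
  shows "has_dim ((*) u ` V) n"
proof -
  obtain B where B: "finite B" "card B = n" "independent B" "span B = V"
    using assms(1) unfolding has_dim_def by metis
  have "card ((*) u ` B) = n"
    using B(2) inj_mult_unit[OF assms(2)] by (simp add: card_image inj_on_subset)
  then show ?thesis
    unfolding has_dim_def
    using B independent_mult_unit[OF assms(2) B(3)] span_mult_unit[OF assms(2), of B]
    by (intro exI[of _ "(*) u ` B"]) simp
qed

end

lemma multiple_point_simps [simp]:
  "multiple_point n x x = n"
  "y \<noteq> x \<Longrightarrow> multiple_point n x y = 0"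
  by (simp_all add: multiple_point_def)

section \<open>Divisors and their spaces of sections\<close>

context curve
begin

text \<open>Treats the order of 0 as infinite; \<open>ord_at\<close> has no meaningful value
  there.\<close>

definition vge :: "'n ppoint \<Rightarrow> int \<Rightarrow> 'k \<Rightarrow> bool" where
  "vge x n f \<longleftrightarrow> f = 0 \<or> n \<le> ord x f"

lemma vge_0 [simp]: "vge x n 0"
  by (simp add: vge_def)

lemma local_ring_iff_vge: "x \<in> pts C \<Longrightarrow> f \<in> \<O> x \<longleftrightarrow> vge x 0 f"
  using local_ring_iff_ord[of x f] local_ring_0[of x] by (auto simp: vge_def)

lemma vge_mono: "vge x n f \<Longrightarrow> m \<le> n \<Longrightarrow> vge x m f"
  by (auto simp: vge_def)

lemma vge_add: "x \<in> pts C \<Longrightarrow> vge x n f \<Longrightarrow> vge x n g \<Longrightarrow> vge x n (f + g)"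
  using ord_add[of x f g] by (fastforce simp: vge_def)

lemma vge_mult: "x \<in> pts C \<Longrightarrow> vge x n f \<Longrightarrow> vge x m g \<Longrightarrow> vge x (n + m) (f * g)"
  using ord_mult[of x f g] by (fastforce simp: vge_def)

lemma vge_const: "x \<in> pts C \<Longrightarrow> vge x 0 (const C c)"
  using local_ring_const local_ring_iff_vge by blast

lemma vge_scale: "x \<in> pts C \<Longrightarrow> vge x n f \<Longrightarrow> vge x n (const C c * f)"
  using vge_mult[OF _ vge_const, of x n f c] by simp

lemma vge_minus: "x \<in> pts C \<Longrightarrow> vge x n f \<Longrightarrow> vge x n (- f)"
  using vge_scale[of x n f "-1"] by (simp add: h_minus h_1)

lemma vge_diff: "x \<in> pts C \<Longrightarrow> vge x n f \<Longrightarrow> vge x n g \<Longrightarrow> vge x n (f - g)"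
  using vge_add[of x n f "- g"] vge_minus by simp

definition LL :: "('n ppoint \<Rightarrow> int) \<Rightarrow> 'k set" where
  "LL D = {f. \<forall>x\<in>pts C. vge x (- D x) f}"

lemma LL_cong: "(\<And>x. x \<in> pts C \<Longrightarrow> D x = D' x) \<Longrightarrow> LL D = LL D'"
  by (auto simp: LL_def)

lemma LL_mono: "(\<And>x. x \<in> pts C \<Longrightarrow> D x \<le> D' x) \<Longrightarrow> LL D \<subseteq> LL D'"
  by (fastforce simp: LL_def intro: vge_mono)

lemma subspace_LL: "subspace (LL D)"
  unfolding subspace_def LL_def by (auto intro: vge_add vge_scale)

lemma LL_mult: "f \<in> LL D \<Longrightarrow> g \<in> LL E \<Longrightarrow> f * g \<in> LL (\<lambda>x. D x + E x)"
  using vge_mult[of _ _ f _ g] by (fastforce simp: LL_def)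

definition fin_div :: "('n ppoint \<Rightarrow> int) \<Rightarrow> bool" where
  "fin_div D \<longleftrightarrow> finite {x \<in> pts C. D x \<noteq> 0}"

definition eff :: "('n ppoint \<Rightarrow> int) \<Rightarrow> bool" where
  "eff D \<longleftrightarrow> (\<forall>x\<in>pts C. D x \<ge> 0)"

definition deg :: "('n ppoint \<Rightarrow> int) \<Rightarrow> int" where
  "deg D = (\<Sum>x | x \<in> pts C \<and> D x \<noteq> 0. D x)"

lemma deg_superset:
  assumes "finite S" "S \<subseteq> pts C" "\<And>x. x \<in> pts C \<Longrightarrow> D x \<noteq> 0 \<Longrightarrow> x \<in> S"
  shows "deg D = (\<Sum>x\<in>S. D x)"
  unfolding deg_def by (rule sum.mono_neutral_left) (use assms in auto)

lemma fin_div_add: "fin_div D \<Longrightarrow> fin_div E \<Longrightarrow> fin_div (\<lambda>x. D x + E x)"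
  unfolding fin_div_def
  by (rule finite_subset[of _ "{x \<in> pts C. D x \<noteq> 0} \<union> {x \<in> pts C. E x \<noteq> 0}"]) auto

lemma deg_add:
  assumes "fin_div D" "fin_div E"
  shows "deg (\<lambda>x. D x + E x) = deg D + deg E"
proof -
  let ?S = "{x \<in> pts C. D x \<noteq> 0} \<union> {x \<in> pts C. E x \<noteq> 0}"
  have "finite ?S"
    using assms by (simp add: fin_div_def)
  then show ?thesis
    by (subst (1 2 3) deg_superset[of ?S]) (auto simp: sum.distrib)
qed

lemma fin_div_uminus: "fin_div D \<Longrightarrow> fin_div (\<lambda>x. - D x)"
  by (simp add: fin_div_def)

lemma deg_uminus: "deg (\<lambda>x. - D x) = - deg D"
  by (simp add: deg_def sum_negf)

lemma fin_div_point [simp]: "fin_div (multiple_point n x)"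
  unfolding fin_div_def multiple_point_def
  by (rule finite_subset[of _ "{x}"]) auto

lemma deg_point: "x \<in> pts C \<Longrightarrow> deg (multiple_point n x) = n"
  by (subst deg_superset[of "{x}"]) (auto simp: multiple_point_def split: if_splits)

lemma deg_cong: "(\<And>x. x \<in> pts C \<Longrightarrow> D x = D' x) \<Longrightarrow> deg D = deg D'"
  unfolding deg_def by (rule sum.cong) auto

lemma deg_nonneg: "eff D \<Longrightarrow> deg D \<ge> 0"
  unfolding deg_def eff_def by (intro sum_nonneg) auto

lemma eff_deg_0:
  assumes "fin_div D" "eff D" "deg D = 0" "x \<in> pts C"
  shows "D x = 0"
proof (rule ccontr)
  assume "D x \<noteq> 0"
  moreover have "\<forall>y\<in>{x \<in> pts C. D x \<noteq> 0}. D y = 0"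
    using assms by (subst sum_nonneg_eq_0_iff[symmetric]) (auto simp: fin_div_def eff_def deg_def)
  ultimately show False
    using assms(4) by blast
qed

text \<open>Induction on the degree. The base case covers every D vanishing on the curve, because
  divisors are functions whose values off \<open>pts C\<close> are arbitrary.\<close>

lemma effective_induct:
  assumes fin: "fin_div D" and eff: "eff D"
    and base: "\<And>D. (\<And>x. x \<in> pts C \<Longrightarrow> D x = 0) \<Longrightarrow> P D"
    and step: "\<And>D x. fin_div D \<Longrightarrow> eff D \<Longrightarrow> x \<in> pts C \<Longrightarrow> P D \<Longrightarrow> P (\<lambda>y. D y + multiple_point 1 x y)"
  shows "P D"
proof -
  obtain n where "deg D = int n"
    using deg_nonneg[OF eff] nonneg_int_cases by metis
  then show ?thesis
    using fin eff
  proof (induction n arbitrary: D)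
    case 0
    then show ?case
      using eff_deg_0 base by simp
  next
    case (Suc n)
    have "\<exists>x\<in>pts C. D x \<noteq> 0"
    proof (rule ccontr)
      assume "\<not> ?thesis"
      then have "deg D = 0"
        unfolding deg_def by (intro sum.neutral) auto
      then show False
        using Suc.prems by simp
    qed
    then obtain x where x: "x \<in> pts C" "D x \<noteq> 0"
      by blast
    define D0 where "D0 = (\<lambda>y. D y + multiple_point (- 1) x y)"
    have fin: "fin_div D0"
      unfolding D0_def using Suc.prems by (intro fin_div_add) auto
    moreover have eff: "eff D0"
      using Suc.prems(3) x unfolding eff_def D0_def multiple_point_def by force
    moreover have "deg D0 = int n"
      unfolding D0_def using Suc.prems x by (subst deg_add) (auto simp: deg_point)
    ultimately have "P (\<lambda>y. D0 y + multiple_point 1 x y)"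
      using Suc.IH x step by blast
    moreover have "(\<lambda>y. D0 y + multiple_point 1 x y) = D"
      by (auto simp: D0_def multiple_point_def)
    ultimately show ?case
      by simp
  qed
qed

text \<open>The quotient a / w is regular at x, and c is its value there.\<close>

lemma leading_term:
  assumes x: "x \<in> pts C" and w: "w \<noteq> 0" and a: "vge x (ord x w) a"
  shows "\<exists>c. vge x (ord x w + 1) (a - const C c * w)"
proof -
  have "vge x (ord x w + - ord x w) (a * inverse w)"
    using ord_inverse[OF x w] by (intro vge_mult[OF x a]) (simp add: vge_def)
  then obtain c where "a * inverse w = const C c \<or> ord x (a * inverse w - const C c) \<ge> 1"
    using residue_constant[OF x] local_ring_iff_vge[OF x] by fastforce
  then have "vge x (1 + ord x w) ((a * inverse w - const C c) * w)"
    by (intro vge_mult[OF x]) (auto simp: vge_def)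
  moreover have "(a * inverse w - const C c) * w = a - const C c * w"
    using w by (simp add: left_diff_distrib)
  ultimately show ?thesis
    by (auto simp: add.commute)
qed

text \<open>Allowing one more pole at x adds at most one dimension: by \<open>leading_term\<close>,
  two functions attaining the new order are proportional modulo \<open>LL D\<close>.\<close>

lemma LL_step:
  assumes x: "x \<in> pts C" and w: "w \<in> LL (\<lambda>y. D y + multiple_point 1 x y)" "w \<notin> LL D"
  shows "LL (\<lambda>y. D y + multiple_point 1 x y) = span (insert w (LL D))"
    and "w \<noteq> 0" "ord x w = - D x - 1"
proof -
  let ?D = "\<lambda>y. D y + multiple_point 1 x y"
  have w0: "w \<noteq> 0"
    using w(2) by (auto simp: LL_def)
  have off: "vge y (- D y) f" if "f \<in> LL ?D" "y \<in> pts C" "y \<noteq> x" for f y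
  proof -
    have "vge y (- (D y + multiple_point 1 x y)) f"
      using that(1,2) unfolding LL_def by blast
    then show ?thesis
      using that(3) by simp
  qed
  have at: "vge x (- D x - 1) f" if "f \<in> LL ?D" for f
    using that x by (auto simp: LL_def dest!: bspec[of _ _ x])
  have "\<not> vge x (- D x) w"
    using w(2) off[OF w(1)] unfolding LL_def by blast
  then have ordw: "ord x w = - D x - 1"
    using at[OF w(1)] by (auto simp: vge_def)
  show "LL ?D = span (insert w (LL D))"
  proof
    have "LL D \<subseteq> LL ?D"
      by (rule LL_mono) (auto simp: multiple_point_def)
    then show "span (insert w (LL D)) \<subseteq> LL ?D"
      using w(1) by (intro span_minimal subspace_LL) auto
    show "LL ?D \<subseteq> span (insert w (LL D))"
    proof
      fix f assume f: "f \<in> LL ?D"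
      obtain c where vx: "vge x (- D x) (f - const C c * w)"
        using leading_term[OF x w0, of f] at[OF f] unfolding ordw by auto
      have "f - const C c * w \<in> LL D"
        unfolding LL_def
      proof safe
        fix y assume y: "y \<in> pts C"
        show "vge y (- D y) (f - const C c * w)"
        proof (cases "y = x")
          case False
          then have "vge y (- D y) f" "vge y (- D y) w"
            using f w(1) y off by blast+
          then show ?thesis
            by (intro vge_diff vge_scale y)
        qed (use vx in simp)
      qed
      then have "(f - const C c * w) + const C c * w \<in> span (insert w (LL D))"
        by (intro span_add span_scale) (auto intro: span_base)
      then show "f \<in> span (insert w (LL D))"
        by simp
    qed
  qed
  show "w \<noteq> 0" "ord x w = - D x - 1"
    by fact+
qed

text \<open>Each point of F imposes at most one linear condition.\<close>

lemma LL_subtract: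
  assumes "has_dim (LL E) m" "fin_div F" "eff F"
  shows "\<exists>k. has_dim (LL (\<lambda>x. E x - F x)) k \<and> int k \<ge> int m - deg F"
  using assms(2,3)
proof (rule effective_induct)
  fix D :: "'n ppoint \<Rightarrow> int" assume "\<And>x. x \<in> pts C \<Longrightarrow> D x = 0"
  then have "LL (\<lambda>x. E x - D x) = LL E" "deg D = 0"
    by (auto intro!: LL_cong simp: deg_def)
  then show "\<exists>k. has_dim (LL (\<lambda>x. E x - D x)) k \<and> int k \<ge> int m - deg D"
    using assms(1) by auto
next
  fix D x assume D: "fin_div D" "eff D" and x: "x \<in> pts C"
    and "\<exists>k. has_dim (LL (\<lambda>x. E x - D x)) k \<and> int k \<ge> int m - deg D"
  then obtain k where k: "has_dim (LL (\<lambda>x. E x - D x)) k" "int k \<ge> int m - deg D"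
    by blast
  let ?E = "\<lambda>y. E y - (D y + multiple_point 1 x y)"
  have eq: "(\<lambda>y. ?E y + multiple_point 1 x y) = (\<lambda>y. E y - D y)"
    by auto
  have deg: "deg (\<lambda>y. D y + multiple_point 1 x y) = deg D + 1"
    using D x by (simp add: deg_add deg_point)
  have sub: "LL ?E \<subseteq> LL (\<lambda>y. E y - D y)"
    by (rule LL_mono) (auto simp: multiple_point_def)
  show "\<exists>k. has_dim (LL ?E) k \<and> int k \<ge> int m - deg (\<lambda>y. D y + multiple_point 1 x y)"
  proof (cases "LL ?E = LL (\<lambda>y. E y - D y)")
    case True
    then show ?thesis
      using k deg by (intro exI[of _ k]) auto
  next
    case False
    then obtain w where w: "w \<in> LL (\<lambda>y. E y - D y)" "w \<notin> LL ?E"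
      using sub by blast
    then have "LL (\<lambda>y. E y - D y) = span (insert w (LL ?E))"
      using LL_step(1)[OF x, of w ?E] unfolding eq by blast
    then have "has_dim (span (insert w (LL ?E))) k"
      using k(1) by simp
    then obtain k' where "k = Suc k'" "has_dim (LL ?E) k'"
      by (rule has_dim_remove[OF subspace_LL w(2)])
    then show ?thesis
      using k(2) deg by (intro exI[of _ k']) auto
  qed
qed

end

section \<open>Repartition classes and Riemann-Roch in genus one\<close>

locale genus_one_curve = curve C for C :: "('n::finite, 'k::field) variety_data" +
  assumes genus: "has_genus C 1"
begin

lemma repartition_add: "a \<in> repartitions C \<Longrightarrow> b \<in> repartitions C \<Longrightarrow> (\<lambda>x. a x + b x) \<in> repartitions C"
  unfolding repartitions_def mem_Collect_eq
  by (rule finite_subset[of _ "{x \<in> pts C. a x \<notin> \<O> x} \<union> {x \<in> pts C. b x \<notin> \<O> x}"])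
     (auto intro: local_ring_add)

lemma repartition_mult: "a \<in> repartitions C \<Longrightarrow> b \<in> repartitions C \<Longrightarrow> (\<lambda>x. a x * b x) \<in> repartitions C"
  unfolding repartitions_def mem_Collect_eq
  by (rule finite_subset[of _ "{x \<in> pts C. a x \<notin> \<O> x} \<union> {x \<in> pts C. b x \<notin> \<O> x}"])
     (auto intro: local_ring_mult)

lemma repartition_const: "(\<lambda>x. f) \<in> repartitions C"
proof (cases "f = 0")
  case False
  show ?thesis
    unfolding repartitions_def mem_Collect_eq
    by (rule finite_subset[OF _ finite_support[OF False]]) (auto simp: local_ring_iff_ord[OF _ False])
qed (auto simp: repartitions_def local_ring_0 intro: finite_subset[of _ "{}"])

definition regular :: "('n ppoint \<Rightarrow> 'k) \<Rightarrow> bool" where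
  "regular a \<longleftrightarrow> (\<forall>x\<in>pts C. a x \<in> \<O> x)"

text \<open>In genus one the basis is a singleton, and an extensional function on a singleton is
  just a number.\<close>

lemma ex_cohomology_basis:
  "\<exists>\<beta>\<in>repartitions C. \<forall>a\<in>repartitions C. \<exists>!c. \<exists>f. regular (\<lambda>x. a x - const C c * \<beta> x - f)"
proof -
  obtain B where B: "B \<subseteq> repartitions C" "card B = 1" and uniq:
    "\<forall>a\<in>repartitions C. \<exists>!c. c \<in> (B \<rightarrow>\<^sub>E UNIV) \<and>
       (\<exists>f. \<forall>x\<in>pts C. a x - (\<Sum>b\<in>B. const C (c b) * b x) - f \<in> local_ring C x)"
    using genus unfolding has_genus_def by (elim exE conjE)
  obtain \<beta> where \<beta>: "B = {\<beta>}"
    using B(2) by (auto simp: card_1_singleton_iff)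
  have "\<exists>!c. \<exists>f. regular (\<lambda>x. a x - const C c * \<beta> x - f)" if a: "a \<in> repartitions C" for a
  proof -
    define P where "P c \<longleftrightarrow> c \<in> ({\<beta>} \<rightarrow>\<^sub>E UNIV) \<and> (\<exists>f. regular (\<lambda>x. a x - const C (c \<beta>) * \<beta> x - f))" for c
    have "\<exists>!c. P c"
      using bspec[OF uniq a] unfolding \<beta> regular_def P_def by simp
    then obtain c where "P c" and P: "\<And>c'. P c' \<Longrightarrow> c' = c"
      by metis
    from \<open>P c\<close> have c: "\<exists>f. regular (\<lambda>x. a x - const C (c \<beta>) * \<beta> x - f)"
      unfolding P_def by (rule conjunct2)
    have c_uniq: "c' = c"
      if "c' \<in> ({\<beta>} \<rightarrow>\<^sub>E UNIV)" "\<exists>f. regular (\<lambda>x. a x - const C (c' \<beta>) * \<beta> x - f)" for c'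
      by (rule P) (unfold P_def, rule conjI, fact+)
    show ?thesis
    proof (rule ex1I[of _ "c \<beta>"])
      fix d assume "\<exists>f. regular (\<lambda>x. a x - const C d * \<beta> x - f)"
      then have "(\<lambda>y\<in>{\<beta>}. d) = c"
        by (intro c_uniq) auto
      then show "d = c \<beta>"
        by auto
    qed (rule c)
  qed
  moreover have "\<beta> \<in> repartitions C"
    using B(1) \<beta> by simp
  ultimately show ?thesis
    by (intro bexI[of _ \<beta>] ballI)
qed

text \<open>\<open>\<omega>\<close> is the coordinate on \<open>H\<^sup>1(O)\<close> with respect to the class of \<open>\<beta>\<close>.\<close>

definition \<beta> :: "'n ppoint \<Rightarrow> 'k" where
  "\<beta> = (SOME \<beta>. \<beta> \<in> repartitions C \<and>
     (\<forall>a\<in>repartitions C. \<exists>!c. \<exists>f. regular (\<lambda>x. a x - const C c * \<beta> x - f)))"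

definition \<omega> :: "('n ppoint \<Rightarrow> 'k) \<Rightarrow> complex" where
  "\<omega> a = (THE c. \<exists>f. regular (\<lambda>x. a x - const C c * \<beta> x - f))"

lemma \<beta>: "\<beta> \<in> repartitions C"
  and \<beta>_ex1: "a \<in> repartitions C \<Longrightarrow> \<exists>!c. \<exists>f. regular (\<lambda>x. a x - const C c * \<beta> x - f)"
proof -
  have "\<beta> \<in> repartitions C \<and>
     (\<forall>a\<in>repartitions C. \<exists>!c. \<exists>f. regular (\<lambda>x. a x - const C c * \<beta> x - f))"
    using someI_ex[OF ex_cohomology_basis[unfolded Bex_def]] unfolding \<beta>_def[symmetric] .
  note * = this
  show "\<beta> \<in> repartitions C"
    by (rule conjunct1[OF *])
  show "a \<in> repartitions C \<Longrightarrow> \<exists>!c. \<exists>f. regular (\<lambda>x. a x - const C c * \<beta> x - f)"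
    by (rule bspec[OF conjunct2[OF *]])
qed

lemma \<omega>_ex: "a \<in> repartitions C \<Longrightarrow> \<exists>f. regular (\<lambda>x. a x - const C (\<omega> a) * \<beta> x - f)"
  unfolding \<omega>_def by (rule theI'[OF \<beta>_ex1])

lemma \<omega>_eqI: "a \<in> repartitions C \<Longrightarrow> regular (\<lambda>x. a x - const C c * \<beta> x - f) \<Longrightarrow> \<omega> a = c"
  unfolding \<omega>_def using \<beta>_ex1[of a] by (intro the1_equality) auto

lemma regular_add: "regular a \<Longrightarrow> regular b \<Longrightarrow> regular (\<lambda>x. a x + b x)"
  by (auto simp: regular_def intro: local_ring_add)

lemma regular_mult: "regular a \<Longrightarrow> regular b \<Longrightarrow> regular (\<lambda>x. a x * b x)"
  by (auto simp: regular_def intro: local_ring_mult)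

lemma regular_const: "regular (\<lambda>x. const C c)"
  by (auto simp: regular_def intro: local_ring_const)

lemma \<omega>_\<beta>: "\<omega> \<beta> = 1"
  by (rule \<omega>_eqI[OF \<beta>, of _ 0]) (simp add: regular_def local_ring_0 h_1)

lemma \<omega>_add:
  assumes "a \<in> repartitions C" "b \<in> repartitions C"
  shows "\<omega> (\<lambda>x. a x + b x) = \<omega> a + \<omega> b"
proof -
  obtain f where f: "regular (\<lambda>x. a x - const C (\<omega> a) * \<beta> x - f)"
    using \<omega>_ex[OF assms(1)] by blast
  obtain g where g: "regular (\<lambda>x. b x - const C (\<omega> b) * \<beta> x - g)"
    using \<omega>_ex[OF assms(2)] by blast
  have "(\<lambda>x. (a x - const C (\<omega> a) * \<beta> x - f) + (b x - const C (\<omega> b) * \<beta> x - g)) =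
      (\<lambda>x. (a x + b x) - const C (\<omega> a + \<omega> b) * \<beta> x - (f + g))"
    by (rule ext) (simp add: h_add algebra_simps)
  then have "regular (\<lambda>x. (a x + b x) - const C (\<omega> a + \<omega> b) * \<beta> x - (f + g))"
    using regular_add[OF f g] by (simp only:)
  then show ?thesis
    by (rule \<omega>_eqI[OF repartition_add[OF assms]])
qed

lemma \<omega>_scale:
  assumes "a \<in> repartitions C"
  shows "\<omega> (\<lambda>x. const C c * a x) = c * \<omega> a"
proof -
  obtain f where f: "regular (\<lambda>x. a x - const C (\<omega> a) * \<beta> x - f)"
    using \<omega>_ex[OF assms(1)] by blast
  have "(\<lambda>x. const C c * (a x - const C (\<omega> a) * \<beta> x - f)) =
      (\<lambda>x. const C c * a x - const C (c * \<omega> a) * \<beta> x - const C c * f)"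
    by (rule ext) (simp add: h_mult algebra_simps)
  then have "regular (\<lambda>x. const C c * a x - const C (c * \<omega> a) * \<beta> x - const C c * f)"
    using regular_mult[OF regular_const[of c] f] by (simp only:)
  then show ?thesis
    by (rule \<omega>_eqI[OF repartition_mult[OF repartition_const assms]])
qed

text \<open>Identifies the kernel of \<open>\<omega>\<close> as the sum of the regular repartitions
  and the constant ones coming from K.\<close>

lemma \<omega>_eq_0_iff:
  assumes "a \<in> repartitions C"
  shows "\<omega> a = 0 \<longleftrightarrow> (\<exists>f. regular (\<lambda>x. a x - f))"
  using \<omega>_ex[OF assms] \<omega>_eqI[OF assms, of 0] by (auto simp: h_0)

lemma \<omega>_principal: "\<omega> (\<lambda>x. f) = 0"
  unfolding \<omega>_eq_0_iff[OF repartition_const] by (intro exI[of _ f]) (simp add: regular_def local_ring_0)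

lemma \<omega>_diff:
  assumes "a \<in> repartitions C" "b \<in> repartitions C"
  shows "\<omega> (\<lambda>x. a x - b x) = \<omega> a - \<omega> b"
  using \<omega>_add[OF assms(1) repartition_mult[OF repartition_const assms(2)], of "const C (-1)"]
    \<omega>_scale[OF assms(2), of "-1"] by (simp add: h_minus h_1)

lemma repartition_diff: "a \<in> repartitions C \<Longrightarrow> b \<in> repartitions C \<Longrightarrow> (\<lambda>x. a x - b x) \<in> repartitions C"
  using repartition_add[OF _ repartition_mult[OF repartition_const], of a b "const C (-1)"]
  by (simp add: h_minus h_1)

text \<open>
  An everywhere regular function \<open>u\<close> acts on the one-dimensional \<open>H\<^sup>1\<close> as a scalar \<open>c\<close>, so
  \<open>u - c\<close> annihilates \<open>H\<^sup>1\<close>; but every repartition is divisible by a nonzero function.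
\<close>

lemma regular_functions_constant:
  assumes "u \<in> LL (\<lambda>_. 0)"
  shows "u \<in> range (const C)"
proof (rule ccontr)
  assume nc: "u \<notin> range (const C)"
  have u: "regular (\<lambda>x. u)"
    using assms by (auto simp: regular_def LL_def local_ring_iff_vge)
  define c where "c = \<omega> (\<lambda>x. u * \<beta> x)"
  obtain f where f: "regular (\<lambda>x. u * \<beta> x - const C c * \<beta> x - f)"
    using \<omega>_ex[OF repartition_mult[OF repartition_const \<beta>]] unfolding c_def by blast
  define w where "w = u - const C c"
  have w0: "w \<noteq> 0"
    using nc by (auto simp: w_def)
  have w: "regular (\<lambda>x. w)"
    using regular_add[OF u regular_const[of "- c"]] by (simp add: w_def h_minus)
  define d where "d = \<omega> (\<lambda>x. inverse w * \<beta> x)"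
  obtain g where g: "regular (\<lambda>x. inverse w * \<beta> x - const C d * \<beta> x - g)"
    using \<omega>_ex[OF repartition_mult[OF repartition_const \<beta>]] unfolding d_def by blast
  \<comment> \<open>Multiply the expansion of \<beta> / w by w. As w \<beta> agrees with f up to a
    regular repartition, \<beta> itself becomes principal up to a regular one, against
    \<open>\<omega> \<beta> = 1\<close>.\<close>
  have "(\<lambda>x. w * (inverse w * \<beta> x - const C d * \<beta> x - g) + const C d * (u * \<beta> x - const C c * \<beta> x - f)) =
      (\<lambda>x. \<beta> x - (w * g + const C d * f))"
  proof
    fix x
    have "w * (inverse w * \<beta> x) = \<beta> x"
      using w0 by simp
    then show "w * (inverse w * \<beta> x - const C d * \<beta> x - g) + const C d * (u * \<beta> x - const C c * \<beta> x - f) =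
      \<beta> x - (w * g + const C d * f)"
      unfolding right_diff_distrib by (simp add: w_def algebra_simps)
  qed
  moreover have "regular (\<lambda>x. w * (inverse w * \<beta> x - const C d * \<beta> x - g) + const C d * (u * \<beta> x - const C c * \<beta> x - f))"
    by (intro regular_add regular_mult[OF w g] regular_mult[OF regular_const f])
  ultimately have "\<omega> \<beta> = 0"
    unfolding \<omega>_eq_0_iff[OF \<beta>] by metis
  then show False
    using \<omega>_\<beta> by simp
qed

lemma has_dim_LL_0: "has_dim (LL (\<lambda>_. 0)) 1"
proof -
  have "LL (\<lambda>_. 0) = span {1}"
  proof
    show "LL (\<lambda>_. 0) \<subseteq> span {1}"
      using regular_functions_constant by (auto simp: span_singleton)
    show "span {1} \<subseteq> LL (\<lambda>_. 0)"
      by (auto simp: span_singleton LL_def vge_const)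
  qed
  then show ?thesis
    unfolding has_dim_def by (intro exI[of _ "{1}"]) auto
qed

definition bounded_by :: "('n ppoint \<Rightarrow> int) \<Rightarrow> ('n ppoint \<Rightarrow> 'k) \<Rightarrow> bool" where
  "bounded_by D a \<longleftrightarrow> a \<in> repartitions C \<and> (\<forall>x\<in>pts C. vge x (- D x) (a x))"

text \<open>For effective \<open>D\<close> this says \<open>H\<^sup>1(O(D)) \<noteq> 0\<close>.\<close>

definition special :: "('n ppoint \<Rightarrow> int) \<Rightarrow> bool" where
  "special D \<longleftrightarrow> (\<forall>a. bounded_by D a \<longrightarrow> \<omega> a = 0)"

lemma special_antimono:
  "special D' \<Longrightarrow> (\<And>x. x \<in> pts C \<Longrightarrow> D x \<le> D' x) \<Longrightarrow> special D"
  unfolding special_def bounded_by_def by (metis neg_le_iff_le vge_mono)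

text \<open>Adding a point either admits a new function, raising h^0 and keeping h^1, or admits
  none, and then h^1 drops from 1 to 0.\<close>

lemma riemann_roch_effective:
  assumes "fin_div D" "eff D"
  shows "\<exists>n. has_dim (LL D) n \<and> int n = deg D + (if special D then 1 else 0)"
  using assms
proof (rule effective_induct)
  fix D :: "'n ppoint \<Rightarrow> int" assume D: "\<And>x. x \<in> pts C \<Longrightarrow> D x = 0"
  then have "LL D = LL (\<lambda>_. 0)" "deg D = 0"
    by (auto intro!: LL_cong simp: deg_def)
  moreover have "special D"
    unfolding special_def bounded_by_def using D
    by (auto simp: \<omega>_eq_0_iff regular_def local_ring_iff_vge intro!: exI[of _ 0])
  ultimately show "\<exists>n. has_dim (LL D) n \<and> int n = deg D + (if special D then 1 else 0)"
    using has_dim_LL_0 by (intro exI[of _ 1]) simp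
next
  fix D x assume D: "fin_div D" "eff D" and x: "x \<in> pts C"
    and "\<exists>n. has_dim (LL D) n \<and> int n = deg D + (if special D then 1 else 0)"
  then obtain n where n: "has_dim (LL D) n" "int n = deg D + (if special D then 1 else 0)"
    by blast
  let ?D = "\<lambda>y. D y + multiple_point 1 x y"
  have deg: "deg ?D = deg D + 1"
    using D x by (simp add: deg_add deg_point)
  have sub: "LL D \<subseteq> LL ?D"
    by (rule LL_mono) (auto simp: multiple_point_def)
  have special: "special D" if "special ?D"
    using that by (rule special_antimono) (auto simp: multiple_point_def)
  show "\<exists>n. has_dim (LL ?D) n \<and> int n = deg ?D + (if special ?D then 1 else 0)"
  proof (cases "LL D = LL ?D")
    case False
    then obtain w where w: "w \<in> LL ?D" "w \<notin> LL D"
      using sub by blast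
    note step = LL_step[OF x w]
    \<comment> \<open>A multiple of the principal repartition w removes the extra pole of a at x
      without changing \<open>\<omega> a\<close>.\<close>
    have "special ?D" if sp: "special D"
      unfolding special_def
    proof safe
      fix a assume a: "bounded_by ?D a"
      have "vge x (- D x - 1) (a x)"
        using a x by (auto simp: bounded_by_def dest!: bspec[of _ _ x])
      then obtain c where vx: "vge x (- D x) (a x - const C c * w)"
        using leading_term[OF x step(2), of "a x"] unfolding step(3) by auto
      have rep: "a \<in> repartitions C" "(\<lambda>y. const C c * w) \<in> repartitions C"
        using a repartition_const by (auto simp: bounded_by_def)
      have "bounded_by D (\<lambda>y. a y - const C c * w)"
        unfolding bounded_by_def
      proof safe
        show "(\<lambda>y. a y - const C c * w) \<in> repartitions C"
          by (rule repartition_diff[OF rep])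
        fix y assume y: "y \<in> pts C"
        show "vge y (- D y) (a y - const C c * w)"
        proof (cases "y = x")
          case False
          then have "- ?D y = - D y"
            by simp
          moreover have "vge y (- ?D y) (a y)" "vge y (- ?D y) w"
            using a w(1) y unfolding LL_def bounded_by_def by blast+
          ultimately have "vge y (- D y) (a y)" "vge y (- D y) w"
            by (simp_all only:)
          then show ?thesis
            by (intro vge_diff vge_scale y)
        qed (use vx in simp)
      qed
      then have "\<omega> (\<lambda>y. a y - const C c * w) = 0"
        using sp by (auto simp: special_def)
      then show "\<omega> a = 0"
        using \<omega>_diff[OF rep] \<omega>_principal by simp
    qed
    then have "special ?D \<longleftrightarrow> special D"
      using special by blast
    moreover have "has_dim (LL ?D) (Suc n)"
      unfolding step(1) by (rule has_dim_insert[OF n(1) w(2)])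
    ultimately show ?thesis
      using n(2) deg by (intro exI[of _ "Suc n"]) simp
  next
    case True
    obtain t where t: "uniformizer C x t"
      using ex_uniformizer[OF x] by blast
    \<comment> \<open>A repartition with exactly the new pole at x. No function has that pole in
      this case, which makes its class new.\<close>
    define \<tau> where "\<tau> = (\<lambda>y. if y = x then t powi (- D x - 1) else 0)"
    have t0: "t \<noteq> 0"
      by (rule uniformizer_nonzero[OF x t])
    have ordt: "ord x (t powi (- D x - 1)) = - D x - 1"
      by (rule ord_powi_uniformizer[OF x t])
    have "\<tau> \<in> repartitions C"
      unfolding repartitions_def mem_Collect_eq
      by (rule finite_subset[of _ "{x}"]) (auto simp: \<tau>_def local_ring_0)
    then have \<tau>: "bounded_by ?D \<tau>"
      using ordt by (auto simp: bounded_by_def \<tau>_def vge_def multiple_point_def)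
    \<comment> \<open>If the classes agreed, \<tau> - a would be principal up to a regular
      repartition, and the function f would supply the missing pole.\<close>
    have distinct: "\<omega> \<tau> \<noteq> \<omega> a" if a: "bounded_by D a" for a
    proof
      assume eq: "\<omega> \<tau> = \<omega> a"
      have rep: "\<tau> \<in> repartitions C" "a \<in> repartitions C"
        using \<tau> a by (auto simp: bounded_by_def)
      have "\<omega> (\<lambda>y. \<tau> y - a y) = 0"
        using \<omega>_diff[OF rep] eq by simp
      then obtain f where f: "regular (\<lambda>y. (\<tau> y - a y) - f)"
        using \<omega>_eq_0_iff[OF repartition_diff[OF rep]] by blast
      have fy: "vge y (- D y) (\<tau> y - f)" if y: "y \<in> pts C" for y
      proof -
        have "vge y 0 (\<tau> y - a y - f)"
          using f y by (auto simp: regular_def local_ring_iff_vge)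
        then have "vge y (- D y) (\<tau> y - a y - f)"
          using D(2) y by (auto simp: eff_def intro: vge_mono)
        moreover have "vge y (- D y) (a y)"
          using a y by (auto simp: bounded_by_def)
        ultimately have "vge y (- D y) ((\<tau> y - a y - f) + a y)"
          by (rule vge_add[OF y])
        then show ?thesis
          by simp
      qed
      have "vge y (- ?D y) f" if y: "y \<in> pts C" for y
      proof -
        have "vge y (- ?D y) (\<tau> y - f)"
          by (rule vge_mono[OF fy[OF y]]) (simp add: multiple_point_def)
        moreover have "vge y (- ?D y) (\<tau> y)"
          using \<tau> y by (auto simp: bounded_by_def)
        ultimately have "vge y (- ?D y) (\<tau> y - (\<tau> y - f))"
          using vge_diff[OF y] by blast
        then show ?thesis
          by simp
      qed
      then have "f \<in> LL D"
        unfolding True by (auto simp: LL_def)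
      then have "vge x (- D x) ((\<tau> x - f) + f)"
        using fy[OF x] x by (intro vge_add) (auto simp: LL_def)
      then show False
        using ordt t0 by (auto simp: vge_def \<tau>_def)
    qed
    have "bounded_by D (\<lambda>_. 0)"
      using repartition_const[of 0] by (simp add: bounded_by_def)
    then have "\<omega> \<tau> \<noteq> 0"
      using distinct \<omega>_principal by metis
    then have "\<not> special ?D"
      using \<tau> by (auto simp: special_def)
    moreover have "special D"
      unfolding special_def
    proof (rule allI, rule impI, rule ccontr)
      fix a assume a: "bounded_by D a" and nz: "\<omega> a \<noteq> 0"
      have rep: "a \<in> repartitions C"
        using a by (auto simp: bounded_by_def)
      \<comment> \<open>A nonzero value of \<open>\<omega>\<close> on repartitions bounded by D
        could be rescaled to \<open>\<omega> \<tau>\<close>.\<close>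
      have "bounded_by D (\<lambda>y. const C (\<omega> \<tau> / \<omega> a) * a y)"
        using a repartition_mult[OF repartition_const] by (auto simp: bounded_by_def intro: vge_scale)
      from distinct[OF this] show False
        using nz by (simp add: \<omega>_scale[OF rep])
    qed
    ultimately show ?thesis
      using n deg True by (intro exI[of _ n]) simp
  qed
qed

end

context curve
begin

text \<open>Multiplication by u maps O(D) isomorphically to O(D - div u).\<close>

lemma LL_mult_eq:
  assumes u: "u \<noteq> 0" and D: "\<And>x. x \<in> pts C \<Longrightarrow> D' x = D x - ord x u"
  shows "LL D' = (*) u ` LL D"
proof
  show "(*) u ` LL D \<subseteq> LL D'"
  proof safe
    fix f assume f: "f \<in> LL D"
    show "u * f \<in> LL D'"
      unfolding LL_def
    proof safe
      fix x assume x: "x \<in> pts C"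
      then have "vge x (ord x u + (- D x)) (u * f)"
        using f by (intro vge_mult) (auto simp: vge_def LL_def)
      then show "vge x (- D' x) (u * f)"
        using D[OF x] by simp
    qed
  qed
  show "LL D' \<subseteq> (*) u ` LL D"
  proof
    fix f assume f: "f \<in> LL D'"
    have "inverse u * f \<in> LL D"
      unfolding LL_def
    proof safe
      fix x assume x: "x \<in> pts C"
      then have "vge x (- ord x u + (- D' x)) (inverse u * f)"
        using f u by (intro vge_mult) (auto simp: vge_def LL_def ord_inverse)
      then show "vge x (- D x) (inverse u * f)"
        using D[OF x] by simp
    qed
    then have "u * (inverse u * f) \<in> (*) u ` LL D"
      by blast
    then show "f \<in> (*) u ` LL D"
      using u by (simp flip: mult.assoc)
  qed
qed

lemma has_dim_LL_mult:
  assumes "has_dim (LL D) n" "u \<noteq> 0" "\<And>x. x \<in> pts C \<Longrightarrow> D' x = D x - ord x u"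
  shows "has_dim (LL D') n"
proof -
  have "has_dim ((*) u ` LL D) n"
    by (rule has_dim_mult_unit[OF assms(1), of u "inverse u"]) (simp add: assms(2))
  moreover have "LL D' = (*) u ` LL D"
    by (rule LL_mult_eq[OF assms(2,3)])
  ultimately show ?thesis
    by simp
qed

lemma fin_div_ord: "u \<noteq> 0 \<Longrightarrow> fin_div (\<lambda>x. ord x u)"
  unfolding fin_div_def by (rule finite_support)

lemma ord_power: "x \<in> pts C \<Longrightarrow> h \<noteq> 0 \<Longrightarrow> ord x (h ^ n) = int n * ord x h"
  using ord_const[of x 1] by (induction n) (simp_all add: h_1 ord_mult algebra_simps)

end

context genus_one_curve
begin

text \<open>The power h^n has a pole of exact order n at x and no other pole, so each power adds one
  dimension.\<close>

lemma has_dim_powers: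
  assumes x: "x \<in> pts C" and h: "h \<in> LL (multiple_point 1 x)" "h \<notin> LL (\<lambda>_. 0)"
  shows "has_dim (LL (multiple_point (int n) x)) (Suc n)"
proof (induction n)
  case 0
  have "multiple_point 0 x = (\<lambda>_. 0)"
    by (auto simp: multiple_point_def)
  then show ?case
    using has_dim_LL_0 by simp
next
  case (Suc n)
  have mp: "(\<lambda>y. 0 + multiple_point 1 x y) = multiple_point 1 x"
    by simp
  have h0: "h \<noteq> 0" and ordh: "ord x h = -1"
    using LL_step(2,3)[OF x, of h "\<lambda>_. 0"] h unfolding mp by auto
  have off: "ord y h \<ge> 0" if "y \<in> pts C" "y \<noteq> x" for y
  proof -
    have "vge y (- multiple_point 1 x y) h"
      using h(1) that(1) unfolding LL_def by blast
    then show ?thesis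
      using that(2) h0 by (simp add: vge_def)
  qed
  have ord: "ord y (h ^ Suc n) = int (Suc n) * ord y h" if "y \<in> pts C" for y
    by (rule ord_power[OF that h0])
  let ?D = "multiple_point (int n) x" and ?D' = "multiple_point (int (Suc n)) x"
  have eq: "(\<lambda>y. ?D y + multiple_point 1 x y) = ?D'"
    by (auto simp: multiple_point_def)
  have "h ^ Suc n \<in> LL ?D'"
    unfolding LL_def
  proof safe
    fix y assume y: "y \<in> pts C"
    show "vge y (- ?D' y) (h ^ Suc n)"
    proof (cases "y = x")
      case True
      then show ?thesis
        using ord[OF x] ordh by (simp add: vge_def)
    next
      case False
      then have "0 \<le> int (Suc n) * ord y h"
        using off[OF y] by simp
      then show ?thesis
        unfolding vge_def ord[OF y] using False by simp
    qed
  qed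
  moreover have "h ^ Suc n \<notin> LL ?D"
  proof
    assume "h ^ Suc n \<in> LL ?D"
    then have "vge x (- int n) (h ^ Suc n)"
      using x by (auto simp: LL_def dest!: bspec[of _ _ x])
    then show False
      using ord[OF x] ordh h0 by (simp add: vge_def)
  qed
  ultimately show ?case
    using has_dim_insert[OF Suc, of "h ^ Suc n"] LL_step(1)[OF x, of "h ^ Suc n" ?D] unfolding eq by simp
qed

text \<open>
  If \<open>H\<^sup>1(O(x)) \<noteq> 0\<close>, there is a function with a single simple pole, and \<open>O(n x)\<close> has so many
  sections that one of them multiplies \<open>A = A(D) + K\<close> into \<open>A(n x) + K\<close>.
\<close>

lemma not_special_point:
  assumes x: "x \<in> pts C"
  shows "\<not> special (multiple_point 1 x)"
proof
  assume sp: "special (multiple_point 1 x)"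
  have eff1: "eff (multiple_point n x)" if "n \<ge> 0" for n
    using that by (simp add: eff_def multiple_point_def)
  obtain m where m: "has_dim (LL (multiple_point 1 x)) m" "int m = 2"
    using riemann_roch_effective[of "multiple_point 1 x"] eff1 sp deg_point[OF x] by auto
  have "LL (\<lambda>_. 0) \<noteq> LL (multiple_point 1 x)"
    using has_dim_unique[OF has_dim_LL_0, of m] m by auto
  moreover have "LL (\<lambda>_. 0) \<subseteq> LL (multiple_point 1 x)"
    by (rule LL_mono) (simp add: multiple_point_def)
  ultimately obtain h where h: "h \<in> LL (multiple_point 1 x)" "h \<notin> LL (\<lambda>_. 0)"
    by blast
  \<comment> \<open>The pole divisor of \<beta>.\<close>
  define D where "D = (\<lambda>y. if \<beta> y \<in> \<O> y then 0 else - ord y (\<beta> y))"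
  have "{y \<in> pts C. D y \<noteq> 0} \<subseteq> {y \<in> pts C. \<beta> y \<notin> \<O> y}"
    by (auto simp: D_def)
  then have fD: "fin_div D"
    unfolding fin_div_def using \<beta> unfolding repartitions_def by (auto intro: finite_subset)
  have D_pos: "D y \<ge> 0" and D_\<beta>: "vge y (- D y) (\<beta> y)" if y: "y \<in> pts C" for y
    using local_ring_iff_vge[OF y, of "\<beta> y"] by (auto simp: D_def vge_def)
  have eD: "eff D"
    using D_pos by (simp add: eff_def)
  obtain n where n: "deg D = int n"
    using deg_nonneg[OF eD] nonneg_int_cases by metis
  let ?n = "multiple_point (int n) x"
  note dim_n = has_dim_powers[OF x h, of n]
  \<comment> \<open>\<open>LL ?n\<close> has dimension n + 1, one more than its degree, which
    Riemann-Roch permits only in the special case.\<close>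
  have spn: "special ?n"
  proof (rule ccontr)
    assume "\<not> special ?n"
    then have "\<exists>k. has_dim (LL ?n) k \<and> int k = int n"
      using riemann_roch_effective[of ?n] eff1 deg_point[OF x] by auto
    then show False
      using has_dim_unique[OF dim_n, of n] by auto
  qed
  \<comment> \<open>Vanishing along D costs at most deg D = n of the n + 1 dimensions, so a nonzero
    u remains with u \<beta> having poles only in n x.\<close>
  obtain k where k: "has_dim (LL (\<lambda>y. ?n y - D y)) k" "int k \<ge> int (Suc n) - deg D"
    using LL_subtract[OF dim_n fD eD] by blast
  then have "k > 0"
    using n by simp
  then obtain u where u: "u \<in> LL (\<lambda>y. ?n y - D y)" "u \<noteq> 0"
    using has_dim_pos[OF k(1)] by blast
  have uy: "vge y (D y - ?n y) u" if "y \<in> pts C" for y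
    using u(1) that by (auto simp: LL_def)
  have rep: "(\<lambda>y. inverse u * \<beta> y) \<in> repartitions C"
    by (rule repartition_mult[OF repartition_const \<beta>])
  define c where "c = \<omega> (\<lambda>y. inverse u * \<beta> y)"
  obtain f where f: "regular (\<lambda>y. inverse u * \<beta> y - const C c * \<beta> y - f)"
    using \<omega>_ex[OF rep] unfolding c_def by blast
  \<comment> \<open>Multiplying the expansion of \<beta> / u by u leaves u times a regular
    repartition and c u \<beta>, both bounded by n x. So \<beta> - u f is bounded by n x and is
    killed by \<open>\<omega>\<close>.\<close>
  have "vge y (- ?n y) (\<beta> y - u * f)" if y: "y \<in> pts C" for y
  proof -
    have "vge y (D y - ?n y + 0) (u * (inverse u * \<beta> y - const C c * \<beta> y - f))"
      using f y by (intro vge_mult[OF y uy[OF y]]) (auto simp: regular_def local_ring_iff_vge)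
    then have 1: "vge y (- ?n y) (u * (inverse u * \<beta> y - const C c * \<beta> y - f))"
      by (rule vge_mono) (use D_pos[OF y] in simp)
    have "vge y (D y - ?n y + - D y) (u * (const C c * \<beta> y))"
      by (intro vge_mult[OF y uy[OF y]] vge_scale y D_\<beta>)
    then have 2: "vge y (- ?n y) (u * (const C c * \<beta> y))"
      by simp
    have "u * (inverse u * \<beta> y) = \<beta> y"
      using u(2) by simp
    then have "u * (inverse u * \<beta> y - const C c * \<beta> y - f) + u * (const C c * \<beta> y) = \<beta> y - u * f"
      unfolding right_diff_distrib by simp
    then show ?thesis
      using vge_add[OF y 1 2] by simp
  qed
  then have "bounded_by ?n (\<lambda>y. \<beta> y - u * f)"
    unfolding bounded_by_def using repartition_diff[OF \<beta> repartition_const] by blast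
  then have "\<omega> (\<lambda>y. \<beta> y - u * f) = 0"
    using spn by (auto simp: special_def)
  then show False
    using \<omega>_diff[OF \<beta> repartition_const[of "u * f"]] \<omega>_\<beta> \<omega>_principal by simp
qed

text \<open>As D dominates the point x, specialness of D would pass to x.\<close>

lemma has_dim_effective:
  assumes "fin_div D" "eff D" "x \<in> pts C" "D x \<ge> 1"
  shows "has_dim (LL D) (nat (deg D))"
proof -
  have "\<not> special D"
  proof
    assume "special D"
    then have "special (multiple_point 1 x)"
      by (rule special_antimono) (use assms in \<open>auto simp: multiple_point_def eff_def\<close>)
    then show False
      using not_special_point assms(3) by blast
  qed
  then obtain n where "has_dim (LL D) n" "int n = deg D"
    using riemann_roch_effective[OF assms(1,2)] by auto
  moreover from this have "nat (deg D) = n"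
    by linarith
  ultimately show ?thesis
    by simp
qed

text \<open>Multiplication by u identifies the sections of the zero divisor with those of the pole
  divisor, and both dimensions are degrees. The extra point x on both sides makes
  \<open>has_dim_effective\<close> applicable.\<close>

lemma deg_ord:
  assumes "u \<noteq> 0" "x \<in> pts C"
  shows "deg (\<lambda>y. ord y u) = 0"
proof -
  let ?Z = "\<lambda>y. max (ord y u) 0 + multiple_point 1 x y"
  let ?N = "\<lambda>y. max (- ord y u) 0 + multiple_point 1 x y"
  have fin: "fin_div (\<lambda>y. max (ord y u) 0)" "fin_div (\<lambda>y. max (- ord y u) 0)"
    using finite_support[OF assms(1)] unfolding fin_div_def by (auto elim!: rev_finite_subset)
  have eff: "eff ?Z" "eff ?N"
    by (auto simp: eff_def multiple_point_def)
  have "has_dim (LL ?Z) (nat (deg ?Z))" "has_dim (LL ?N) (nat (deg ?N))"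
    using assms(2) fin eff by (auto intro!: has_dim_effective[of _ x] fin_div_add)
  moreover have "has_dim (LL ?N) (nat (deg ?Z))"
    by (rule has_dim_LL_mult[OF calculation(1) assms(1)]) (auto simp: max_def)
  ultimately have "nat (deg ?Z) = nat (deg ?N)"
    using has_dim_unique by blast
  then have "deg ?Z = deg ?N"
    using deg_nonneg[OF eff(1)] deg_nonneg[OF eff(2)] by simp
  then have "deg (\<lambda>y. max (ord y u) 0) = deg (\<lambda>y. max (- ord y u) 0)"
    using fin by (simp add: deg_add)
  moreover have "deg (\<lambda>y. max (ord y u) 0 + - max (- ord y u) 0) =
      deg (\<lambda>y. max (ord y u) 0) + deg (\<lambda>y. - max (- ord y u) 0)"
    by (intro deg_add fin fin_div_uminus)
  moreover have "(\<lambda>y. max (ord y u) 0 + - max (- ord y u) 0) = (\<lambda>y. ord y u)"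
    by (rule ext) (simp add: max_def)
  ultimately show ?thesis
    by (simp add: deg_uminus)
qed

text \<open>Subtracting the negative part leaves at least deg D > 0 dimensions, hence a nonzero
  section u; D + div u is effective of the same degree.\<close>

lemma has_dim_positive_degree:
  assumes D: "fin_div D" "deg D > 0"
  shows "has_dim (LL D) (nat (deg D))"
proof -
  obtain x where x: "x \<in> pts C"
  proof (cases "pts C = {}")
    case True
    then have "deg D = 0"
      by (simp add: deg_def)
    then show ?thesis
      using D(2) by simp
  qed blast
  let ?Z = "\<lambda>y. max (D y) 0 + multiple_point 1 x y"
  let ?N = "\<lambda>y. max (- D y) 0 + multiple_point 1 x y"
  have "fin_div (\<lambda>y. max (D y) 0)" "fin_div (\<lambda>y. max (- D y) 0)"
    using D(1) unfolding fin_div_def by (auto elim!: rev_finite_subset)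
  then have fin: "fin_div ?Z" "fin_div ?N"
    by (auto intro!: fin_div_add)
  have eff: "eff ?Z" "eff ?N"
    by (auto simp: eff_def multiple_point_def)
  have eq: "(\<lambda>y. ?Z y + - ?N y) = D"
    by (rule ext) (simp add: max_def)
  have deg: "deg D = deg ?Z - deg ?N"
    using deg_add[OF fin(1) fin_div_uminus[OF fin(2)]] unfolding eq deg_uminus by simp
  have "has_dim (LL ?Z) (nat (deg ?Z))"
    using fin eff x by (intro has_dim_effective[of _ x]) auto
  then obtain k where k: "has_dim (LL (\<lambda>y. ?Z y - ?N y)) k" "int k \<ge> int (nat (deg ?Z)) - deg ?N"
    using LL_subtract[OF _ fin(2) eff(2)] by blast
  have "has_dim (LL D) k"
    using k(1) eq by simp
  moreover have "k > 0"
    using k(2) deg D(2) by linarith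
  ultimately obtain u where u: "u \<in> LL D" "u \<noteq> 0"
    using has_dim_pos by blast
  let ?D = "\<lambda>y. D y + ord y u"
  have fD: "fin_div ?D"
    by (intro fin_div_add D(1) fin_div_ord u(2))
  have degD: "deg ?D = deg D"
    using deg_add[OF D(1) fin_div_ord[OF u(2)]] deg_ord[OF u(2) x] by simp
  have eD: "eff ?D"
    using u by (fastforce simp: eff_def LL_def vge_def)
  have "\<exists>y\<in>pts C. ?D y \<ge> 1"
  proof (rule ccontr)
    assume "\<not> ?thesis"
    then have "\<And>y. y \<in> pts C \<Longrightarrow> ?D y = 0"
      using eD unfolding eff_def by force
    then have "deg ?D = 0"
      by (auto simp: deg_def)
    then show False
      using degD D(2) by simp
  qed
  then obtain y where y: "y \<in> pts C" "?D y \<ge> 1"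
    by blast
  have "has_dim (LL ?D) (nat (deg D))"
    using has_dim_effective[OF fD eD y] degD by simp
  then show ?thesis
    by (rule has_dim_LL_mult[OF _ u(2)]) simp
qed

text \<open>In degree one h^0 is 1, and the constants already fill the space. Hence a pencil needs
  degree at least two.\<close>

lemma low_degree_constant:
  assumes "fin_div D" "eff D" "deg D \<le> 1" "f \<in> LL D"
  shows "f \<in> range (const C)"
proof (cases "deg D = 0")
  case True
  then have "LL D = LL (\<lambda>_. 0)"
    using eff_deg_0[OF assms(1,2)] by (intro LL_cong) auto
  then show ?thesis
    using assms(4) regular_functions_constant by blast
next
  case False
  then have d: "deg D = 1"
    using assms(3) deg_nonneg[OF assms(2)] by linarith
  have 1: "1 \<in> LL D"
    unfolding LL_def
  proof safe
    fix x assume x: "x \<in> pts C"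
    then have "vge x 0 1"
      using vge_const[OF x, of 1] by (simp add: h_1)
    then show "vge x (- D x) 1"
      by (rule vge_mono) (use assms(2) x in \<open>simp add: eff_def\<close>)
  qed
  have "has_dim (LL D) 1"
    using has_dim_positive_degree[OF assms(1)] d by simp
  then show ?thesis
    using has_dim_1[OF _ 1 _ assms(4)] by auto
qed

end

section \<open>Irreducibility in the Zariski topology\<close>

text \<open>The generating sets are only used as a subbasis, so a neighbourhood is described by a
  finite set of forms instead of their product.\<close>

lemma zariski_open_basis:
  assumes "openin (zariski sc V) U" "L \<in> U"
  shows "\<exists>F. finite F \<and> (\<forall>f\<in>F. \<exists>d. homogeneous_form sc V d f) \<and> (\<forall>f\<in>F. \<exists>v\<in>L. f v \<noteq> 0) \<and>
    (\<forall>L'\<in>proj sc V. (\<forall>f\<in>F. \<exists>v\<in>L'. f v \<noteq> 0) \<longrightarrow> L' \<in> U)"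
proof -
  have "generate_topology_on {{L \<in> proj sc V. \<exists>v\<in>L. f v \<noteq> 0} | f d. homogeneous_form sc V d f} U"
    using assms(1) unfolding zariski_def openin_topology_generated_by_iff .
  then show ?thesis
    using assms(2)
  proof (induction rule: generate_topology_on.induct)
    case Empty
    then show ?case by simp
  next
    case (Int a b)
    obtain F where F: "finite F" "\<forall>f\<in>F. \<exists>d. homogeneous_form sc V d f" "\<forall>f\<in>F. \<exists>v\<in>L. f v \<noteq> 0"
      "\<forall>L'\<in>proj sc V. (\<forall>f\<in>F. \<exists>v\<in>L'. f v \<noteq> 0) \<longrightarrow> L' \<in> a"
      using Int by blast
    obtain G where G: "finite G" "\<forall>f\<in>G. \<exists>d. homogeneous_form sc V d f" "\<forall>f\<in>G. \<exists>v\<in>L. f v \<noteq> 0"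
      "\<forall>L'\<in>proj sc V. (\<forall>f\<in>G. \<exists>v\<in>L'. f v \<noteq> 0) \<longrightarrow> L' \<in> b"
      using Int by blast
    show ?case
      by (rule exI[of _ "F \<union> G"]) (use F G in \<open>auto simp: ball_Un\<close>)
  next
    case (UN K)
    then obtain k where "k \<in> K" "L \<in> k"
      by blast
    from UN.IH[OF this]
    obtain F where F: "finite F" "\<forall>f\<in>F. \<exists>d. homogeneous_form sc V d f" "\<forall>f\<in>F. \<exists>v\<in>L. f v \<noteq> 0"
      "\<forall>L'\<in>proj sc V. (\<forall>f\<in>F. \<exists>v\<in>L'. f v \<noteq> 0) \<longrightarrow> L' \<in> k"
      by blast
    show ?case
      by (rule exI[of _ F]) (use F \<open>k \<in> K\<close> in blast)
  next
    case (Basis s)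
    then obtain f d where "s = {L \<in> proj sc V. \<exists>v\<in>L. f v \<noteq> 0}" "homogeneous_form sc V d f"
      by blast
    then show ?case
      using Basis.prems by (intro exI[of _ "{f}"]) auto
  qed
qed

lemma zariski_closedI:
  assumes "Z \<subseteq> proj sc V"
    and "\<And>L. L \<in> proj sc V \<Longrightarrow> L \<notin> Z \<Longrightarrow>
      \<exists>f d. homogeneous_form sc V d f \<and> (\<exists>v\<in>L. f v \<noteq> 0) \<and> (\<forall>L'\<in>Z. \<forall>v\<in>L'. f v = 0)"
  shows "closedin (zariski sc V) Z"
  unfolding closedin_def topspace_zariski
proof (intro conjI assms(1))
  show "openin (zariski sc V) (proj sc V - Z)"
  proof (subst openin_subopen, intro ballI)
    fix L assume L: "L \<in> proj sc V - Z"
    then obtain f d where f: "homogeneous_form sc V d f" "\<exists>v\<in>L. f v \<noteq> 0" "\<forall>L'\<in>Z. \<forall>v\<in>L'. f v = 0"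
      using assms(2)[of L] by blast
    let ?U = "{L \<in> proj sc V. \<exists>v\<in>L. f v \<noteq> 0}"
    have "openin (zariski sc V) ?U"
      unfolding zariski_def using f(1) by (intro topology_generated_by_Basis) blast
    then show "\<exists>T. openin (zariski sc V) T \<and> L \<in> T \<and> T \<subseteq> proj sc V - Z"
      using f L by (intro exI[of _ ?U]) auto
  qed
qed

lemma zariski_not_in_closure:
  assumes "homogeneous_form sc V d f" "v \<in> L" "f v \<noteq> 0" "\<And>L' v. L' \<in> Z \<Longrightarrow> v \<in> L' \<Longrightarrow> f v = 0"
  shows "L \<notin> zariski sc V closure_of Z"
proof
  assume L: "L \<in> zariski sc V closure_of Z"
  let ?U = "{L \<in> proj sc V. \<exists>v\<in>L. f v \<noteq> 0}"
  have open_U: "openin (zariski sc V) ?U"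
    unfolding zariski_def using assms(1) by (intro topology_generated_by_Basis) blast
  have "L \<in> ?U"
    using L assms(2,3) closure_of_subset_topspace[of "zariski sc V" Z] unfolding topspace_zariski by blast
  then have "\<exists>y. y \<in> Z \<and> y \<in> ?U"
    using conjunct2[OF L[unfolded in_closure_of]] open_U by (elim allE[of _ ?U]) simp
  then obtain L' where "L' \<in> Z" "L' \<in> ?U"
    by blast
  then show False
    using assms(4) by blast
qed

text \<open>Each of the finitely many forms cutting out neighbourhoods of p and q is a nonzero
  polynomial along w, so a general parameter gives a point of Z in both neighbourhoods.\<close>

lemma zariski_irreducible:
  assumes sc1: "\<And>v. sc 1 v = v" and Z: "Z \<subseteq> proj sc V" "Z \<noteq> {}"
    and join: "\<And>p q. p \<in> Z \<Longrightarrow> q \<in> Z \<Longrightarrow> \<exists>w :: complex \<Rightarrow> _.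
      (\<forall>\<phi>. functional_on sc V \<phi> \<longrightarrow> (\<exists>P. \<forall>t. \<phi> (w t) = poly P t)) \<and> (\<forall>t. w t \<in> V) \<and>
      p = pline sc (w 0) \<and> q = pline sc (w 1) \<and> finite {t. pline sc (w t) \<notin> Z}"
  shows "irreducible_space (subtopology (zariski sc V) Z)"
  unfolding irreducible_space_def
proof (intro conjI allI impI)
  let ?T = "zariski sc V"
  have top: "topspace (subtopology ?T Z) = Z"
    using Z(1) by (auto simp: topspace_zariski)
  show "topspace (subtopology ?T Z) \<noteq> {}"
    using Z(2) top by simp
  fix A B assume AB: "closedin (subtopology ?T Z) A \<and> closedin (subtopology ?T Z) B \<and> A \<union> B = topspace (subtopology ?T Z)"
  show "A = topspace (subtopology ?T Z) \<or> B = topspace (subtopology ?T Z)"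
  proof (rule ccontr)
    assume "\<not> ?thesis"
    then obtain p q where p: "p \<in> Z" "p \<notin> A" and q: "q \<in> Z" "q \<notin> B"
      using AB top by blast
    have "openin (subtopology ?T Z) (Z - A)" "openin (subtopology ?T Z) (Z - B)"
      using AB top by (auto simp: closedin_def)
    then obtain U W where U: "openin ?T U" "Z - A = U \<inter> Z" and W: "openin ?T W" "Z - B = W \<inter> Z"
      by (auto simp: openin_subtopology)
    have "p \<in> U" "q \<in> W"
      using p q U(2) W(2) by blast+
    obtain F where F: "finite F" "\<forall>f\<in>F. \<exists>d. homogeneous_form sc V d f" "\<forall>f\<in>F. \<exists>v\<in>p. f v \<noteq> 0"
      "\<forall>L'\<in>proj sc V. (\<forall>f\<in>F. \<exists>v\<in>L'. f v \<noteq> 0) \<longrightarrow> L' \<in> U"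
      using zariski_open_basis[OF U(1) \<open>p \<in> U\<close>] by blast
    obtain G where G: "finite G" "\<forall>f\<in>G. \<exists>d. homogeneous_form sc V d f" "\<forall>f\<in>G. \<exists>v\<in>q. f v \<noteq> 0"
      "\<forall>L'\<in>proj sc V. (\<forall>f\<in>G. \<exists>v\<in>L'. f v \<noteq> 0) \<longrightarrow> L' \<in> W"
      using zariski_open_basis[OF W(1) \<open>q \<in> W\<close>] by blast
    obtain w :: "complex \<Rightarrow> _" where w: "\<forall>\<phi>. functional_on sc V \<phi> \<longrightarrow> (\<exists>P. \<forall>t. \<phi> (w t) = poly P t)"
      "\<forall>t. w t \<in> V" "p = pline sc (w 0)" "q = pline sc (w 1)" "finite {t. pline sc (w t) \<notin> Z}"
      using join[OF p(1) q(1)] by blast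
    have fin: "finite {t. f (w t) = 0}"
      if form: "\<exists>d. homogeneous_form sc V d f" and v: "v \<in> pline sc (w t0)" "f v \<noteq> 0" for f v t0
    proof -
      obtain d where d: "homogeneous_form sc V d f"
        using form by blast
      obtain P where P: "\<forall>t. f (w t) = poly P t"
        using homogeneous_form_poly_curve[OF d, of w] w(1) by blast
      obtain c where "v = sc c (w t0)"
        using v(1) by (auto simp: pline_def)
      then have "f (w t0) \<noteq> 0"
        using homogeneous_form_scale[OF d, of "w t0" c] w(2) v(2) by auto
      then have "P \<noteq> 0"
        using P by auto
      then show ?thesis
        using P poly_roots_finite[of P] by simp
    qed
    have "finite {t. f (w t) = 0}" if "f \<in> F \<union> G" for f
      using that fin F(2,3) G(2,3) unfolding w(3,4) by blast
    then have "finite ({t. pline sc (w t) \<notin> Z} \<union> (\<Union>f\<in>F \<union> G. {t. f (w t) = 0}))"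
      using w(5) F(1) G(1) by blast
    then obtain t where t: "t \<notin> {t. pline sc (w t) \<notin> Z} \<union> (\<Union>f\<in>F \<union> G. {t. f (w t) = 0})"
      using ex_new_if_finite[OF infinite_UNIV_char_0] by blast
    let ?r = "pline sc (w t)"
    have r: "?r \<in> Z" "?r \<in> proj sc V"
      using t Z(1) by auto
    have "w t \<in> ?r"
      unfolding pline_def using sc1[of "w t"] by (metis rangeI)
    then have "?r \<in> U" "?r \<in> W"
      using F(4) G(4) r(2) t by blast+
    then have "?r \<notin> A" "?r \<notin> B"
      using r(1) U(2) W(2) by blast+
    then show False
      using AB top r(1) by blast
  qed
qed

lemma irreducible_space_closure:
  assumes "irreducible_space (subtopology T Z)" "Z \<subseteq> topspace T"
  shows "irreducible_space (subtopology T (T closure_of Z))"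
  unfolding irreducible_space_def
proof (intro conjI allI impI)
  let ?Z = "T closure_of Z"
  have top: "topspace (subtopology T ?Z) = ?Z" "topspace (subtopology T Z) = Z"
    using assms(2) closure_of_subset_topspace[of T Z] by auto
  have sub: "Z \<subseteq> ?Z"
    by (rule closure_of_subset[OF assms(2)])
  show "topspace (subtopology T ?Z) \<noteq> {}"
    using assms(1) sub top unfolding irreducible_space_def by auto
  fix A B assume AB: "closedin (subtopology T ?Z) A \<and> closedin (subtopology T ?Z) B \<and> A \<union> B = topspace (subtopology T ?Z)"
  then have closed: "closedin T A" "closedin T B"
    using closedin_trans_full[OF _ closedin_closure_of] by blast+
  have "closedin (subtopology T Z) (A \<inter> Z)" "closedin (subtopology T Z) (B \<inter> Z)"
    using closed by (auto simp: closedin_subtopology)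
  moreover have "(A \<inter> Z) \<union> (B \<inter> Z) = topspace (subtopology T Z)"
    using AB sub top by blast
  ultimately have "A \<inter> Z = Z \<or> B \<inter> Z = Z"
    using assms(1) top unfolding irreducible_space_def by metis
  then have "?Z \<subseteq> A \<or> ?Z \<subseteq> B"
    using closure_of_minimal closed by (metis inf.absorb_iff2 inf_commute)
  then show "A = topspace (subtopology T ?Z) \<or> B = topspace (subtopology T ?Z)"
    using AB top by blast
qed

text \<open>An irreducible subset of a union of two closed sets lies in one of them; the
  non-inclusions make both sets maximal.\<close>

lemma irreducible_components_pair:
  assumes cover: "A \<union> B = topspace T" and closed: "closedin T A" "closedin T B"
    and irr: "irreducible_space (subtopology T A)" "irreducible_space (subtopology T B)"
    and inc: "\<not> A \<subseteq> B" "\<not> B \<subseteq> A"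
  shows "irreducible_components T = {A, B}"
proof -
  have split: "Y \<subseteq> A \<or> Y \<subseteq> B" if Y: "Y \<subseteq> topspace T" "irreducible_space (subtopology T Y)" for Y
  proof -
    have top: "topspace (subtopology T Y) = Y"
      using Y(1) by auto
    have "closedin (subtopology T Y) (A \<inter> Y)" "closedin (subtopology T Y) (B \<inter> Y)"
      using closed by (auto simp: closedin_subtopology)
    moreover have "(A \<inter> Y) \<union> (B \<inter> Y) = topspace (subtopology T Y)"
      using cover Y(1) top by blast
    ultimately have "A \<inter> Y = Y \<or> B \<inter> Y = Y"
      using Y(2) top unfolding irreducible_space_def by metis
    then show ?thesis
      by blast
  qed
  show ?thesis
  proof (intro equalityI subsetI)
    fix Z assume "Z \<in> irreducible_components T"
    then have Z: "Z \<subseteq> topspace T" "irreducible_space (subtopology T Z)"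
      and max: "\<And>Y. Y \<subseteq> topspace T \<Longrightarrow> irreducible_space (subtopology T Y) \<Longrightarrow> Z \<subseteq> Y \<Longrightarrow> Y = Z"
      by (auto simp: irreducible_components_def)
    then show "Z \<in> {A, B}"
      using split[OF Z] max[of A] max[of B] cover irr by blast
  next
    fix Z assume "Z \<in> {A, B}"
    moreover have "A \<in> irreducible_components T"
      unfolding irreducible_components_def using split cover irr inc by blast
    moreover have "B \<in> irreducible_components T"
      unfolding irreducible_components_def using split cover irr inc by blast
    ultimately show "Z \<in> irreducible_components T"
      by blast
  qed
qed

section \<open>Determinantal forms\<close>

text \<open>Indexed by natural numbers because the size b - 1 is a value, not the cardinality of an
  index type.\<close>

definition leibniz_det :: "nat \<Rightarrow> (nat \<Rightarrow> nat \<Rightarrow> complex) \<Rightarrow> complex" where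
  "leibniz_det n A = (\<Sum>p | p permutes {..<n}. of_int (sign p) * (\<Prod>i<n. A i (p i)))"

lemma leibniz_det_id:
  assumes "\<And>i j. i < n \<Longrightarrow> j < n \<Longrightarrow> A i j = (if i = j then 1 else 0)"
  shows "leibniz_det n A = 1"
proof -
  have "(\<Prod>i<n. A i (p i)) = (if p = id then 1 else 0)" if p: "p permutes {..<n}" for p
  proof (cases "p = id")
    case False
    then obtain i where i: "p i \<noteq> i"
      by (auto simp: fun_eq_iff)
    then have "i < n"
      using p unfolding permutes_def by blast
    moreover have "p i < n"
      using permutes_in_image[OF p, of i] \<open>i < n\<close> by simp
    ultimately have "A i (p i) = 0"
      using assms i by simp
    then have "(\<Prod>i<n. A i (p i)) = 0"
      using \<open>i < n\<close> by (intro prod_zero) auto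
    then show ?thesis
      using False by simp
  qed (use assms in simp)
  then have "leibniz_det n A = (\<Sum>p | p permutes {..<n}. of_int (sign p) * (if p = id then 1 else 0))"
    unfolding leibniz_det_def by (intro sum.cong) auto
  also have "\<dots> = (\<Sum>p | p permutes {..<n}. if p = id then 1 else 0)"
    by (rule sum.cong) auto
  also have "\<dots> = 1"
    by (simp add: finite_permutations permutes_id)
  finally show ?thesis .
qed

lemma leibniz_det_zero_column:
  assumes "m < n" "\<And>i. i < n \<Longrightarrow> A i m = 0"
  shows "leibniz_det n A = 0"
proof -
  have "(\<Prod>i<n. A i (p i)) = 0" if p: "p permutes {..<n}" for p
  proof -
    obtain i where "i < n" "p i = m"
      using permutes_image[OF p] assms(1) by (metis imageE lessThan_iff)
    then show ?thesis
      using assms(2) by (intro prod_zero) auto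
  qed
  then show ?thesis
    unfolding leibniz_det_def by (intro sum.neutral) auto
qed

text \<open>Composing with the transposition of j and m keeps every product and flips every sign, so
  the determinant equals its negative.\<close>

lemma leibniz_det_equal_columns:
  assumes "j < n" "m < n" "j \<noteq> m" "\<And>i. i < n \<Longrightarrow> A i j = A i m"
  shows "leibniz_det n A = 0"
proof -
  let ?t = "Transposition.transpose j m"
  have t: "?t permutes {..<n}"
    using assms by (intro permutes_swap_id) auto
  have "leibniz_det n A = (\<Sum>p | p permutes {..<n}. of_int (sign (?t \<circ> p)) * (\<Prod>i<n. A i ((?t \<circ> p) i)))"
    unfolding leibniz_det_def by (rule setum_permutations_compose_left[OF t])
  also have "\<dots> = (\<Sum>p | p permutes {..<n}. - (of_int (sign p) * (\<Prod>i<n. A i (p i))))"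
  proof (rule sum.cong)
    fix p assume "p \<in> {p. p permutes {..<n}}"
    then have p: "p permutes {..<n}"
      by simp
    have "sign (?t \<circ> p) = - sign p"
      using assms(3) p t by (subst sign_compose) (auto simp: sign_swap_id permutation_permutes)
    moreover have "(\<Prod>i<n. A i ((?t \<circ> p) i)) = (\<Prod>i<n. A i (p i))"
      by (rule prod.cong) (auto simp: Transposition.transpose_def assms(4))
    ultimately show "of_int (sign (?t \<circ> p)) * (\<Prod>i<n. A i ((?t \<circ> p) i)) = - (of_int (sign p) * (\<Prod>i<n. A i (p i)))"
      by simp
  qed simp
  also have "\<dots> = - leibniz_det n A"
    by (simp add: leibniz_det_def sum_negf)
  finally show ?thesis
    by simp
qed

text \<open>Linear expansion in column m leaves matrices \<open>A' j\<close> whose columns j and m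
  coincide.\<close>

lemma leibniz_det_dependent:
  assumes "m < n" "\<And>i. i < n \<Longrightarrow> A i m = (\<Sum>j<m. c j * A i j)"
  shows "leibniz_det n A = 0"
proof -
  define A' where "A' j i k = (if k = m then A i j else A i k)" for j i k
  have "(\<Prod>i<n. A i (p i)) = (\<Sum>j<m. c j * (\<Prod>i<n. A' j i (p i)))" if p: "p permutes {..<n}" for p
  proof -
    obtain i0 where i0: "i0 < n" "p i0 = m"
      using permutes_image[OF p] assms(1) by (metis imageE lessThan_iff)
    have other: "p i \<noteq> m" if "i \<noteq> i0" for i
      using permutes_inj[OF p] i0(2) that by (metis injD)
    have "(\<Prod>i<n. B i (p i)) = B i0 m * (\<Prod>i\<in>{..<n} - {i0}. B i (p i))" for B :: "nat \<Rightarrow> nat \<Rightarrow> complex"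
      using i0 by (subst prod.remove[of _ i0]) auto
    note rem = this
    have "(\<Prod>i<n. A' j i (p i)) = A i0 j * (\<Prod>i\<in>{..<n} - {i0}. A i (p i))" for j
    proof -
      have "(\<Prod>i\<in>{..<n} - {i0}. A' j i (p i)) = (\<Prod>i\<in>{..<n} - {i0}. A i (p i))"
        by (rule prod.cong) (use other in \<open>auto simp: A'_def\<close>)
      then show ?thesis
        unfolding rem[of "A' j"] by (simp add: A'_def)
    qed
    moreover have "(\<Prod>i<n. A i (p i)) = (\<Sum>j<m. c j * A i0 j) * (\<Prod>i\<in>{..<n} - {i0}. A i (p i))"
      unfolding rem[of A] assms(2)[OF i0(1)] ..
    ultimately show ?thesis
      by (simp add: sum_distrib_right mult.assoc)
  qed
  then have "leibniz_det n A = (\<Sum>p | p permutes {..<n}. \<Sum>j<m. of_int (sign p) * (c j * (\<Prod>i<n. A' j i (p i))))"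
    unfolding leibniz_det_def by (intro sum.cong) (auto simp: sum_distrib_left)
  also have "\<dots> = (\<Sum>j<m. \<Sum>p | p permutes {..<n}. of_int (sign p) * (c j * (\<Prod>i<n. A' j i (p i))))"
    by (rule sum.swap)
  also have "\<dots> = (\<Sum>j<m. c j * leibniz_det n (A' j))"
    unfolding leibniz_det_def sum_distrib_left by (intro sum.cong) (auto simp: mult_ac)
  also have "\<dots> = 0"
  proof (rule sum.neutral, rule ballI)
    fix j assume "j \<in> {..<m}"
    then have "leibniz_det n (A' j) = 0"
      using assms(1) by (intro leibniz_det_equal_columns[of j n m]) (auto simp: A'_def)
    then show "c j * leibniz_det n (A' j) = 0"
      by simp
  qed
  finally show ?thesis .
qed

lemma homogeneous_form_leibniz_det:
  assumes "\<And>i j. functional_on sc V (\<phi> i j)"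
  shows "homogeneous_form sc V n (\<lambda>v. leibniz_det n (\<lambda>i j. \<phi> i j v))"
proof -
  \<comment> \<open>\<open>prod_encode\<close> packs the two matrix indices into the single natural
    number that numbers the functionals.\<close>
  have "homogeneous_form sc V n (\<lambda>v. \<Sum>p\<in>{p. p permutes {..<n}}. of_int (sign p) *
      (\<Prod>i\<in>{..<n}. (case prod_decode (prod_encode (i, p i)) of (i, j) \<Rightarrow> \<phi> i j) v ^ 1))"
    by (rule homogeneous_formI[where \<phi> = "\<lambda>k. case prod_decode k of (i, j) \<Rightarrow> \<phi> i j"
          and g = "\<lambda>p i. prod_encode (i, p i)" and e = "\<lambda>_ _. 1"])
       (use assms in \<open>auto simp: finite_permutations split: prod.split\<close>)
  then show ?thesis
    by (simp add: leibniz_det_def)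
qed

section \<open>Algebraic dependence of too many polynomial functions\<close>

lemma sum_digits:
  fixes b :: nat
  shows "(\<Sum>i<m. (r div b ^ i mod b) * b ^ i) = r mod b ^ m"
proof (induction m)
  case (Suc m)
  have "r mod b ^ Suc m = b ^ m * (r div b ^ m mod b) + r mod b ^ m"
    using mod_mult2_eq[of r "b ^ m" b] by (simp add: mult.commute)
  then show ?case
    using Suc by (simp add: mult.commute)
qed simp

text \<open>
  The exponents of the monomials of degree \<open>n N\<close> in \<open>n + 1\<close> variables whose first \<open>n\<close>
  exponents are the digits of \<open>r\<close> to the base \<open>N + 1\<close>.
\<close>

definition digit_exponent :: "nat \<Rightarrow> nat \<Rightarrow> nat \<Rightarrow> nat \<Rightarrow> nat" where
  "digit_exponent n N r i = (if i < n then r div (N + 1) ^ i mod (N + 1)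
     else n * N - (\<Sum>i<n. r div (N + 1) ^ i mod (N + 1)))"

text \<open>A form in n + 1 variables with (N + 1)^n free coefficients; the last variable only pads
  the degree.\<close>

definition digit_form :: "nat \<Rightarrow> nat \<Rightarrow> (nat \<Rightarrow> complex) \<Rightarrow> (nat \<Rightarrow> complex) \<Rightarrow> complex" where
  "digit_form n N c w = (\<Sum>r<(N + 1) ^ n. c r * (\<Prod>i\<le>n. w i ^ digit_exponent n N r i))"

text \<open>Digits are at most N, so the subtraction in the last exponent is not truncated.\<close>

lemma sum_digit_exponent: "(\<Sum>i\<le>n. digit_exponent n N r i) = n * N"
proof -
  have "(\<Sum>i<n. r div (N + 1) ^ i mod (N + 1)) \<le> (\<Sum>i<n. N)"
    by (intro sum_mono) (metis Suc_eq_plus1 le_simps(2) mod_less_divisor zero_less_Suc)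
  then have "(\<Sum>i<n. r div (N + 1) ^ i mod (N + 1)) \<le> n * N"
    by simp
  then show ?thesis
    by (simp add: lessThan_Suc_atMost[symmetric] digit_exponent_def)
qed

text \<open>Kronecker substitution: the monomial with digits r becomes t^r, so different monomials
  stay independent in one variable.\<close>

lemma digit_form_nonzero:
  assumes "r0 < (N + 1) ^ n" "c r0 \<noteq> (0 :: complex)"
  shows "\<exists>t. digit_form n N c (\<lambda>i. if i < n then t ^ ((N + 1) ^ i) else 1) \<noteq> 0"
proof -
  define P where "P = (\<Sum>r<(N + 1) ^ n. monom (c r) r)"
  have "coeff P r0 = c r0"
    using assms(1) by (simp add: P_def coeff_sum)
  then have "P \<noteq> 0"
    using assms(2) by auto
  then have "finite {t. poly P t = 0}"
    by (rule poly_roots_finite)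
  then obtain t where t: "poly P t \<noteq> 0"
    using ex_new_if_finite[OF infinite_UNIV_char_0] by blast
  have "(\<Prod>i\<le>n. (if i < n then t ^ ((N + 1) ^ i) else 1) ^ digit_exponent n N r i) = t ^ r"
    if "r < (N + 1) ^ n" for r
  proof -
    have "(\<Prod>i\<le>n. (if i < n then t ^ ((N + 1) ^ i) else 1) ^ digit_exponent n N r i) =
        (\<Prod>i<n. t ^ ((r div (N + 1) ^ i mod (N + 1)) * (N + 1) ^ i))"
      by (simp add: lessThan_Suc_atMost[symmetric] digit_exponent_def power_mult[symmetric] mult.commute)
    also have "\<dots> = t ^ (\<Sum>i<n. (r div (N + 1) ^ i mod (N + 1)) * (N + 1) ^ i)"
      by (simp add: power_sum)
    also have "\<dots> = t ^ r"
      using that by (simp only: sum_digits mod_less)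
    finally show ?thesis .
  qed
  then have "digit_form n N c (\<lambda>i. if i < n then t ^ ((N + 1) ^ i) else 1) = poly P t"
    by (simp add: digit_form_def P_def poly_sum poly_monom)
  then show ?thesis
    using t by metis
qed

interpretation fun_algebra: comm_algebra "\<lambda>c (f :: 'p \<Rightarrow> complex) p. c * f p"
  by unfold_locales (auto simp: fun_eq_iff plus_fun_def times_fun_def algebra_simps)

text \<open>Each exponent is bounded separately, which makes the count (d + 1)^n immediate and
  additive in d under products.\<close>

definition box_monomials :: "nat \<Rightarrow> (nat \<Rightarrow> 'p \<Rightarrow> complex) \<Rightarrow> nat \<Rightarrow> ('p \<Rightarrow> complex) set" where
  "box_monomials n z d = (\<lambda>e p. \<Prod>j<n. z j p ^ e j) ` ({..<n} \<rightarrow>\<^sub>E {..d})"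

lemma box_monomialsI:
  assumes "\<And>j. j < n \<Longrightarrow> e j \<le> d" "f = (\<lambda>p. \<Prod>j<n. z j p ^ e j)"
  shows "f \<in> box_monomials n z d"
proof -
  have "f = (\<lambda>p. \<Prod>j<n. z j p ^ restrict e {..<n} j)"
    using assms(2) by (auto simp: fun_eq_iff)
  moreover have "restrict e {..<n} \<in> {..<n} \<rightarrow>\<^sub>E {..d}"
    using assms(1) by auto
  ultimately show ?thesis
    unfolding box_monomials_def by (rule image_eqI)
qed

lemma card_box_monomials: "finite (box_monomials n z d)" "card (box_monomials n z d) \<le> (d + 1) ^ n"
proof -
  have fin: "finite ({..<n} \<rightarrow>\<^sub>E {..d})"
    by (intro finite_PiE) auto
  then show "finite (box_monomials n z d)"
    by (simp add: box_monomials_def)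
  have "card (box_monomials n z d) \<le> card ({..<n} \<rightarrow>\<^sub>E {..d})"
    unfolding box_monomials_def by (rule card_image_le[OF fin])
  also have "\<dots> = (d + 1) ^ n"
    by (simp add: card_PiE)
  finally show "card (box_monomials n z d) \<le> (d + 1) ^ n" .
qed

lemma span_box_mult:
  assumes "f \<in> fun_algebra.span (box_monomials n z d)" "g \<in> fun_algebra.span (box_monomials n z d')"
  shows "f * g \<in> fun_algebra.span (box_monomials n z (d + d'))"
proof (rule fun_algebra.span_mult_subset[OF assms])
  fix x y assume "x \<in> box_monomials n z d" "y \<in> box_monomials n z d'"
  then obtain e e' where x: "e \<in> {..<n} \<rightarrow>\<^sub>E {..d}" "x = (\<lambda>p. \<Prod>j<n. z j p ^ e j)"
    and y: "e' \<in> {..<n} \<rightarrow>\<^sub>E {..d'}" "y = (\<lambda>p. \<Prod>j<n. z j p ^ e' j)"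
    by (auto simp: box_monomials_def)
  have "x * y \<in> box_monomials n z (d + d')"
  proof (rule box_monomialsI)
    show "e j + e' j \<le> d + d'" if "j < n" for j
      using x(1) y(1) that by (intro add_mono) auto
    show "x * y = (\<lambda>p. \<Prod>j<n. z j p ^ (e j + e' j))"
      using x(2) y(2) by (simp add: fun_eq_iff times_fun_def power_add prod.distrib)
  qed
  then show "x * y \<in> fun_algebra.span (box_monomials n z (d + d'))"
    by (rule fun_algebra.span_base)
qed

lemma span_box_1: "1 \<in> fun_algebra.span (box_monomials n z 0)"
  by (rule fun_algebra.span_base, rule box_monomialsI[of _ "\<lambda>_. 0"]) (auto simp: one_fun_def)

lemma span_box_power:
  "f \<in> fun_algebra.span (box_monomials n z 1) \<Longrightarrow> f ^ k \<in> fun_algebra.span (box_monomials n z k)"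
proof (induction k)
  case (Suc k)
  then have "f * f ^ k \<in> fun_algebra.span (box_monomials n z (1 + k))"
    by (intro span_box_mult)
  then show ?case
    by (simp only: power_Suc plus_1_eq_Suc)
qed (simp add: span_box_1)

lemma span_box_prod:
  assumes "\<And>i. i \<in> I \<Longrightarrow> f i \<in> fun_algebra.span (box_monomials n z 1)"
  shows "(\<Prod>i\<in>I. f i ^ e i) \<in> fun_algebra.span (box_monomials n z (\<Sum>i\<in>I. e i))"
  using assms
  by (induction I rule: infinite_finite_induct) (auto simp: span_box_1 intro!: span_box_mult span_box_power)

text \<open>There are n + 2 functions of n parameters. The (N + 1)^(n + 1) chosen monomials in them
  lie in a span of at most ((n + 1) N + 1)^n elements, which is smaller for suitable N.\<close>

lemma homogeneous_relation:
  fixes w z :: "nat \<Rightarrow> 'p \<Rightarrow> complex"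
  assumes "\<And>i. i \<le> Suc n \<Longrightarrow> w i \<in> fun_algebra.span (box_monomials n z 1)"
  obtains N c where "\<exists>r<(N + 1) ^ Suc n. c r \<noteq> 0"
    and "\<And>p. digit_form (Suc n) N c (\<lambda>i. w i p) = 0"
proof -
  \<comment> \<open>Chosen so that ((n + 1)(N + 1))^n = N (N + 1)^n < (N + 1)^(n + 1).\<close>
  define N where "N = Suc n ^ n"
  define M where "M r = (\<Prod>i\<le>Suc n. w i ^ digit_exponent (Suc n) N r i)" for r
  have M: "M r \<in> fun_algebra.span (box_monomials n z (Suc n * N))" for r
    unfolding M_def using span_box_prod[of "{..Suc n}" w n z "digit_exponent (Suc n) N r"] assms
    unfolding sum_digit_exponent by simp
  have "card (box_monomials n z (Suc n * N)) \<le> (Suc n * N + 1) ^ n"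
    by (rule card_box_monomials)
  also have "\<dots> \<le> (Suc n * (N + 1)) ^ n"
    by (intro power_mono) auto
  also have "\<dots> = N * (N + 1) ^ n"
    by (simp only: power_mult_distrib N_def)
  also have "\<dots> < (N + 1) ^ Suc n"
    by simp
  also have "\<dots> = card {..<(N + 1) ^ Suc n}"
    by simp
  finally have card: "card (box_monomials n z (Suc n * N)) < card {..<(N + 1) ^ Suc n}" .
  obtain c where c: "(\<Sum>r<(N + 1) ^ Suc n. (\<lambda>p. c r * M r p)) = 0" "\<exists>r\<in>{..<(N + 1) ^ Suc n}. c r \<noteq> 0"
    using fun_algebra.family_dependent[OF card_box_monomials(1) _ card, of M] M by blast
  have prod_app: "(\<Prod>i\<in>I. f i) p = (\<Prod>i\<in>I. f i p)" for I :: "nat set" and f :: "nat \<Rightarrow> 'p \<Rightarrow> complex" and p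
    by (induction I rule: infinite_finite_induct) (auto simp: one_fun_def times_fun_def)
  have sum_app: "(\<Sum>i\<in>I. f i) p = (\<Sum>i\<in>I. f i p)" for I :: "nat set" and f :: "nat \<Rightarrow> 'p \<Rightarrow> complex" and p
    by (induction I rule: infinite_finite_induct) (auto simp: zero_fun_def plus_fun_def)
  have pow_app: "(f ^ k) p = f p ^ k" for f :: "'p \<Rightarrow> complex" and k p
    by (induction k) (auto simp: one_fun_def times_fun_def)
  have "digit_form (Suc n) N c (\<lambda>i. w i p) = 0" for p
    using fun_cong[OF c(1), of p] unfolding sum_app M_def prod_app pow_app digit_form_def by (simp add: zero_fun_def)
  then show ?thesis
    using that c(2) by blast
qed

section \<open>Resonant sections of the split bundle\<close>

locale split_bundle = genus_one_curve C for C :: "('n::finite, 'k::field) variety_data" +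
  fixes P Q :: "'n ppoint" and b :: int
  assumes P: "P \<in> pts C" and Q: "Q \<in> pts C" and b: "b \<ge> 3"
begin

abbreviation DP :: "'n ppoint \<Rightarrow> int" where "DP \<equiv> multiple_point 2 P"
abbreviation DQ :: "'n ppoint \<Rightarrow> int" where "DQ \<equiv> multiple_point b Q"

text \<open>\<open>O(DK)\<close> is the sheaf of homomorphisms from \<open>O(2P)\<close> to \<open>O(bQ)\<close>.\<close>

definition DK :: "'n ppoint \<Rightarrow> int" where "DK = (\<lambda>x. DQ x + - DP x)"

definition E :: "'n ppoint \<Rightarrow> ('k ^ 2) set" where
  "E = direct_sum (line_bundle C DP) (line_bundle C DQ)"

abbreviation V :: "('k ^ 2) set" where "V \<equiv> global_sections C E"

abbreviation sc :: "complex \<Rightarrow> 'k ^ 2 \<Rightarrow> 'k ^ 2" where "sc \<equiv> cscale C"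
abbreviation line :: "'k ^ 2 \<Rightarrow> ('k ^ 2) set" where "line \<equiv> pline sc"
abbreviation mk :: "'k \<Rightarrow> 'k \<Rightarrow> 'k ^ 2" where "mk f g \<equiv> vector [f, g]"

lemma vec2_eq_iff: "(v :: 'k ^ 2) = w \<longleftrightarrow> v $ 1 = w $ 1 \<and> v $ 2 = w $ 2"
  by (simp add: vec_eq_iff forall_2)

lemma cscale_nth [simp]: "cscale C c v $ i = const C c * v $ i"
  by (simp add: cscale_def)

lemma mem_E: "v \<in> E x \<longleftrightarrow> vge x (- DP x) (v $ 1) \<and> vge x (- DQ x) (v $ 2)"
  by (auto simp: E_def direct_sum_def line_bundle_def vge_def)

lemma mem_V: "s \<in> V \<longleftrightarrow> s $ 1 \<in> LL DP \<and> s $ 2 \<in> LL DQ"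
  by (auto simp: global_sections_def mem_E LL_def)

lemma fin_DK: "fin_div DK"
  unfolding DK_def by (intro fin_div_add fin_div_uminus fin_div_point)

lemma deg_DK: "deg DK = b - 2"
  unfolding DK_def deg_add[OF fin_div_point fin_div_uminus[OF fin_div_point]]
  by (simp add: deg_uminus deg_point P Q)

lemma has_dim_DP: "has_dim (LL DP) 2"
  using has_dim_positive_degree[of DP] deg_point[OF P] by simp

lemma has_dim_DQ: "has_dim (LL DQ) (nat b)"
  using has_dim_positive_degree[of DQ] deg_point[OF Q] b by simp

lemma has_dim_DK: "has_dim (LL DK) (nat (b - 2))"
  using has_dim_positive_degree[OF fin_DK] deg_DK b by simp

lemma mult_DP_DK: "f \<in> LL DP \<Longrightarrow> k \<in> LL DK \<Longrightarrow> f * k \<in> LL DQ"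
  using LL_mult[of f DP k DK] by (simp add: DK_def)

lemma ex_nonconstant_section:
  assumes "fin_div D" "deg D \<ge> 2"
  shows "\<exists>h\<in>LL D. h \<notin> range (const C)"
proof (rule ccontr)
  assume "\<not> ?thesis"
  then have sub: "LL D \<subseteq> span {1}"
    by (auto simp: span_singleton)
  have "has_dim (LL D) (nat (deg D))"
    using assms by (intro has_dim_positive_degree) auto
  then obtain B where B: "finite B" "card B = nat (deg D)" "independent B" "span B = LL D"
    unfolding has_dim_def by blast
  have "B \<subseteq> span {1}"
    using B(4) sub span_superset[of B] by blast
  then have "card B \<le> card {1::'k}"
    using independent_span_bound[of "{1}" B] B(3) by blast
  then show False
    using B(2) assms(2) by simp
qed

text \<open>The divisor of \<open>s\<close> as a section of its saturation.\<close>

definition min_div :: "'k ^ 2 \<Rightarrow> 'n ppoint \<Rightarrow> int" where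
  "min_div s x = (if s $ 1 = 0 then ord x (s $ 2) + DQ x
     else if s $ 2 = 0 then ord x (s $ 1) + DP x
     else min (ord x (s $ 1) + DP x) (ord x (s $ 2) + DQ x))"

text \<open>The minimum in \<open>min_div\<close> expresses that both components of c s must satisfy
  their pole bounds.\<close>

lemma scaled_in_E:
  assumes "x \<in> pts C" "s \<noteq> 0"
  shows "c *s s \<in> E x \<longleftrightarrow> vge x (- min_div s x) c"
  using assms
  by (cases "c = 0"; cases "s $ 1 = 0"; cases "s $ 2 = 0")
     (auto simp: mem_E vge_def min_div_def ord_mult vec2_eq_iff)

lemma fin_min_div:
  assumes "s \<noteq> 0"
  shows "fin_div (min_div s)"
proof -
  have "{x \<in> pts C. min_div s x \<noteq> 0} \<subseteq> (if s $ 1 = 0 then {} else {x \<in> pts C. ord x (s $ 1) \<noteq> 0}) \<union>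
      (if s $ 2 = 0 then {} else {x \<in> pts C. ord x (s $ 2) \<noteq> 0}) \<union>
      {x \<in> pts C. DP x \<noteq> 0} \<union> {x \<in> pts C. DQ x \<noteq> 0}"
    using assms by (auto simp: min_div_def vec2_eq_iff split: if_splits)
  moreover have "finite \<dots>"
    using finite_support[of "s $ 1"] finite_support[of "s $ 2"] fin_div_point[of 2 P] fin_div_point[of b Q]
    unfolding fin_div_def by auto
  ultimately show ?thesis
    unfolding fin_div_def by (rule finite_subset)
qed

lemma eff_min_div:
  assumes "s \<in> V" "s \<noteq> 0"
  shows "eff (min_div s)"
  unfolding eff_def
proof
  fix x assume x: "x \<in> pts C"
  have "1 *s s \<in> E x"
    using assms(1) x by (simp add: global_sections_def)
  then show "0 \<le> min_div s x"
    using ord_const[OF x, of 1] scaled_in_E[OF x assms(2), of 1] by (simp add: vge_def h_1)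
qed

lemma scaled_section: "s \<noteq> 0 \<Longrightarrow> c *s s \<in> V \<longleftrightarrow> c \<in> LL (min_div s)"
  using scaled_in_E by (auto simp: global_sections_def LL_def)

lemma proportional_of_det2:
  assumes "det2 s t = 0" "s \<noteq> 0"
  shows "\<exists>h. t = h *s (s :: 'k ^ 2)"
proof -
  have "det2 s t $ 1 $ 2 = 0"
    using assms(1) by simp
  then have *: "s $ 1 * t $ 2 = s $ 2 * t $ 1"
    by (simp add: det2_def)
  show ?thesis
  proof (cases "s $ 1 = 0")
    case True
    then have "s $ 2 \<noteq> 0"
      using assms(2) by (simp add: vec2_eq_iff)
    then show ?thesis
      using * True by (intro exI[of _ "t $ 2 / s $ 2"]) (simp add: vec2_eq_iff)
  next
    case False
    then show ?thesis
      using * by (intro exI[of _ "t $ 1 / s $ 1"]) (simp add: vec2_eq_iff field_simps)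
  qed
qed

lemma lin_independent2_scaled:
  assumes "s \<noteq> 0"
  shows "lin_independent2 C s (h *s (s :: 'k ^ 2)) \<longleftrightarrow> h \<notin> range (const C)"
proof -
  have eq: "cscale C a s + cscale C d (h *s s) = (const C a + const C d * h) *s s" for a d
    by (simp add: vec2_eq_iff algebra_simps)
  have zero: "c *s s = 0 \<longleftrightarrow> c = 0" for c
    using assms by (auto simp: vec2_eq_iff)
  show ?thesis
  proof
    assume ind: "lin_independent2 C s (h *s s)"
    show "h \<notin> range (const C)"
    proof
      assume "h \<in> range (const C)"
      then obtain c where "h = const C c"
        by blast
      then have "cscale C c s + cscale C (-1) (h *s s) = 0"
        unfolding eq zero by (simp add: h_minus h_1)
      then show False
        using ind unfolding lin_independent2_def by fastforce
    qed
  next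
    assume h: "h \<notin> range (const C)"
    show "lin_independent2 C s (h *s s)"
      unfolding lin_independent2_def eq zero
    proof (intro allI impI)
      fix a d assume *: "const C a + const C d * h = 0"
      have "d = 0"
      proof (rule ccontr)
        assume d: "d \<noteq> 0"
        then have "const C d \<noteq> 0"
          by (simp add: h_eq_0_iff)
        then have "h = - const C a * inverse (const C d)"
          using * by (simp add: field_simps eq_neg_iff_add_eq_0 add.commute)
        then have "h = const C (- a * inverse d)"
          by (simp add: h_mult h_minus h_inverse)
        then show False
          using h by blast
      qed
      then show "a = 0 \<and> d = 0"
        using * by (simp add: h_0 h_eq_0_iff)
    qed
  qed
qed

text \<open>A section with vanishing determinant against s is h s with h in
  \<open>LL (min_div s)\<close>, and it is independent of s iff h is nonconstant; such h exist
  exactly from degree two on.\<close>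

lemma resonant_iff_min_div: "resonant C E s \<longleftrightarrow> s \<in> V \<and> s \<noteq> 0 \<and> deg (min_div s) \<ge> 2"
proof
  assume res: "resonant C E s"
  then obtain t where t: "s \<in> V" "t \<in> V" "lin_independent2 C s t" "det2 s t = 0"
    by (auto simp: resonant_def)
  have s0: "s \<noteq> 0"
  proof
    assume "s = 0"
    then have "cscale C 1 s + cscale C 0 t = 0"
      by (simp add: vec2_eq_iff h_0)
    then show False
      using t(3) unfolding lin_independent2_def by fastforce
  qed
  obtain h where h: "t = h *s s"
    using proportional_of_det2[OF t(4) s0] by blast
  have "h \<in> LL (min_div s)"
    using t(2) scaled_section[OF s0] unfolding h by blast
  moreover have "h \<notin> range (const C)"
    using t(3) lin_independent2_scaled[OF s0] unfolding h by blast
  ultimately have "\<not> deg (min_div s) \<le> 1"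
    using low_degree_constant[OF fin_min_div[OF s0] eff_min_div[OF t(1) s0]] by blast
  then show "s \<in> V \<and> s \<noteq> 0 \<and> deg (min_div s) \<ge> 2"
    using t(1) s0 by simp
next
  assume s: "s \<in> V \<and> s \<noteq> 0 \<and> deg (min_div s) \<ge> 2"
  then obtain h where h: "h \<in> LL (min_div s)" "h \<notin> range (const C)"
    using ex_nonconstant_section fin_min_div by blast
  have "det2 s (h *s s) = 0"
    by (simp add: det2_def vec_eq_iff)
  moreover have "h *s s \<in> V" "lin_independent2 C s (h *s s)"
    using s h scaled_section lin_independent2_scaled by blast+
  ultimately show "resonant C E s"
    using s unfolding resonant_def by blast
qed

text \<open>For nonzero first component f, \<open>min_div s\<close> is at most div f + 2P, of degree
  two. Degree at least two forces equality, that is div f + 2P \<le> div g + bQ, so g / f lies in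
  H^0(O(bQ - 2P)).\<close>

lemma resonant_cases:
  assumes "s \<in> V" "s \<noteq> 0"
  shows "resonant C E s \<longleftrightarrow> s $ 1 = 0 \<or> (\<exists>k\<in>LL DK. s $ 2 = s $ 1 * k)"
    and "s $ 1 = 0 \<Longrightarrow> deg (min_div s) = b"
    and "s $ 1 \<noteq> 0 \<Longrightarrow> k \<in> LL DK \<Longrightarrow> s $ 2 = s $ 1 * k \<Longrightarrow> deg (min_div s) = 2"
proof -
  have deg_div: "deg (\<lambda>x. ord x f + D x) = deg D" if "f \<noteq> 0" "fin_div D" for f D
    using that deg_add[OF fin_div_ord] deg_ord[OF _ P] by simp
  show zero: "deg (min_div s) = b" if s1: "s $ 1 = 0"
  proof -
    have "s $ 2 \<noteq> 0"
      using s1 assms(2) by (simp add: vec2_eq_iff)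
    moreover have "min_div s = (\<lambda>x. ord x (s $ 2) + DQ x)"
      using s1 by (simp add: min_div_def fun_eq_iff)
    ultimately show ?thesis
      using deg_div[of "s $ 2" DQ] deg_point[OF Q] by simp
  qed
  show two: "deg (min_div s) = 2" if s1: "s $ 1 \<noteq> 0" and k: "k \<in> LL DK" "s $ 2 = s $ 1 * k" for k
  proof -
    have "min_div s x = ord x (s $ 1) + DP x" if x: "x \<in> pts C" for x
    proof (cases "s $ 2 = 0")
      case False
      then have "k \<noteq> 0"
        using k(2) by auto
      moreover have "vge x (- DK x) k"
        using k(1) x by (simp add: LL_def)
      ultimately have "ord x (s $ 1) + DP x \<le> ord x (s $ 2) + DQ x"
        unfolding k(2) ord_mult[OF x s1 \<open>k \<noteq> 0\<close>] by (simp add: vge_def DK_def)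
      then show ?thesis
        using s1 False by (simp add: min_div_def)
    qed (use s1 in \<open>simp add: min_div_def\<close>)
    then have "deg (min_div s) = deg (\<lambda>x. ord x (s $ 1) + DP x)"
      by (rule deg_cong)
    then show ?thesis
      using deg_div[OF s1, of DP] deg_point[OF P] by simp
  qed
  have "\<exists>k\<in>LL DK. s $ 2 = s $ 1 * k" if s1: "s $ 1 \<noteq> 0" and res: "resonant C E s"
  proof (cases "s $ 2 = 0")
    case True
    then show ?thesis
      by (intro bexI[of _ 0]) (auto simp: LL_def)
  next
    case False
    let ?A = "\<lambda>x. ord x (s $ 1) + DP x"
    have "deg (min_div s) \<ge> 2"
      using res resonant_iff_min_div by blast
    moreover have degA: "deg ?A = 2"
      using deg_div[OF s1, of DP] deg_point[OF P] by simp
    moreover have finA: "fin_div ?A"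
      by (intro fin_div_add fin_div_ord s1 fin_div_point)
    \<comment> \<open>The defect of that inequality: effective and of degree at most 0, hence zero
      on the curve.\<close>
    define D where "D = (\<lambda>x. ?A x + - min_div s x)"
    have D: "fin_div D"
      unfolding D_def by (intro fin_div_add[OF finA] fin_div_uminus fin_min_div assms)
    have "deg D = 2 - deg (min_div s)"
      unfolding D_def using deg_add[OF finA fin_div_uminus[OF fin_min_div[OF assms(2)]]] degA
      by (simp add: deg_uminus)
    moreover have "eff D"
      using s1 False by (auto simp: eff_def D_def min_div_def)
    ultimately have "D x = 0" if "x \<in> pts C" for x
      using eff_deg_0[OF D _ _ that] deg_nonneg[of D] by linarith
    then have le: "ord x (s $ 1) + DP x \<le> ord x (s $ 2) + DQ x" if "x \<in> pts C" for x
      using that s1 False by (fastforce simp: D_def min_div_def min_def split: if_splits)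
    have "s $ 2 * inverse (s $ 1) \<in> LL DK"
      unfolding LL_def
    proof safe
      fix x assume x: "x \<in> pts C"
      show "vge x (- DK x) (s $ 2 * inverse (s $ 1))"
        using le[OF x] s1 False by (simp add: vge_def ord_mult[OF x] ord_inverse[OF x] DK_def)
    qed
    then show ?thesis
      using s1 by (intro bexI[of _ "s $ 2 * inverse (s $ 1)"]) auto
  qed
  moreover have "resonant C E s" if "s $ 1 = 0 \<or> (\<exists>k\<in>LL DK. s $ 2 = s $ 1 * k)"
    using that zero two b assms unfolding resonant_iff_min_div by fastforce
  ultimately show "resonant C E s \<longleftrightarrow> s $ 1 = 0 \<or> (\<exists>k\<in>LL DK. s $ 2 = s $ 1 * k)"
    by blast
qed

section \<open>The degree of the saturation\<close>

text \<open>Every rational function is a quotient of germs at x, so the saturated stalk is the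
  intersection of K s with the stalk of E.\<close>

lemma saturation_eq:
  assumes "x \<in> pts C" "s \<noteq> 0"
  shows "saturation C E s x = {c *s s | c. vge x (- min_div s x) c}"
proof (intro equalityI subsetI)
  fix v assume "v \<in> saturation C E s x"
  then obtain h g where v: "v \<in> E x" "h \<noteq> 0" "h *s v = g *s s"
    by (auto simp: saturation_def)
  have "v = (inverse h * h) *s v"
    using v(2) by simp
  also have "\<dots> = (inverse h * g) *s s"
    using v(3) by (metis vector_smult_assoc)
  finally have eq: "v = (inverse h * g) *s s" .
  then have "vge x (- min_div s x) (inverse h * g)"
    using v(1) scaled_in_E[OF assms] by metis
  then show "v \<in> {c *s s | c. vge x (- min_div s x) c}"
    using eq by blast
next
  fix v assume "v \<in> {c *s s | c. vge x (- min_div s x) c}"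
  then obtain c where c: "v = c *s s" "c *s s \<in> E x"
    using scaled_in_E[OF assms] by blast
  obtain p q where pq: "p \<in> \<O> x" "q \<in> \<O> x" "q \<noteq> 0" "c = p / q"
    by (rule local_ring_fraction[OF assms(1)])
  then have "q *s v = p *s s"
    using c(1) by (simp add: vec2_eq_iff)
  then show "v \<in> saturation C E s x"
    using c pq unfolding saturation_def by blast
qed

lemma section_ord_saturation:
  assumes x: "x \<in> pts C" and s: "s \<noteq> 0" and f: "f \<noteq> 0"
  shows "section_ord C x (saturation C E s x) (f *s s) = ord x f + min_div s x"
proof -
  let ?n = "ord x f + min_div s x"
  have smult_eq: "c *s s = d *s s \<longleftrightarrow> c = d" for c d
    using s by (auto simp: vec2_eq_iff)
  obtain t where t: "uniformizer C x t"
    using ex_uniformizer[OF x] by blast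
  have t0: "t \<noteq> 0"
    by (rule uniformizer_nonzero[OF x t])
  note ordt = ord_powi_uniformizer[OF x t]
  show ?thesis
    unfolding section_ord_def
  proof (rule the_equality)
    \<comment> \<open>Has order \<open>- min_div s x\<close>, the least allowed in the stalk, so its
      multiple of s is a generator.\<close>
    let ?c = "t powi (- ?n) * f"
    have c0: "?c \<noteq> 0" and ordc: "ord x ?c = - min_div s x"
      using t0 f by (auto simp: ord_mult[OF x] ordt)
    have "saturation C E s x = {g *s (?c *s s) | g. g \<in> \<O> x}"
    proof (intro equalityI subsetI)
      fix v assume "v \<in> saturation C E s x"
      then obtain c where c: "v = c *s s" "vge x (- min_div s x) c"
        unfolding saturation_eq[OF x s] by blast
      have "vge x (min_div s x) (inverse ?c)"
        using ord_inverse[OF x c0] ordc by (simp add: vge_def)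
      then have "vge x 0 (c * inverse ?c)"
        using vge_mult[OF x c(2)] by fastforce
      moreover have "v = (c * inverse ?c) *s (?c *s s)"
        using c(1) by (simp only: vector_smult_assoc mult.assoc left_inverse[OF c0] mult_1_right)
      ultimately show "v \<in> {g *s (?c *s s) | g. g \<in> \<O> x}"
        using local_ring_iff_vge[OF x] by blast
    next
      fix v assume "v \<in> {g *s (?c *s s) | g. g \<in> \<O> x}"
      then obtain g where g: "v = g *s (?c *s s)" "vge x 0 g"
        using local_ring_iff_vge[OF x] by blast
      have "vge x (0 + - min_div s x) (g * ?c)"
        using ordc by (intro vge_mult[OF x g(2)]) (simp add: vge_def)
      moreover have "v = (g * ?c) *s s"
        using g(1) by (simp only: vector_smult_assoc)
      ultimately show "v \<in> saturation C E s x"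
        unfolding saturation_eq[OF x s] by auto
    qed
    moreover have "f *s s = t powi ?n *s (?c *s s)"
    proof -
      have "t powi ?n * t powi (- ?n) = 1"
        using t0 by (simp add: power_int_add[symmetric])
      then have "t powi ?n * ?c = f"
        by (metis mult.assoc mult_1)
      then show ?thesis
        by (simp only: vector_smult_assoc)
    qed
    ultimately show "\<exists>t e. uniformizer C x t \<and> saturation C E s x = {g *s e | g. g \<in> \<O> x} \<and> f *s s = t powi ?n *s e"
      using t by blast
  next
    fix m assume "\<exists>t e. uniformizer C x t \<and> saturation C E s x = {g *s e | g. g \<in> \<O> x} \<and> f *s s = t powi m *s e"
    then obtain t' e where t': "uniformizer C x t'" and e: "saturation C E s x = {g *s e | g. g \<in> \<O> x}"
      "f *s s = t' powi m *s e"
      by blast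
    have "1 *s e \<in> saturation C E s x"
      unfolding e(1) using local_ring_1[OF x] by blast
    then obtain c where c: "e = c *s s" "vge x (- min_div s x) c"
      unfolding saturation_eq[OF x s] by auto
    have fc: "f = t' powi m * c"
      using e(2) unfolding c(1) vector_smult_assoc smult_eq .
    then have c0: "c \<noteq> 0"
      using f by auto
    have ordf: "ord x f = m + ord x c"
      unfolding fc using uniformizer_nonzero[OF x t'] c0
      by (simp add: ord_mult[OF x] ord_powi_uniformizer[OF x t'])
    \<comment> \<open>This germ of least possible order is a multiple of e, which forces c to have
      that order too and so determines m.\<close>
    have "t powi (- min_div s x) *s s \<in> saturation C E s x"
      unfolding saturation_eq[OF x s] using ordt by (auto simp: vge_def)
    then obtain g where g: "g \<in> \<O> x" "t powi (- min_div s x) *s s = g *s e"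
      unfolding e(1) by blast
    then have "t powi (- min_div s x) = g * c"
      unfolding c(1) vector_smult_assoc smult_eq by simp
    moreover from this have "g \<noteq> 0"
      using t0 by auto
    ultimately have "- min_div s x = ord x g + ord x c"
      using ordt[of "- min_div s x"] c0 by (simp add: ord_mult[OF x])
    moreover have "ord x g \<ge> 0"
      using g(1) local_ring_iff_ord[OF x \<open>g \<noteq> 0\<close>] by simp
    moreover have "- min_div s x \<le> ord x c"
      using c(2) c0 by (simp add: vge_def)
    ultimately show "m = ?n"
      using ordf by simp
  qed
qed

text \<open>Every nonzero rational section is f s, and div f adds degree 0; hence the definite
  description is independent of the section.\<close>

lemma sub_line_bundle_degree_saturation:
  assumes s: "s \<noteq> 0"
  shows "sub_line_bundle_degree C (saturation C E s) = deg (min_div s)"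
proof -
  have sum: "(\<Sum>x | x \<in> pts C \<and> section_ord C x (saturation C E s x) (f *s s) \<noteq> 0.
      section_ord C x (saturation C E s x) (f *s s)) = deg (min_div s)" if f: "f \<noteq> 0" for f
  proof -
    have "(\<Sum>x | x \<in> pts C \<and> section_ord C x (saturation C E s x) (f *s s) \<noteq> 0.
        section_ord C x (saturation C E s x) (f *s s)) = deg (\<lambda>x. section_ord C x (saturation C E s x) (f *s s))"
      by (simp add: deg_def)
    also have "\<dots> = deg (\<lambda>x. ord x f + min_div s x)"
      by (rule deg_cong) (rule section_ord_saturation[OF _ s f])
    also have "\<dots> = deg (min_div s)"
      using deg_add[OF fin_div_ord[OF f] fin_min_div[OF s]] deg_ord[OF f P] by simp
    finally show ?thesis .
  qed
  show ?thesis
    unfolding sub_line_bundle_degree_def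
  proof (rule the_equality)
    obtain t where t: "uniformizer C P t"
      using ex_uniformizer[OF P] by blast
    let ?c = "t powi (- min_div s P)"
    have t0: "t \<noteq> 0"
      by (rule uniformizer_nonzero[OF P t])
    have "?c *s s \<in> saturation C E s P"
      unfolding saturation_eq[OF P s] using ord_powi_uniformizer[OF P t] by (auto simp: vge_def)
    moreover have "s = inverse ?c *s (?c *s s)"
      using t0 by (simp add: vector_smult_assoc)
    moreover have "deg (min_div s) = (\<Sum>x | x \<in> pts C \<and> section_ord C x (saturation C E s x) s \<noteq> 0.
        section_ord C x (saturation C E s x) s)"
      using sum[of 1] by simp
    ultimately show "\<exists>\<sigma>. \<sigma> \<noteq> 0 \<and> (\<exists>x\<in>pts C. \<exists>e\<in>saturation C E s x. \<exists>h. \<sigma> = h *s e) \<and>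
        deg (min_div s) = (\<Sum>x | x \<in> pts C \<and> section_ord C x (saturation C E s x) \<sigma> \<noteq> 0.
          section_ord C x (saturation C E s x) \<sigma>)"
      using s P by blast
  next
    fix d assume "\<exists>\<sigma>. \<sigma> \<noteq> 0 \<and> (\<exists>x\<in>pts C. \<exists>e\<in>saturation C E s x. \<exists>h. \<sigma> = h *s e) \<and>
        d = (\<Sum>x | x \<in> pts C \<and> section_ord C x (saturation C E s x) \<sigma> \<noteq> 0.
          section_ord C x (saturation C E s x) \<sigma>)"
    then obtain \<sigma> x e h where \<sigma>: "\<sigma> \<noteq> 0" and x: "x \<in> pts C" "e \<in> saturation C E s x" "\<sigma> = h *s e"
      and d: "d = (\<Sum>x | x \<in> pts C \<and> section_ord C x (saturation C E s x) \<sigma> \<noteq> 0.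
          section_ord C x (saturation C E s x) \<sigma>)"
      by blast
    obtain c where "e = c *s s"
      using x(2) unfolding saturation_eq[OF x(1) s] by blast
    then have f: "\<sigma> = (h * c) *s s"
      using x(3) by (simp add: vector_smult_assoc)
    then have f0: "h * c \<noteq> 0"
      using \<sigma> by (metis vector_smult_lzero)
    show "d = deg (min_div s)"
      unfolding d f by (rule sum[OF f0])
  qed
qed

section \<open>The two families of resonant sections\<close>

definition S2 :: "('k ^ 2) set" where
  "S2 = {s. s \<in> V \<and> s $ 1 \<noteq> 0 \<and> (\<exists>k\<in>LL DK. s $ 2 = s $ 1 * k)}"

definition Sb :: "('k ^ 2) set" where
  "Sb = {s. s \<in> V \<and> s $ 1 = 0 \<and> s $ 2 \<noteq> 0}"

lemma resonant_iff: "resonant C E s \<longleftrightarrow> s \<in> S2 \<union> Sb"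
proof (cases "s \<in> V \<and> s \<noteq> 0")
  case True
  then show ?thesis
    using resonant_cases(1)[of s] by (auto simp: S2_def Sb_def vec2_eq_iff)
next
  case False
  then show ?thesis
    using resonant_iff_min_div[of s] by (auto simp: S2_def Sb_def)
qed

lemma resonance_variety_eq: "resonance_variety C E = line ` S2 \<union> line ` Sb"
  unfolding resonance_variety_def resonant_iff by blast

lemma degree_S2: "s \<in> S2 \<Longrightarrow> sub_line_bundle_degree C (saturation C E s) = 2"
  using sub_line_bundle_degree_saturation[of s] resonant_cases(3)[of s]
  by (auto simp: S2_def vec2_eq_iff[of s])

lemma degree_Sb: "s \<in> Sb \<Longrightarrow> sub_line_bundle_degree C (saturation C E s) = b"
  using sub_line_bundle_degree_saturation[of s] resonant_cases(2)[of s]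
  by (auto simp: Sb_def vec2_eq_iff[of s])

text \<open>Since b \<ge> 3, the degrees 2 and b tell the two families apart.\<close>

lemma stratum_2: "resonance_stratum C E 2 = line ` S2"
  and stratum_b: "resonance_stratum C E b = line ` Sb"
proof -
  have "s \<in> S2 \<union> Sb \<and> sub_line_bundle_degree C (saturation C E s) = 2 \<longleftrightarrow> s \<in> S2"
    "s \<in> S2 \<union> Sb \<and> sub_line_bundle_degree C (saturation C E s) = b \<longleftrightarrow> s \<in> Sb" for s
    using degree_S2[of s] degree_Sb[of s] b by auto
  then show "resonance_stratum C E 2 = line ` S2" "resonance_stratum C E b = line ` Sb"
    unfolding resonance_stratum_def resonant_iff by (simp_all only:) auto
qed

end

section \<open>The two components\<close>

context field_embedding
begin

text \<open>Defined on all of K, so that one functional applies to any product of sections.\<close>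

definition linear_functional :: "('k \<Rightarrow> complex) \<Rightarrow> bool" where
  "linear_functional \<psi> \<longleftrightarrow> (\<forall>x y. \<psi> (x + y) = \<psi> x + \<psi> y) \<and> (\<forall>c x. \<psi> (h c * x) = c * \<psi> x)"

lemma linear_functional_add: "linear_functional \<psi> \<Longrightarrow> \<psi> (x + y) = \<psi> x + \<psi> y"
  and linear_functional_scale: "linear_functional \<psi> \<Longrightarrow> \<psi> (h c * x) = c * \<psi> x"
  by (auto simp: linear_functional_def)

lemma linear_functional_0: "linear_functional \<psi> \<Longrightarrow> \<psi> 0 = 0"
  using linear_functional_scale[of \<psi> 0 0] by (simp add: h_0)

lemma linear_functional_sum: "linear_functional \<psi> \<Longrightarrow> \<psi> (\<Sum>i\<in>I. f i) = (\<Sum>i\<in>I. \<psi> (f i))"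
  by (induction I rule: infinite_finite_induct) (auto simp: linear_functional_0 linear_functional_add)

lemma ex_linear_functional:
  assumes "independent B"
  shows "\<exists>\<psi>. linear_functional \<psi> \<and> (\<forall>x\<in>B. \<psi> x = f x)"
proof -
  interpret vs: vector_space_pair "\<lambda>c (x :: 'k). h c * x" "(*) :: complex \<Rightarrow> complex \<Rightarrow> complex"
    by unfold_locales (simp_all add: algebra_simps)
  obtain g where g: "Vector_Spaces.linear (\<lambda>c x. h c * x) (*) g" "\<forall>x\<in>B. g x = f x"
    using vs.linear_independent_extend[OF assms] by blast
  then have "linear_functional g"
    unfolding linear_functional_def Vector_Spaces.linear_iff by blast
  then show ?thesis
    using g(2) by blast
qed

lemma ex_dual_family:
  assumes "independent B" "bij_betw u {..<n} B"
  obtains \<psi> :: "nat \<Rightarrow> 'k \<Rightarrow> complex" where "\<And>i. linear_functional (\<psi> i)"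
    "\<And>i j. i < n \<Longrightarrow> j < n \<Longrightarrow> \<psi> i (u j) = (if i = j then 1 else 0)"
proof -
  have "\<forall>i. \<exists>\<psi>. linear_functional \<psi> \<and> (\<forall>x\<in>B. \<psi> x = (if x = u i then 1 else 0))"
    by (intro allI ex_linear_functional assms(1))
  then obtain \<psi> where \<psi>: "\<And>i. linear_functional (\<psi> i)" "\<And>i x. x \<in> B \<Longrightarrow> \<psi> i x = (if x = u i then 1 else 0)"
    by metis
  show ?thesis
  proof (rule that)
    fix i j assume ij: "i < n" "j < n"
    then have "u j \<in> B" "u j = u i \<longleftrightarrow> i = j"
      using assms(2) by (auto simp: bij_betw_def inj_on_def)
    then show "\<psi> i (u j) = (if i = j then 1 else 0)"
      using \<psi>(2) by auto
  qed (rule \<psi>(1))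
qed

lemma ex_basis:
  assumes "has_dim W n"
  obtains u :: "nat \<Rightarrow> 'k" where "independent (u ` {..<n})" "bij_betw u {..<n} (u ` {..<n})" "span (u ` {..<n}) = W"
proof -
  obtain B where B: "finite B" "card B = n" "independent B" "span B = W"
    using assms unfolding has_dim_def by metis
  obtain u where "bij_betw u {0..<card B} B"
    using ex_bij_betw_nat_finite[OF B(1)] by blast
  then have u: "bij_betw u {..<n} B"
    using B(2) by (simp add: atLeast0LessThan)
  then have "u ` {..<n} = B"
    by (simp add: bij_betw_def)
  then show ?thesis
    using that[of u] u B by simp
qed

lemma span_family:
  fixes u :: "nat \<Rightarrow> 'k"
  assumes "x \<in> span (u ` {..<n})"
  obtains c where "x = (\<Sum>i<n. h (c i) * u i)"
proof -
  have "\<exists>c. x = (\<Sum>i<n. h (c i) * u i)"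
    using assms
  proof (induction rule: span_induct_alt)
    case base
    show ?case
      by (intro exI[of _ "\<lambda>_. 0"]) (simp add: h_0)
  next
    case (step a y z)
    then obtain c j where c: "z = (\<Sum>i<n. h (c i) * u i)" and j: "j < n" "y = u j"
      by auto
    have "(\<Sum>i<n. h (if i = j then a + c i else c i) * u i) =
        (\<Sum>i<n. (if i = j then h a * u i else 0) + h (c i) * u i)"
      by (rule sum.cong) (auto simp: h_add distrib_right)
    also have "\<dots> = (\<Sum>i<n. if i = j then h a * u i else 0) + z"
      unfolding sum.distrib c ..
    also have "\<dots> = h a * y + z"
      using j by (subst sum.delta) auto
    finally have "h a * y + z = (\<Sum>i<n. h (if i = j then a + c i else c i) * u i)" ..
    then show ?case
      by (rule exI[of _ "\<lambda>i. if i = j then a + c i else c i"])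
  qed
  then show ?thesis
    using that by blast
qed

end

lemma homogeneous_form_functional:
  assumes "functional_on sc V \<phi>"
  shows "homogeneous_form sc V 1 \<phi>"
  using homogeneous_formI[of "{()}" "{()}" "\<lambda>_ _. 1" 1 sc V "\<lambda>_. \<phi>" "\<lambda>_. 1" "\<lambda>_ _. 0"] assms by simp

context split_bundle
begin

lemma sc_1: "sc 1 v = v"
  by (simp add: vec2_eq_iff h_1)

lemma sc_in_V: "v \<in> V \<Longrightarrow> sc c v \<in> V"
  using subspace_scale[OF subspace_LL] by (auto simp: mem_V)

lemma add_in_V: "v \<in> V \<Longrightarrow> w \<in> V \<Longrightarrow> v + w \<in> V"
  using subspace_add[OF subspace_LL] by (auto simp: mem_V)

lemma mem_line: "v \<in> line v"
  unfolding pline_def using sc_1[of v] by (metis rangeI)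

lemma lineD: "v \<in> line w \<Longrightarrow> \<exists>c. v = sc c w"
  by (auto simp: pline_def)

lemma functional_on_add: "functional_on sc V \<phi> \<Longrightarrow> u \<in> V \<Longrightarrow> v \<in> V \<Longrightarrow> \<phi> (u + v) = \<phi> u + \<phi> v"
  and functional_on_scale: "functional_on sc V \<phi> \<Longrightarrow> v \<in> V \<Longrightarrow> \<phi> (sc c v) = c * \<phi> v"
  by (auto simp: functional_on_def)

lemma functional_on_fst: "linear_functional \<psi> \<Longrightarrow> functional_on sc V (\<lambda>v. \<psi> (v $ 1 * k))"
  by (auto simp: functional_on_def linear_functional_add linear_functional_scale algebra_simps
      simp flip: linear_functional_scale)

lemma functional_on_snd: "linear_functional \<psi> \<Longrightarrow> functional_on sc V (\<lambda>v. \<psi> (v $ 2))"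
  by (auto simp: functional_on_def linear_functional_add linear_functional_scale)

text \<open>There is at most one zero, because \<open>const C\<close> is injective.\<close>

lemma finite_zeros_of_line:
  assumes "f \<noteq> (0 :: 'k)"
  shows "finite {t. f + const C t * g = 0}"
proof (cases "g = 0")
  case False
  have "t = t'" if "f + const C t * g = 0" "f + const C t' * g = 0" for t t'
  proof -
    have "const C t * g = const C t' * g"
      using that by (metis add_left_cancel)
    then show ?thesis
      using False by (simp add: h_eq_iff)
  qed
  then have "{t. f + const C t * g = 0} \<subseteq> {SOME t. f + const C t * g = 0}"
    by (auto intro!: some_equality[symmetric])
  then show ?thesis
    by (rule finite_subset) simp
qed (use assms in simp)

lemma S_nonzero: "s \<in> S2 \<union> Sb \<Longrightarrow> s \<in> V \<and> s \<noteq> 0"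
  by (auto simp: S2_def Sb_def)

lemma lines_subset_proj: "S \<subseteq> S2 \<union> Sb \<Longrightarrow> line ` S \<subseteq> proj sc V"
  unfolding proj_def using S_nonzero by blast

text \<open>The joining curve s + t a + t^2 e is quadratic because \<open>S2\<close> comes from the
  bilinear product of f and k.\<close>

lemma irreducible_lines:
  assumes S: "S \<subseteq> S2 \<union> Sb" "S \<noteq> {}"
    and join: "\<And>s s'. s \<in> S \<Longrightarrow> s' \<in> S \<Longrightarrow>
      \<exists>a\<in>V. \<exists>e\<in>V. s + a + e = s' \<and> finite {t. s + sc t (a + sc t e) \<notin> S}"
  shows "irreducible_space (subtopology (zariski sc V) (line ` S))"
proof (rule zariski_irreducible)
  show "sc 1 v = v" for v
    by (rule sc_1)
  show "line ` S \<subseteq> proj sc V"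
    by (rule lines_subset_proj[OF S(1)])
  show "line ` S \<noteq> {}"
    using S(2) by blast
  fix p q assume "p \<in> line ` S" "q \<in> line ` S"
  then obtain s s' where s: "s \<in> S" "p = line s" and s': "s' \<in> S" "q = line s'"
    by blast
  obtain a e where a: "a \<in> V" and e: "e \<in> V" and eq: "s + a + e = s'"
    and fin: "finite {t. s + sc t (a + sc t e) \<notin> S}"
    using join[OF s(1) s'(1)] by blast
  have sV: "s \<in> V"
    using S(1) s(1) S_nonzero by blast
  define w where "w t = s + sc t (a + sc t e)" for t
  have "{t. line (w t) \<notin> line ` S} \<subseteq> {t. s + sc t (a + sc t e) \<notin> S}"
    unfolding w_def by blast
  then have "finite {t. line (w t) \<notin> line ` S}"
    using fin by (rule finite_subset)
  moreover have "\<exists>R. \<forall>t. \<phi> (w t) = poly R t" if \<phi>: "functional_on sc V \<phi>" for \<phi>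
    by (rule exI[of _ "[:\<phi> s, \<phi> a, \<phi> e:]"])
       (simp add: w_def functional_on_add[OF \<phi>] functional_on_scale[OF \<phi>] sV a e sc_in_V add_in_V)
  moreover have "w t \<in> V" for t
    unfolding w_def by (intro add_in_V sc_in_V sV a e)
  moreover have "w 0 = s" "w 1 = s'"
    unfolding eq[symmetric] by (simp_all add: w_def vec2_eq_iff h_0 h_1)
  then have "p = line (w 0)" "q = line (w 1)"
    using s(2) s'(2) by simp_all
  ultimately show "\<exists>w. (\<forall>\<phi>. functional_on sc V \<phi> \<longrightarrow> (\<exists>P. \<forall>t. \<phi> (w t) = poly P t)) \<and> (\<forall>t. w t \<in> V) \<and>
      p = line (w 0) \<and> q = line (w 1) \<and> finite {t. line (w t) \<notin> line ` S}"
    by (intro exI[of _ w]) blast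
qed

lemma irreducible_Sb: "irreducible_space (subtopology (zariski sc V) (line ` Sb))"
proof (rule irreducible_lines)
  obtain g where "g \<in> LL DQ" "g \<noteq> 0"
    using has_dim_pos[OF has_dim_DQ] b by auto
  then have "mk 0 g \<in> Sb"
    by (auto simp: Sb_def mem_V LL_def)
  then show "Sb \<noteq> {}"
    by blast
  fix s s' assume s: "s \<in> Sb" "s' \<in> Sb"
  then have V: "s \<in> V" "s' \<in> V" "s $ 1 = 0" "s' $ 1 = 0" "s $ 2 \<noteq> 0"
    by (auto simp: Sb_def)
  \<comment> \<open>Within the linear family a straight segment suffices: a = s' - s and e =
    0.\<close>
  have "s' + sc (-1) s \<in> V"
    by (intro add_in_V sc_in_V V)
  moreover have "0 \<in> V"
    by (simp add: mem_V LL_def)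
  moreover have "s + (s' + sc (-1) s) + 0 = s'"
    by (simp add: vec2_eq_iff h_minus h_1)
  moreover have "finite {t. s + sc t ((s' + sc (-1) s) + sc t 0) \<notin> Sb}"
  proof (rule finite_subset)
    show "finite {t. s $ 2 + const C t * (s' $ 2 - s $ 2) = 0}"
      by (rule finite_zeros_of_line[OF V(5)])
    have "s + sc t ((s' + sc (-1) s) + sc t 0) \<in> V" for t
      by (intro add_in_V sc_in_V V \<open>0 \<in> V\<close>)
    then show "{t. s + sc t ((s' + sc (-1) s) + sc t 0) \<notin> Sb} \<subseteq> {t. s $ 2 + const C t * (s' $ 2 - s $ 2) = 0}"
      using V by (auto simp: Sb_def h_minus h_1)
  qed
  ultimately show "\<exists>a\<in>V. \<exists>e\<in>V. s + a + e = s' \<and> finite {t. s + sc t (a + sc t e) \<notin> Sb}"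
    by blast
qed simp

lemma one_in_LL_DP: "1 \<in> LL DP"
  unfolding LL_def
proof safe
  fix x assume x: "x \<in> pts C"
  have "vge x 0 1"
    using vge_const[OF x, of 1] by (simp add: h_1)
  then show "vge x (- DP x) 1"
    by (rule vge_mono) (simp add: multiple_point_def)
qed

lemma zero_in_LL: "0 \<in> LL D"
  by (simp add: LL_def)

lemma S2_I: "f \<in> LL DP \<Longrightarrow> f \<noteq> 0 \<Longrightarrow> k \<in> LL DK \<Longrightarrow> mk f (f * k) \<in> S2"
  by (auto simp: S2_def mem_V mult_DP_DK)

lemma S2_E:
  assumes "s \<in> S2"
  obtains f k where "f \<in> LL DP" "f \<noteq> 0" "k \<in> LL DK" "s = mk f (f * k)"
  using assms by (auto simp: S2_def mem_V vec2_eq_iff)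

lemma irreducible_S2: "irreducible_space (subtopology (zariski sc V) (line ` S2))"
proof (rule irreducible_lines)
  show "S2 \<noteq> {}"
    using S2_I[OF one_in_LL_DP _ zero_in_LL] by auto
  fix s s' assume s: "s \<in> S2" "s' \<in> S2"
  obtain f k where f: "f \<in> LL DP" "f \<noteq> 0" "k \<in> LL DK" "s = mk f (f * k)"
    using s(1) by (rule S2_E)
  obtain f' k' where f': "f' \<in> LL DP" "f' \<noteq> 0" "k' \<in> LL DK" "s' = mk f' (f' * k')"
    using s(2) by (rule S2_E)
  have df: "f' - f \<in> LL DP" and dk: "k' - k \<in> LL DK"
    using f f' by (auto intro: subspace_diff[OF subspace_LL])
  \<comment> \<open>The coefficients of t and t^2 when f and k both move along segments to f' and
    k'.\<close>
  let ?a = "mk (f' - f) (f * (k' - k) + (f' - f) * k)" and ?e = "mk 0 ((f' - f) * (k' - k))"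
  have w: "s + sc t (?a + sc t ?e) =
      mk (f + const C t * (f' - f)) ((f + const C t * (f' - f)) * (k + const C t * (k' - k)))" for t
    by (simp add: f(4) vec2_eq_iff algebra_simps)
  have "?a \<in> V" "?e \<in> V"
    using df dk f by (auto simp: mem_V mult_DP_DK zero_in_LL intro: subspace_add[OF subspace_LL])
  moreover have "s + ?a + ?e = s'"
    by (simp add: f(4) f'(4) vec2_eq_iff algebra_simps)
  moreover have "finite {t. s + sc t (?a + sc t ?e) \<notin> S2}"
  proof (rule finite_subset)
    show "finite {t. f + const C t * (f' - f) = 0}"
      by (rule finite_zeros_of_line[OF f(2)])
    have "s + sc t (?a + sc t ?e) \<in> S2" if "f + const C t * (f' - f) \<noteq> 0" for t
      unfolding w using that f df dk
      by (intro S2_I subspace_add[OF subspace_LL] subspace_scale[OF subspace_LL])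
    then show "{t. s + sc t (?a + sc t ?e) \<notin> S2} \<subseteq> {t. f + const C t * (f' - f) = 0}"
      by blast
  qed
  ultimately show "\<exists>a\<in>V. \<exists>e\<in>V. s + a + e = s' \<and> finite {t. s + sc t (a + sc t e) \<notin> S2}"
    by blast
qed simp

section \<open>Closedness of the degree b stratum and of the resonance variety\<close>

lemma closed_Sb: "closedin (zariski sc V) (line ` Sb)"
proof (rule zariski_closedI)
  show "line ` Sb \<subseteq> proj sc V"
    by (rule lines_subset_proj) simp
  fix L assume L: "L \<in> proj sc V" "L \<notin> line ` Sb"
  then obtain s where s: "s \<in> V" "s \<noteq> 0" "L = line s"
    by (auto simp: proj_def)
  then have s1: "s $ 1 \<noteq> 0"
    using L(2) by (auto simp: Sb_def vec2_eq_iff)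
  then have "independent {s $ 1}"
    by simp
  then obtain \<psi> where \<psi>: "linear_functional \<psi>" "\<psi> (s $ 1) = 1"
    using ex_linear_functional[of "{s $ 1}" "\<lambda>_. 1"] by auto
  have "functional_on sc V (\<lambda>v. \<psi> (v $ 1 * 1))"
    by (rule functional_on_fst[OF \<psi>(1)])
  then have "homogeneous_form sc V 1 (\<lambda>v. \<psi> (v $ 1 * 1))"
    by (rule homogeneous_form_functional)
  moreover have "\<exists>v\<in>L. \<psi> (v $ 1 * 1) \<noteq> 0"
    using s(3) mem_line[of s] \<psi>(2) by (intro bexI[of _ s]) auto
  moreover have "\<forall>L'\<in>line ` Sb. \<forall>v\<in>L'. \<psi> (v $ 1 * 1) = 0"
    using linear_functional_0[OF \<psi>(1)] by (auto simp: Sb_def dest!: lineD)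
  ultimately show "\<exists>f d. homogeneous_form sc V d f \<and> (\<exists>v\<in>L. f v \<noteq> 0) \<and> (\<forall>L'\<in>line ` Sb. \<forall>v\<in>L'. f v = 0)"
    by blast
qed

text \<open>
  A section \<open>(f, g)\<close> is resonant iff \<open>g\<close> depends linearly on the products of \<open>f\<close> with a basis
  of \<open>H\<^sup>0(O(bQ - 2P))\<close>, i.e. iff certain maximal minors vanish; as \<open>b > 2\<close> they also vanish at \<open>f = 0\<close>.
\<close>

lemma closed_S: "closedin (zariski sc V) (line ` (S2 \<union> Sb))"
proof (rule zariski_closedI)
  show "line ` (S2 \<union> Sb) \<subseteq> proj sc V"
    by (rule lines_subset_proj) simp
  fix L assume L: "L \<in> proj sc V" "L \<notin> line ` (S2 \<union> Sb)"
  then obtain s where s: "s \<in> V" "s \<noteq> 0" "L = line s"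
    by (auto simp: proj_def)
  then have nres: "s \<notin> S2" "s \<notin> Sb"
    using L(2) by blast+
  then have s1: "s $ 1 \<noteq> 0"
    using s by (auto simp: Sb_def vec2_eq_iff)
  have nk: "s $ 2 \<notin> (*) (s $ 1) ` LL DK"
    using nres(1) s(1) s1 by (auto simp: S2_def)
  define m where "m = nat (b - 2)"
  have m: "m > 0"
    using b by (simp add: m_def)
  obtain u where u: "independent (u ` {..<m})" "bij_betw u {..<m} (u ` {..<m})" "span (u ` {..<m}) = LL DK"
    by (rule ex_basis[OF has_dim_DK[folded m_def]])
  have unit: "s $ 1 * inverse (s $ 1) = 1"
    using s1 by simp
  \<comment> \<open>The columns of the matrix at s. They are independent since s is not resonant, so
    functionals dual to them make the matrix at s the identity.\<close>
  define x where "x j = (if j < m then s $ 1 * u j else s $ 2)" for j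
  have ximg: "x ` {..<Suc m} = insert (s $ 2) ((*) (s $ 1) ` u ` {..<m})"
    unfolding lessThan_Suc by (auto simp: x_def)
  have nspan: "s $ 2 \<notin> span ((*) (s $ 1) ` u ` {..<m})"
    using nk u(3) by (simp add: span_mult_unit[OF unit])
  then have nin: "s $ 2 \<notin> (*) (s $ 1) ` u ` {..<m}"
    by (rule contrapos_nn) (rule span_base)
  have ind: "independent (x ` {..<Suc m})"
    unfolding ximg using nspan independent_mult_unit[OF unit u(1)] by (simp add: independent_insert)
  have "inj_on x {..<Suc m}"
  proof (rule inj_onI)
    fix i j assume ij: "i \<in> {..<Suc m}" "j \<in> {..<Suc m}" "x i = x j"
    have "s $ 1 * u l \<noteq> s $ 2" "s $ 2 \<noteq> s $ 1 * u l" if "l < m" for l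
    proof -
      have "s $ 1 * u l \<in> (*) (s $ 1) ` u ` {..<m}"
        using that by (intro imageI) simp
      then show "s $ 1 * u l \<noteq> s $ 2" "s $ 2 \<noteq> s $ 1 * u l"
        using nin by metis+
    qed
    then show "i = j"
      using ij u(2) s1 by (auto simp: x_def less_Suc_eq bij_betw_def inj_on_def split: if_splits)
  qed
  then have bij: "bij_betw x {..<Suc m} (x ` {..<Suc m})"
    by (simp add: bij_betw_def)
  obtain \<psi> where \<psi>: "\<And>i. linear_functional (\<psi> i)"
    and dual: "\<And>i j. i < Suc m \<Longrightarrow> j < Suc m \<Longrightarrow> \<psi> i (x j) = (if i = j then 1 else 0)"
    by (rule ex_dual_family[OF ind bij]) blast
  define \<Phi> :: "nat \<Rightarrow> nat \<Rightarrow> 'k ^ 2 \<Rightarrow> complex" where "\<Phi> i j = (if j < m then (\<lambda>v. \<psi> i (v $ 1 * u j)) else (\<lambda>v. \<psi> i (v $ 2)))" for i j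
  let ?D = "\<lambda>v. leibniz_det (Suc m) (\<lambda>i j. \<Phi> i j v)"
  have "homogeneous_form sc V (Suc m) ?D"
    by (rule homogeneous_form_leibniz_det) (simp add: \<Phi>_def functional_on_fst[OF \<psi>] functional_on_snd[OF \<psi>])
  moreover have "?D s = 1"
  proof (rule leibniz_det_id)
    fix i j assume "i < Suc m" "j < Suc m"
    moreover have "\<Phi> i j s = \<psi> i (x j)"
      by (simp add: \<Phi>_def x_def)
    ultimately show "\<Phi> i j s = (if i = j then 1 else 0)"
      using dual by simp
  qed
  then have "\<exists>v\<in>L. ?D v \<noteq> 0"
    using s(3) mem_line[of s] by (intro bexI[of _ s]) auto
  moreover have "?D v = 0" if v: "v \<in> line s'" and s': "s' \<in> S2 \<union> Sb" for v s'
  proof -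
    obtain c where c: "v = sc c s'"
      using lineD[OF v] by blast
    show ?thesis
    proof (cases "s' \<in> Sb")
      case True
      then have "v $ 1 = 0"
        using c by (simp add: Sb_def)
      \<comment> \<open>With f = 0 column 0 vanishes; it is a product column because m = b - 2 >
        0.\<close>
      then show ?thesis
        using m linear_functional_0[OF \<psi>] by (intro leibniz_det_zero_column[of 0]) (auto simp: \<Phi>_def)
    next
      case False
      then obtain k where k: "k \<in> LL DK" "s' $ 2 = s' $ 1 * k"
        using s' by (auto simp: S2_def)
      then have vk: "v $ 2 = v $ 1 * k"
        using c by simp
      obtain a where a: "k = (\<Sum>j<m. const C (a j) * u j)"
        using span_family[of k u m] k(1) u(3) by auto
      have "\<Phi> i m v = (\<Sum>j<m. a j * \<Phi> i j v)" for i
      proof -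
        have "v $ 2 = (\<Sum>j<m. const C (a j) * (v $ 1 * u j))"
          unfolding vk a by (simp add: sum_distrib_left mult_ac)
        then show ?thesis
          by (simp add: \<Phi>_def linear_functional_sum[OF \<psi>] linear_functional_scale[OF \<psi>])
      qed
      then show ?thesis
        by (intro leibniz_det_dependent[of m _ _ a]) auto
    qed
  qed
  then have "\<forall>L'\<in>line ` (S2 \<union> Sb). \<forall>v\<in>L'. ?D v = 0"
    by blast
  ultimately show "\<exists>f d. homogeneous_form sc V d f \<and> (\<exists>v\<in>L. f v \<noteq> 0) \<and> (\<forall>L'\<in>line ` (S2 \<union> Sb). \<forall>v\<in>L'. f v = 0)"
    by blast
qed

text \<open>
  Up to scaling, \<open>f \<in> H\<^sup>0(O(2P))\<close> depends on one parameter and \<open>k \<in> H\<^sup>0(O(bQ - 2P))\<close> on \<open>b - 3\<close>, so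
  that \<open>homogeneous_relation\<close> applies to the \<open>b\<close> coordinates of \<open>f k\<close> in \<open>H\<^sup>0(O(bQ))\<close>.
\<close>

lemma equation_of_products:
  obtains d F g where "homogeneous_form sc V d (\<lambda>v. F (v $ 2))"
    "\<And>f k. f \<in> LL DP \<Longrightarrow> k \<in> LL DK \<Longrightarrow> F (f * k) = 0" "g \<in> LL DQ" "g \<noteq> 0" "F g \<noteq> (0 :: complex)"
proof -
  define m where "m = nat (b - 2)"
  have m: "m > 0" and nb: "nat b = Suc (Suc m)"
    using b by (auto simp: m_def)
  obtain q where q: "independent (q ` {..<Suc (Suc m)})" "bij_betw q {..<Suc (Suc m)} (q ` {..<Suc (Suc m)})"
    "span (q ` {..<Suc (Suc m)}) = LL DQ"
    by (rule ex_basis[OF has_dim_DQ[unfolded nb]])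
  obtain y where y: "\<And>i. linear_functional (y i)"
    and dual: "\<And>i j. i < Suc (Suc m) \<Longrightarrow> j < Suc (Suc m) \<Longrightarrow> y i (q j) = (if i = j then 1 else 0)"
    by (rule ex_dual_family[OF q(1,2)]) blast
  obtain u where u: "span (u ` {..<m}) = LL DK"
    by (rule ex_basis[OF has_dim_DK[folded m_def]])
  obtain f :: "nat \<Rightarrow> 'k" where f: "span (f ` {..<2}) = LL DP"
    by (rule ex_basis[OF has_dim_DP])
  define z where "z j p = p j" for j and p :: "nat \<Rightarrow> complex"
  \<comment> \<open>Affine charts with leading coefficient 1: p 0 is the parameter of f, and p 1,
    ..., p (m - 1) are those of k.\<close>
  define F1 where "F1 p = f 0 + const C (p 0) * f 1" for p :: "nat \<Rightarrow> complex"
  define K1 where "K1 p = u 0 + (\<Sum>j\<in>{1..<m}. const C (p j) * u j)" for p :: "nat \<Rightarrow> complex"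
  let ?span = "fun_algebra.span (box_monomials m z 1)"
  have mon: "(\<lambda>p. \<Prod>j\<in>J. p j) \<in> ?span" if "J \<subseteq> {..<m}" for J
  proof (rule fun_algebra.span_base, rule box_monomialsI)
    have "(\<Prod>j<m. z j p ^ (if j \<in> J then 1 else 0)) = (\<Prod>j\<in>J. p j)" for p
    proof -
      have "(\<Prod>j<m. z j p ^ (if j \<in> J then 1 else 0)) = (\<Prod>j<m. if j \<in> J then p j else 1)"
        by (rule prod.cong) (auto simp: z_def)
      also have "\<dots> = (\<Prod>j\<in>{..<m} \<inter> J. p j)"
        by (simp add: prod.inter_restrict)
      also have "{..<m} \<inter> J = J"
        using that by blast
      finally show ?thesis .
    qed
    then show "(\<lambda>p. \<Prod>j\<in>J. p j) = (\<lambda>p. \<Prod>j<m. z j p ^ (if j \<in> J then 1 else 0))"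
      by (simp add: fun_eq_iff)
  qed simp
  have const1: "(\<lambda>p. c) \<in> ?span" for c
    using fun_algebra.span_scale[OF mon[of "{}"], of c] by simp
  have lin1: "(\<lambda>p. p j * c) \<in> ?span" if "j < m" for j c
    using fun_algebra.span_scale[OF mon[of "{j}"], of c] that by (simp add: mult.commute)
  have lin2: "(\<lambda>p. p 0 * p j * c) \<in> ?span" if "j \<in> {1..<m}" for j c
    using fun_algebra.span_scale[OF mon[of "{0, j}"], of c] that by (simp add: mult_ac)
  have sum_fun: "(\<lambda>p. \<Sum>j\<in>J. G j p) \<in> ?span" if "\<And>j. j \<in> J \<Longrightarrow> G j \<in> ?span" for J and G :: "nat \<Rightarrow> _"
  proof -
    have "(\<lambda>p. \<Sum>j\<in>J. G j p) = (\<Sum>j\<in>J. G j)"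
    proof (rule ext)
      show "(\<Sum>j\<in>J. G j p) = (\<Sum>j\<in>J. G j) p" for p
        by (induction J rule: infinite_finite_induct) (auto simp: zero_fun_def plus_fun_def)
    qed
    then show ?thesis
      using that by (simp add: fun_algebra.span_sum)
  qed
  have add_fun: "(\<lambda>p. G p + H p) \<in> ?span" if "G \<in> ?span" "H \<in> ?span" for G H
    using fun_algebra.span_add[OF that] by (simp add: plus_fun_def)
  \<comment> \<open>The factors use disjoint parameters, so their product involves only monomials
    with all exponents at most 1.\<close>
  have w: "(\<lambda>p. y i (F1 p * K1 p)) \<in> ?span" for i
  proof -
    have "y i (F1 p * K1 p) = (y i (f 0 * u 0) + (\<Sum>j\<in>{1..<m}. p j * y i (f 0 * u j))) +
        (p 0 * y i (f 1 * u 0) + (\<Sum>j\<in>{1..<m}. p 0 * p j * y i (f 1 * u j)))" for p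
    proof -
      have "F1 p * K1 p = (f 0 * u 0 + (\<Sum>j\<in>{1..<m}. const C (p j) * (f 0 * u j))) +
          (const C (p 0) * (f 1 * u 0) + (\<Sum>j\<in>{1..<m}. const C (p 0 * p j) * (f 1 * u j)))"
        by (simp add: F1_def K1_def distrib_left distrib_right sum_distrib_left sum.distrib h_mult mult_ac)
      then show ?thesis
        by (simp only: linear_functional_add[OF y] linear_functional_sum[OF y] linear_functional_scale[OF y])
    qed
    moreover have "(\<lambda>p. (y i (f 0 * u 0) + (\<Sum>j\<in>{1..<m}. p j * y i (f 0 * u j))) +
        (p 0 * y i (f 1 * u 0) + (\<Sum>j\<in>{1..<m}. p 0 * p j * y i (f 1 * u j)))) \<in> ?span"
      using m by (intro add_fun sum_fun const1 lin1 lin2) auto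
    ultimately show ?thesis
      by simp
  qed
  obtain N c where c: "\<exists>r<(N + 1) ^ Suc m. c r \<noteq> 0"
    and rel: "\<And>p. digit_form (Suc m) N c (\<lambda>i. y i (F1 p * K1 p)) = 0"
    by (rule homogeneous_relation[of m "\<lambda>i p. y i (F1 p * K1 p)" z, OF w]) blast
  define F where "F x = digit_form (Suc m) N c (\<lambda>i. y i x)" for x
  define d where "d = Suc m * N"
  have form: "homogeneous_form sc V d (\<lambda>v. F (v $ 2))"
    unfolding F_def d_def digit_form_def
    by (rule homogeneous_formI[where \<phi> = "\<lambda>i v. y i (v $ 2)" and g = "\<lambda>_ i. i"])
       (auto simp only: finite_lessThan finite_atMost sum_digit_exponent functional_on_snd[OF y])
  have F_scale: "F (const C a * x) = a ^ d * F x" for a x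
  proof -
    have "(\<Prod>i\<le>Suc m. (a * y i x) ^ digit_exponent (Suc m) N r i) =
        a ^ d * (\<Prod>i\<le>Suc m. y i x ^ digit_exponent (Suc m) N r i)" for r
      unfolding power_mult_distrib prod.distrib power_sum[symmetric] sum_digit_exponent d_def ..
    then show ?thesis
      unfolding F_def digit_form_def linear_functional_scale[OF y] sum_distrib_left by (simp add: mult.left_commute)
  qed
  have vanish: "F (x * k) = 0" if x: "x \<in> LL DP" and k: "k \<in> LL DK" for x k
  proof -
    obtain \<alpha> where \<alpha>: "x = (\<Sum>i<2. const C (\<alpha> i) * f i)"
      using span_family[of x f 2] x f by auto
    obtain \<kappa> where \<kappa>: "k = (\<Sum>j<m. const C (\<kappa> j) * u j)"
      using span_family[of k u m] k u by auto
    \<comment> \<open>Once both leading coefficients are nonzero, the factors are scalar multiples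
      of \<open>F1 p\<close> and \<open>K1 p\<close>. Moving by t along f 0 and u 0 achieves this
      for all but two values of t.\<close>
    have generic: "F ((x + const C t * f 0) * (k + const C t * u 0)) = 0"
      if t: "\<alpha> 0 + t \<noteq> 0" "\<kappa> 0 + t \<noteq> 0" for t
    proof -
      define p where "p j = (if j = 0 then \<alpha> 1 / (\<alpha> 0 + t) else \<kappa> j / (\<kappa> 0 + t))" for j
      have cancel: "const C a * (const C (e / a) * v) = const C e * v" if "a \<noteq> 0" for a e v
        using that by (simp flip: h_mult mult.assoc)
      have "x + const C t * f 0 = const C (\<alpha> 0 + t) * F1 p"
      proof -
        have "const C (\<alpha> 0 + t) * F1 p = const C (\<alpha> 0 + t) * f 0 + const C (\<alpha> 1) * f 1"
          unfolding F1_def distrib_left using t(1) by (simp add: p_def cancel)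
        also have "\<dots> = (const C (\<alpha> 0) * f 0 + const C (\<alpha> 1) * f 1) + const C t * f 0"
          by (simp add: h_add distrib_right)
        also have "const C (\<alpha> 0) * f 0 + const C (\<alpha> 1) * f 1 = x"
          by (simp add: \<alpha> numeral_2_eq_2)
        finally show ?thesis ..
      qed
      moreover have "k + const C t * u 0 = const C (\<kappa> 0 + t) * K1 p"
      proof -
        have "{..<m} = insert 0 {1..<m}"
          using m by auto
        then have k_eq: "k = const C (\<kappa> 0) * u 0 + (\<Sum>j\<in>{1..<m}. const C (\<kappa> j) * u j)"
          unfolding \<kappa> by simp
        have "const C (\<kappa> 0 + t) * (\<Sum>j\<in>{1..<m}. const C (p j) * u j) = (\<Sum>j\<in>{1..<m}. const C (\<kappa> j) * u j)"
          unfolding sum_distrib_left using t(2) by (intro sum.cong) (auto simp: p_def cancel)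
        then have "const C (\<kappa> 0 + t) * K1 p = const C (\<kappa> 0 + t) * u 0 + (\<Sum>j\<in>{1..<m}. const C (\<kappa> j) * u j)"
          unfolding K1_def distrib_left by (simp only:)
        then show ?thesis
          unfolding k_eq by (simp add: h_add distrib_right)
      qed
      ultimately have "(x + const C t * f 0) * (k + const C t * u 0) =
          const C ((\<alpha> 0 + t) * (\<kappa> 0 + t)) * (F1 p * K1 p)"
        by (simp add: h_mult mult_ac)
      then show ?thesis
        using rel[of p] by (simp add: F_scale) (simp add: F_def)
    qed
    define R where "R i = [:y i (x * k), y i (x * u 0 + f 0 * k), y i (f 0 * u 0):]" for i
    have R: "y i ((x + const C t * f 0) * (k + const C t * u 0)) = poly (R i) t" for i t
    proof -
      have "(x + const C t * f 0) * (k + const C t * u 0) =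
          x * k + const C t * ((x * u 0 + f 0 * k) + const C t * (f 0 * u 0))"
        by (simp add: algebra_simps)
      then show ?thesis
        by (simp only: R_def linear_functional_add[OF y] linear_functional_scale[OF y] poly_pCons poly_0) simp
    qed
    \<comment> \<open>The value of F along this perturbation is a polynomial in t with infinitely
      many zeros, so it also vanishes at t = 0.\<close>
    define S where "S = (\<Sum>r<(N + 1) ^ Suc m. smult (c r) (\<Prod>i\<le>Suc m. R i ^ digit_exponent (Suc m) N r i))"
    have S: "F ((x + const C t * f 0) * (k + const C t * u 0)) = poly S t" for t
      unfolding F_def digit_form_def S_def R by (simp only: poly_sum poly_smult poly_prod poly_power)
    have "infinite (UNIV - {- \<alpha> 0, - \<kappa> 0})"
      by (simp add: infinite_UNIV_char_0)
    moreover have "UNIV - {- \<alpha> 0, - \<kappa> 0} \<subseteq> {t. poly S t = 0}"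
    proof
      fix t assume "t \<in> UNIV - {- \<alpha> 0, - \<kappa> 0}"
      then have "\<alpha> 0 + t \<noteq> 0" "\<kappa> 0 + t \<noteq> 0"
        by (simp_all add: add_eq_0_iff)
      then have "poly S t = 0"
        by (rule generic[of t, unfolded S])
      then show "t \<in> {t. poly S t = 0}"
        by simp
    qed
    ultimately have "infinite {t. poly S t = 0}"
      by (meson finite_subset)
    then have "S = 0"
      using poly_roots_finite by blast
    then show ?thesis
      using S[of 0] by (simp only: h_0 mult_zero_left add_0_right poly_0)
  qed
  obtain r0 where r0: "r0 < (N + 1) ^ Suc m" "c r0 \<noteq> 0"
    using c by blast
  obtain t where t: "digit_form (Suc m) N c (\<lambda>i. if i < Suc m then t ^ ((N + 1) ^ i) else 1) \<noteq> 0"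
    using digit_form_nonzero[where c = c, OF r0] by blast
  \<comment> \<open>The Kronecker point where the form is nonzero, realized as the coordinate vector
    of a section g in the basis q.\<close>
  define \<tau> where "\<tau> i = (if i < Suc m then t ^ ((N + 1) ^ i) else 1)" for i
  define g where "g = (\<Sum>j<Suc (Suc m). const C (\<tau> j) * q j)"
  have yg: "y i g = \<tau> i" if "i \<le> Suc m" for i
  proof -
    have "y i g = (\<Sum>j<Suc (Suc m). \<tau> j * y i (q j))"
      unfolding g_def by (simp only: linear_functional_sum[OF y] linear_functional_scale[OF y])
    also have "\<dots> = (\<Sum>j<Suc (Suc m). if j = i then \<tau> j else 0)"
      by (rule sum.cong) (use dual that in auto)
    also have "\<dots> = \<tau> i"
      using that by simp
    finally show ?thesis .
  qed
  have "F g = digit_form (Suc m) N c \<tau>"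
    unfolding F_def digit_form_def by (intro sum.cong prod.cong arg_cong2[where f = "(*)"] refl) (simp add: yg)
  then have "F g \<noteq> 0"
    using t unfolding \<tau>_def by simp
  moreover have "g \<in> LL DQ"
    unfolding g_def q(3)[symmetric] by (intro span_sum span_scale span_base) auto
  \<comment> \<open>The last coordinate of g is 1.\<close>
  moreover have "g \<noteq> 0"
    using yg[of "Suc m"] linear_functional_0[OF y] by (auto simp: \<tau>_def)
  ultimately show ?thesis
    using that[OF form vanish] by blast
qed

lemma Sb_not_in_closure: "\<not> line ` Sb \<subseteq> zariski sc V closure_of (line ` S2)"
proof -
  obtain d F g where F: "homogeneous_form sc V d (\<lambda>v. F (v $ 2))"
    "\<And>f k. f \<in> LL DP \<Longrightarrow> k \<in> LL DK \<Longrightarrow> F (f * k) = 0" "g \<in> LL DQ" "g \<noteq> 0" "F g \<noteq> (0 :: complex)"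
    by (rule equation_of_products) blast
  have s: "mk 0 g \<in> Sb"
    using F(3,4) by (auto simp: Sb_def mem_V zero_in_LL)
  have "line (mk 0 g) \<notin> zariski sc V closure_of (line ` S2)"
  proof (rule zariski_not_in_closure[OF F(1) mem_line])
    show "F (mk 0 g $ 2) \<noteq> 0"
      using F(5) by simp
    fix L v assume "L \<in> line ` S2" "v \<in> L"
    then obtain s c where s: "s \<in> S2" "v = sc c s"
      using lineD by blast
    obtain f k where f: "f \<in> LL DP" "k \<in> LL DK" "s = mk f (f * k)"
      using s(1) by (rule S2_E)
    have "v $ 2 = (const C c * f) * k"
      using s(2) f(3) by (simp add: mult.assoc)
    then show "F (v $ 2) = 0"
      using F(2) f subspace_scale[OF subspace_LL] by metis
  qed
  then show ?thesis
    using s by blast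
qed

text \<open>The section (1, 0) has nonzero first component, the case k = 0.\<close>

lemma S2_not_in_Sb: "\<not> line ` S2 \<subseteq> line ` Sb"
proof
  assume sub: "line ` S2 \<subseteq> line ` Sb"
  have "mk 1 (1 * 0) \<in> S2"
    by (rule S2_I[OF one_in_LL_DP _ zero_in_LL]) simp
  then obtain s where s: "s \<in> Sb" "line (mk 1 (1 * 0)) = line s"
    using sub by blast
  then obtain c where "mk 1 (1 * 0) = sc c s"
    using mem_line[of "mk 1 (1 * 0)"] lineD by metis
  then have "(1 :: 'k) = const C c * s $ 1"
    by (metis cscale_nth vector_2(1))
  then show False
    using s(1) by (simp add: Sb_def)
qed

lemma components:
  "irreducible_components (subtopology (proj_sections C E) (resonance_variety C E)) =
     {proj_sections C E closure_of resonance_stratum C E 2, resonance_stratum C E b} \<and>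
   proj_sections C E closure_of resonance_stratum C E 2 \<noteq> resonance_stratum C E b"
proof -
  let ?T = "zariski sc V"
  let ?R = "line ` (S2 \<union> Sb)" and ?A = "?T closure_of (line ` S2)" and ?B = "line ` Sb"
  have R: "resonance_variety C E = ?R"
    unfolding resonance_variety_eq by (simp add: image_Un)
  have sub2: "line ` S2 \<subseteq> ?A"
    by (rule closure_of_subset) (use lines_subset_proj[of S2] in \<open>simp add: topspace_zariski\<close>)
  have AR: "?A \<subseteq> ?R"
    by (rule closure_of_minimal[OF _ closed_S]) blast
  have BR: "?B \<subseteq> ?R"
    by blast
  have Rtop: "?R \<subseteq> topspace ?T"
    using lines_subset_proj[of "S2 \<union> Sb"] by (simp add: topspace_zariski)
  have AB: "\<not> ?A \<subseteq> ?B" "\<not> ?B \<subseteq> ?A"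
    using S2_not_in_Sb sub2 Sb_not_in_closure by blast+
  have "irreducible_components (subtopology ?T ?R) = {?A, ?B}"
  proof (rule irreducible_components_pair)
    show "?A \<union> ?B = topspace (subtopology ?T ?R)"
      using sub2 AR BR Rtop by auto
    show "closedin (subtopology ?T ?R) ?A"
      by (rule closedin_subset_topspace[OF closedin_closure_of AR])
    show "closedin (subtopology ?T ?R) ?B"
      by (rule closedin_subset_topspace[OF closed_Sb BR])
    have "subtopology (subtopology ?T ?R) ?A = subtopology ?T ?A" "subtopology (subtopology ?T ?R) ?B = subtopology ?T ?B"
      using AR BR by (simp_all add: subtopology_subtopology Int_absorb1)
    then show "irreducible_space (subtopology (subtopology ?T ?R) ?A)"
      "irreducible_space (subtopology (subtopology ?T ?R) ?B)"
      using irreducible_Sb irreducible_space_closure[OF irreducible_S2] lines_subset_proj[of S2]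
      by (simp_all add: topspace_zariski)
  qed (use AB in blast)+
  then show ?thesis
    using AB unfolding proj_sections_def R stratum_2 stratum_b by blast
qed

end

theorem proposition3p10:
  fixes C :: "('n::finite, 'k::field) variety_data"
    and P Q :: "'n ppoint"
    and b :: int
    and E :: "'n ppoint \<Rightarrow> ('k ^ 2) set"
  assumes "elliptic_curve C"
    and "P \<in> pts C" and "Q \<in> pts C"
    and "b \<ge> 3"
    and "E = direct_sum (line_bundle C (multiple_point 2 P)) (line_bundle C (multiple_point b Q))"
  shows "irreducible_components (subtopology (proj_sections C E) (resonance_variety C E)) =
           {proj_sections C E closure_of resonance_stratum C E 2, resonance_stratum C E b} \<and>
         proj_sections C E closure_of resonance_stratum C E 2 \<noteq> resonance_stratum C E b"
proof -
  interpret split_bundle C P Q b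
    using assms(1-4) by unfold_locales (auto simp: elliptic_curve_def)
  have E: "E = split_bundle.E C P Q b"
    unfolding assms(5) E_def ..
  show ?thesis
    unfolding E by (rule components)
qed

end
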